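(* Let $\mathsf X$, $(\Xi,\mathcal G,\mu)$, $f$, $g$, $F$, $G$, $D(s)$, $\mathcal D$ and the iterates $(x_n^{\gamma,\nu})_n$ of the constant step stochastic Douglas-Rachford algorithm be as defined in the context. Assume that all of the following hold. (A1) For every compact set $\mathcal K\subset \mathsf X$, there exists $\varepsilon>0$ such that $\sup_{x\in\mathcal K\cap\mathcal D}\int \|\partial g_0(x,s)\|^{1+\varepsilon}\,\mu(ds)<\infty$. (A2) For $\mu$-a.e. $s\in\Xi$, $f(\cdot,s)$ is differentiable, and there exists a closed ball in $\mathsf X$ such that $\|\nabla f(x,s)\|\le M(s)$ for all $x$ in this ball, where $M(s)$ is $\mu$-integrable. Moreover, for every compact set $\mathcal K\subset\mathsf X$, there exists $\varepsilon>0$ such that $\sup_{x\in\mathcal K}\int\|\nabla f(x,s)\|^{1+\varepsilon}\,\mu(ds)<\infty$. (A3) There exists $C>0$ such that for all $x\in\mathsf X$, $\int d(x,D(s))^2\,\mu(ds)\ge C\, d(x,\mathcal D)^2$. (A4) For every compact set $\mathcal K\subset\mathsf X$, there exist $\varepsilon,C,\gamma_0>0$ such that for all $\gamma\in(0,\gamma_0]$ and all $x\in\mathcal K$, $$\frac1{\gamma^{1+\varepsilon}}\int\|\mathrm{prox}_{\gamma g(\cdot,s)}(x)-\Pi_{\mathrm{cl}(D(s))}(x)\|^{1+\varepsilon}\,\mu(ds)<C .$$ (A5) There exists $L>0$ such that for $\mu$-a.e. $s$, $\nabla f(\cdot,s)$ is $L$-Lipschitz continuous. (A6) There exist $x_\star\in\arg\min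 (F+G)$ and $\varphi\in L^2(\Xi,\mathsf X)$ such that $\varphi(s)\in\partial g(x_\star,s)$ for $\mu$-a.e. $s$, $\nabla f(x_\star,\cdot)\in L^2(\Xi,\mathsf X)$, and $\int\nabla f(x_\star,s)\,\mu(ds)+\int\varphi(s)\,\mu(ds)=0$. (A7) The function $F+G$ satisfies one of the following properties: (a) $F+G$ is coercive, i.e. $F(x)+G(x)\to+\infty$ as $\|x\|\to+\infty$; (b) $F+G$ is supercoercive, i.e. $\frac{F(x)+G(x)}{\|x\|}\to+\infty$ as $\|x\|\to+\infty$. (A8) There exist $\gamma_0>0$ and $C>0$ such that for all $\gamma\in(0,\gamma_0]$ and all $x\in\mathsf X$, $$\int\Big(\|\nabla f_\gamma(x,s)\|+\frac1\gamma\|\mathrm{prox}_{\gamma g(\cdot,s)}(x)-\Pi_{\mathrm{cl}(D(s))}(x)\|\Big)\,\mu(ds)\le C\big(1+|F^\gamma(x)+G^\gamma(x)|\big).$$ Then, for each probability measure $\nu$ on $\mathsf X$ having a finite second moment and for any $\varepsilon>0$, $$\limsup_{n\to\infty}\frac1{n+1}\sum_{k=0}^n\mathbb P\big(d(x_k^{\gamma,\nu},\arg\min(F+G))>\varepsilon\big)\xrightarrow[\gamma\to0]{}0 .$$ Moreover, if property (b) of (A7) holds, then, for each such $\nu$ and $\varepsilon$, setting $\bar x_n^{\gamma,\nu}=\frac1n\sum_{k=1}^n x_k^{\gamma,\nu}$, $$\limsup_{n\to\infty}\ \mathbb P\big(d(\bar x_n^{\gamma,\nu},\arg\min(F+G))\ge\varepsilon\big)\xrightarrow[\gamma\to0]{}0$$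 and $$\limsup_{n\to\infty}\ d\big(\mathbb E(\bar x_n^{\gamma,\nu}),\arg\min(F+G)\big)\xrightarrow[\gamma\to0]{}0 .$$
   Context: Setting. $\mathsf X$ is a Euclidean space (finite-dimensional real inner product space) with norm $\|\cdot\|$ and Borel $\sigma$-field $\mathscr B(\mathsf X)$. $\Gamma_0(\mathsf X)$ is the set of convex, lower semicontinuous, proper functions $\mathsf X\to(-\infty,+\infty]$. $\xi$ is a random variable from a probability space $(\Omega,\mathcal F,\mathbb P)$ into a measurable space $(\Xi,\mathcal G)$, with distribution $\mu$. $f,g:\mathsf X\times\Xi\to(-\infty,+\infty]$ are such that $f(\cdot,s)\in\Gamma_0(\mathsf X)$ and $g(\cdot,s)\in\Gamma_0(\mathsf X)$ for every $s\in\Xi$. It is understood that the functions of $s$ being integrated, and the maps $(x,s)\mapsto \mathrm{prox}_{\gamma f(\cdot,s)}(x)$ and $(x,s)\mapsto\mathrm{prox}_{\gamma g(\cdot,s)}(x)$ used in the algorithm, are measurable. Set $$F(x)=\mathbb E_\xi(f(x,\xi))=\int f(x,s)\,\mu(ds),\qquad G(x)=\mathbb E_\xi(g(x,\xi))=\int g(x,s)\,\mu(ds),$$ and assume $F,G\in\Gamma_0(\mathsf X)$. Notation. For $h\in\Gamma_0(\mathsf X)$: $\mathrm{dom}(h)=\{x: h(x)<+\infty\}$; $\partial h(x)$ is the subdifferential of $h$ at $x$; $\partial h_0(x)$ is the least norm element of $\partial h(x)$. For $\gamma>0$, the proximity operator is $\mathrm{prox}_{\gamma h}(x)=\arg\min_{y\in\mathsf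 X}\frac12\|x-y\|^2+\gamma h(y)$, and the Moreau envelope is $h_\gamma(x)=\min_{y\in\mathsf X}h(y)+\frac{\|y-x\|^2}{2\gamma}$; it is differentiable with $\nabla h_\gamma(x)=\frac1\gamma(x-\mathrm{prox}_{\gamma h}(x))$. For functions depending on $s$, these operations are taken in the first variable with $s$ fixed: $\partial g(x,s)$ is the subdifferential of $g(\cdot,s)$ at $x$; $\partial g_0(x,s)$ is its least norm element; $\nabla f(x,s)$ is the gradient of $f(\cdot,s)$ at $x$; $f_\gamma(\cdot,s)$ and $g_\gamma(\cdot,s)$ are the Moreau envelopes of $f(\cdot,s)$ and $g(\cdot,s)$; $\nabla f_\gamma(x,s)$ is the gradient of $f_\gamma(\cdot,s)$ at $x$. Set $F^\gamma(x)=\int f_\gamma(x,s)\,\mu(ds)$ and $G^\gamma(x)=\int g_\gamma(x,s)\,\mu(ds)$. $D(s)=\mathrm{dom}(g(\cdot,s))$ and $\mathcal D=\mathrm{dom}(G)$. $\mathrm{cl}$ denotes closure, $\Pi_{\mathcal C}$ is the projection onto a closed convex set $\mathcal C$, and $d(x,S)$ is the distance from the point $x$ to the set $S\subset\mathsf X$. For $p\ge1$, $L^p(\Xi,\mathsf X)$ is the set of measurable maps $\varphi:(\Xi,\mathcal G,\mu)\to(\mathsf X,\mathscr B(\mathsf X))$ such that $\|\varphi\|^p$ is $\mu$-integrable. Algorithm. Let $(\xi_n)_{n\ge1}$ be a sequence of i.i.d. copies of $\xi$ (distribution $\mu$). For a step size $\gamma>0$ and a probability measure $\nu$ on $\mathsf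 X$, $(x_n^{\gamma,\nu})_{n\ge0}$ is the sequence $(x_n)_{n\ge0}$ where $x_0$ has distribution $\nu$ and is independent of $(\xi_n)_{n\ge1}$, and for $n\ge0$, $$y_{n+1}=\mathrm{prox}_{\gamma f(\cdot,\xi_{n+1})}(x_n),\quad z_{n+1}=\mathrm{prox}_{\gamma g(\cdot,\xi_{n+1})}(2y_{n+1}-x_n),\quad x_{n+1}=x_n+z_{n+1}-y_{n+1}.$$ *)

theory Defs
  imports "HOL-Probability.Probability"
begin

definition edom :: "('a \<Rightarrow> ereal) \<Rightarrow> 'a set" where
  "edom h = {x. h x < \<infinity>}"

text \<open>The class of proper, convex, lower semicontinuous functions. At points where the value
  is infinite the products below use the convention \<open>0 * \<infinity> = 0\<close>, which is harmless as
  properness excludes \<open>- \<infinity>\<close>.\<close>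

definition Gamma0 :: "('a::euclidean_space \<Rightarrow> ereal) set" where
  "Gamma0 = {h.
     (\<forall>x y. \<forall>u\<ge>0. \<forall>v\<ge>0. u + v = 1 \<longrightarrow>
        h (u *\<^sub>R x + v *\<^sub>R y) \<le> ereal u * h x + ereal v * h y) \<and>
     (\<forall>x. h x \<le> Liminf (at x) h) \<and>
     (\<forall>x. h x \<noteq> -\<infinity>) \<and> (\<exists>x. h x \<noteq> \<infinity>)}"

definition Argmin :: "('a \<Rightarrow> ereal) \<Rightarrow> 'a set" where
  "Argmin h = {x. is_arg_min h (\<lambda>_. True) x}"

text \<open>For proper \<open>h\<close> this set is empty outside \<open>edom h\<close>.\<close>

definition subdiff :: "('a::euclidean_space \<Rightarrow> ereal) \<Rightarrow> 'a \<Rightarrow> 'a set" where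
  "subdiff h x = {u. \<forall>y. h x + ereal (u \<bullet> (y - x)) \<le> h y}"

text \<open>Meaningful only where the subdifferential is nonempty.\<close>

definition least_subgrad :: "('a::euclidean_space \<Rightarrow> ereal) \<Rightarrow> 'a \<Rightarrow> 'a" where
  "least_subgrad h x = arg_min norm (\<lambda>u. u \<in> subdiff h x)"

definition prox :: "real \<Rightarrow> ('a::euclidean_space \<Rightarrow> ereal) \<Rightarrow> 'a \<Rightarrow> 'a" where
  "prox \<gamma> h x =
     arg_min (\<lambda>y. ereal ((norm (x - y))\<^sup>2 / 2) + ereal \<gamma> * h y) (\<lambda>_. True)"

definition moreau :: "real \<Rightarrow> ('a::euclidean_space \<Rightarrow> ereal) \<Rightarrow> 'a \<Rightarrow> ereal" where
  "moreau \<gamma> h x = (INF y. h y + ereal ((norm (y - x))\<^sup>2 / (2 * \<gamma>)))"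

text \<open>Differentiability at a point includes finiteness in a neighbourhood of it.\<close>

definition has_gradient :: "('a::euclidean_space \<Rightarrow> ereal) \<Rightarrow> 'a \<Rightarrow> 'a \<Rightarrow> bool" where
  "has_gradient h v x \<longleftrightarrow>
     (\<forall>\<^sub>F y in nhds x. \<bar>h y\<bar> \<noteq> \<infinity>) \<and> GDERIV (\<lambda>y. real_of_ereal (h y)) x :> v"

definition gradient :: "('a::euclidean_space \<Rightarrow> ereal) \<Rightarrow> 'a \<Rightarrow> 'a" where
  "gradient h x = (THE v. has_gradient h v x)"

definition differentiable_fun :: "('a::euclidean_space \<Rightarrow> ereal) \<Rightarrow> bool" where
  "differentiable_fun h \<longleftrightarrow> (\<forall>x. \<exists>v. has_gradient h v x)"

definition coercive :: "('a::euclidean_space \<Rightarrow> ereal) \<Rightarrow> bool" where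
  "coercive h \<longleftrightarrow> (h \<longlongrightarrow> \<infinity>) at_infinity"

definition supercoercive :: "('a::euclidean_space \<Rightarrow> ereal) \<Rightarrow> bool" where
  "supercoercive h \<longleftrightarrow> ((\<lambda>x. h x / ereal (norm x)) \<longlongrightarrow> \<infinity>) at_infinity"

text \<open>Integral of an extended-real-valued function: positive part minus negative part (the map
  \<open>e2ennreal\<close> truncates at \<open>0\<close>). If both parts have infinite integral, the value is \<open>\<infinity>\<close>,
  because \<open>\<infinity> - \<infinity> = \<infinity>\<close> on \<open>ereal\<close>.\<close>

definition ereal_integral :: "'s measure \<Rightarrow> ('s \<Rightarrow> ereal) \<Rightarrow> ereal" where
  "ereal_integral M h =
     enn2ereal (\<integral>\<^sup>+ s. e2ennreal (h s) \<partial>M) - enn2ereal (\<integral>\<^sup>+ s. e2ennreal (- h s) \<partial>M)"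

definition Lp :: "real \<Rightarrow> 's measure \<Rightarrow> ('s \<Rightarrow> 'a::euclidean_space) set" where
  "Lp p M = {\<phi> \<in> borel_measurable M. integrable M (\<lambda>s. norm (\<phi> s) powr p)}"

text \<open>Iterates started at \<open>x0\<close> and driven by a sequence \<open>u\<close>, of which only the entries of index
  at least \<open>1\<close> are used.\<close>

primrec dr_iter :: "real \<Rightarrow> ('a::euclidean_space \<Rightarrow> 's \<Rightarrow> ereal) \<Rightarrow> ('a \<Rightarrow> 's \<Rightarrow> ereal) \<Rightarrow>
    'a \<Rightarrow> (nat \<Rightarrow> 's) \<Rightarrow> nat \<Rightarrow> 'a" where
  "dr_iter \<gamma> f g x0 u 0 = x0"
| "dr_iter \<gamma> f g x0 u (Suc n) =
     (let x = dr_iter \<gamma> f g x0 u n;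
          y = prox \<gamma> (\<lambda>v. f v (u (Suc n))) x;
          z = prox \<gamma> (\<lambda>v. g v (u (Suc n))) (2 *\<^sub>R y - x)
      in x + z - y)"

definition iid_copies :: "'w measure \<Rightarrow> 's measure \<Rightarrow> (nat \<Rightarrow> 'w \<Rightarrow> 's) \<Rightarrow> bool" where
  "iid_copies P M \<xi> \<longleftrightarrow>
     prob_space.indep_vars P (\<lambda>_. M) \<xi> {1..} \<and> (\<forall>n\<ge>1. distr P M (\<xi> n) = M)"

text \<open>Independence of \<open>X0\<close> and the sequence \<open>\<xi>\<close> is stated for the generated sigma-fields, since \<open>indep_var\<close> wants equal codomain types.\<close>

definition initial_rv ::
    "'w measure \<Rightarrow> 's measure \<Rightarrow> (nat \<Rightarrow> 'w \<Rightarrow> 's) \<Rightarrow> 'a::euclidean_space measure \<Rightarrow>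
     ('w \<Rightarrow> 'a) \<Rightarrow> bool" where
  "initial_rv P M \<xi> \<nu> X0 \<longleftrightarrow>
     X0 \<in> borel_measurable P \<and> distr P borel X0 = \<nu> \<and>
     prob_space.indep_set P
       (sets (vimage_algebra (space P) X0 borel))
       (sets (vimage_algebra (space P) (\<lambda>\<omega>. \<lambda>n\<in>{1..}. \<xi> n \<omega>) (\<Pi>\<^sub>M n\<in>{1..}. M)))"

end

theory Submission
  imports Defs
begin

text \<open>Write \<open>T\<^sub>\<gamma>(x, s)\<close> for one step of the algorithm and \<open>h\<^sub>\<gamma>\<close> for Moreau envelopes. Cocoercivity of the
  Lipschitz gradient of \<open>f(\<cdot>, s)\<close> and the subgradient inequalities at \<open>x\<^sub>\<star>\<close> give, for small \<open>\<gamma>\<close>,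
  \<open>E \<parallel>T\<^sub>\<gamma>(x, \<xi>) - x\<^sub>\<star>\<parallel>\<^sup>2 \<le> \<parallel>x - x\<^sub>\<star>\<parallel>\<^sup>2 - 2\<gamma> \<Psi>\<^bsub>2\<gamma>\<^esub>(x) + C\<gamma>\<^sup>2\<close>, where
  \<open>\<Psi>\<^sub>\<gamma>(x) = E (f\<^sub>\<gamma>(x, \<xi>) + g\<^sub>\<gamma>(x, \<xi>) - f(x\<^sub>\<star>, \<xi>) - g(x\<^sub>\<star>, \<xi>))\<close> is convex, is bounded below by a multiple of
  \<open>- \<gamma>\<close>, and grows as \<open>\<gamma> \<rightarrow> 0\<close> to a limit that is positive off \<open>S = argmin (F + G)\<close>. As \<open>S\<close> is bounded by
  coercivity, a Dini argument on a tube around \<open>S\<close> and convexity give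
  \<open>\<Psi>\<^sub>\<gamma>(x) + C\<gamma> \<ge> c max(0, d(x, S) - \<epsilon>)\<close> for all \<open>x\<close> and all small \<open>\<gamma>\<close>. Summing the drift
  inequality along the iterates bounds the averages of \<open>E max(0, d(x\<^sub>k, S) - \<epsilon>)\<close> by \<open>O(\<gamma>) + O(1/(\<gamma>n))\<close>, and all
  the claims follow by Markov's inequality and convexity of \<open>d(\<cdot>, S)\<close>.\<close>

section \<open>Proximity operators and Moreau envelopes\<close>

text \<open>Fix subgradients \<open>d s\<close> and \<open>\<phi> s\<close> of the two functions at
  \<open>xs\<close>. Because their means cancel, the linear part of the gap between envelopes and
  values at \<open>xs\<close> integrates to 0, and the rest is bounded below by completing a square;
  finiteness of \<open>F\<close> and \<open>G\<close> away from \<open>xs\<close> is never at issue.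
  Doubling the parameter is dictated by the algebra of one step: with subgradients \<open>u\<close>
  and \<open>v\<close> at the two proximal points, the products of \<open>u\<close> and
  \<open>v\<close> cancel exactly at \<open>2 * \<gamma>\<close>, while at \<open>\<gamma>\<close>
  such a term would remain with no square of \<open>v\<close> to absorb it. The remaining square of
  \<open>u\<close> is paid for by cocoercivity, which compares \<open>u\<close> with
  \<open>d\<close> and leaves only \<open>\<gamma>\<^sup>2\<close> times the squared norm of
  \<open>d\<close>. Positivity off the minimizers is proved by contraposition: if no mean gap at a
  point is positive, then almost surely both functions meet there their affine minorants from
  \<open>xs\<close>, whose slopes cancel in the mean, so the point is a minimizer. Minimizers are
  defined by comparing extended values, so the case of \<open>F + G\<close> infinite everywhere is
  split off.\<close>

lemma Gamma0_convexD:
  assumes "h \<in> Gamma0" "0 \<le> u" "0 \<le> v" "u + v = 1"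
  shows "h (u *\<^sub>R x + v *\<^sub>R y) \<le> ereal u * h x + ereal v * h y"
  using assms unfolding Gamma0_def by blast

lemma Gamma0_not_MInf: "h \<in> Gamma0 \<Longrightarrow> h x \<noteq> -\<infinity>"
  unfolding Gamma0_def by blast

text \<open>The class states lower semicontinuity through the punctured filter \<open>at x\<close>;
  the hypothesis supplies the missing point.\<close>

lemma Gamma0_lsc:
  assumes "h \<in> Gamma0" "c < h x"
  shows "\<forall>\<^sub>F y in nhds x. c < h y"
proof -
  have "h x \<le> Liminf (at x) h"
    using assms unfolding Gamma0_def by blast
  with assms have "\<forall>\<^sub>F y in at x. c < h y"
    by (intro less_LiminfD) auto
  with assms show ?thesis
    by (simp add: eventually_nhds_conv_at)
qed

lemma subdiff_finite:
  assumes "h \<in> Gamma0" "u \<in> subdiff h x"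
  shows "\<bar>h x\<bar> \<noteq> \<infinity>"
proof -
  obtain y where y: "h y \<noteq> \<infinity>"
    using assms unfolding Gamma0_def by blast
  have "h x + ereal (u \<bullet> (y - x)) \<le> h y"
    using assms unfolding subdiff_def by blast
  with y have "h x \<noteq> \<infinity>" by auto
  with Gamma0_not_MInf[OF assms(1), of x] show ?thesis by auto
qed

lemma subdiff_le:
  assumes "h \<in> Gamma0" "u \<in> subdiff h x"
  shows "ereal (real_of_ereal (h x) + u \<bullet> (y - x)) \<le> h y"
proof -
  have "h x + ereal (u \<bullet> (y - x)) \<le> h y"
    using assms unfolding subdiff_def by blast
  moreover have "h x = ereal (real_of_ereal (h x))"
    using subdiff_finite[OF assms] by (simp add: ereal_real)
  ultimately show ?thesis by (metis plus_ereal.simps(1))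
qed

text \<open>\<open>prox\<close> is a choice through \<open>arg_min\<close>, so it means something
  only once a minimizer is known to exist. The affine minorant given by \<open>u\<close> makes the
  objective exceed its value at \<open>x0\<close> outside a ball; on the ball, lower semicontinuity
  and compactness do the rest.\<close>

lemma prox_minimizes:
  fixes x :: "'a::euclidean_space"
  assumes h: "h \<in> Gamma0" and u: "u \<in> subdiff h x0" and g: "\<gamma> > 0"
  shows "ereal ((norm (x - prox \<gamma> h x))\<^sup>2 / 2) + ereal \<gamma> * h (prox \<gamma> h x)
       \<le> ereal ((norm (x - y))\<^sup>2 / 2) + ereal \<gamma> * h y"
proof -
  define k where "k = (\<lambda>y. ereal ((norm (x - y))\<^sup>2 / 2) + ereal \<gamma> * h y)"
  define h0 where "h0 = real_of_ereal (h x0)"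
  have h0: "h x0 = ereal h0"
    using subdiff_finite[OF h u] by (simp add: h0_def ereal_real)
  \<comment> \<open>Lower semicontinuity of the objective. The real \<open>a\<close>, strictly
    between the level \<open>h\<close> must pass at \<open>p0\<close> and \<open>h p0\<close>,
    leaves room for the quadratic term to vary.\<close>
  have open_k: "open {p. c < k p}" if c: "c \<noteq> -\<infinity>" for c
  proof (cases c)
    case (real r)
    have "\<forall>\<^sub>F p in nhds p0. c < k p" if "c < k p0" for p0
    proof -
      have "ereal ((r - (norm (x - p0))\<^sup>2 / 2) / \<gamma>) < h p0"
        using that g Gamma0_not_MInf[OF h, of p0] unfolding k_def real
        by (cases "h p0") (auto simp: field_simps)
      then obtain a where a: "ereal ((r - (norm (x - p0))\<^sup>2 / 2) / \<gamma>) < ereal a" "ereal a < h p0"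
        using ereal_dense2 by blast
      have "((\<lambda>p. (r - (norm (x - p))\<^sup>2 / 2) / \<gamma>) \<longlongrightarrow> (r - (norm (x - p0))\<^sup>2 / 2) / \<gamma>) (nhds p0)"
        using g by (intro tendsto_intros filterlim_ident) auto
      then have "\<forall>\<^sub>F p in nhds p0. (r - (norm (x - p))\<^sup>2 / 2) / \<gamma> < a"
        using a(1) by (intro order_tendstoD) auto
      moreover have "\<forall>\<^sub>F p in nhds p0. ereal a < h p"
        using Gamma0_lsc[OF h a(2)] .
      ultimately show ?thesis
      proof eventually_elim
        case (elim p)
        then have "r < (norm (x - p))\<^sup>2 / 2 + \<gamma> * a"
          using elim(1) g by (simp add: field_simps)
        show ?case
        proof (cases "h p")
          case (real t)
          have "\<gamma> * a \<le> \<gamma> * t"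
            using elim(2) g unfolding real by (intro mult_left_mono) auto
          with \<open>r < _\<close> show ?thesis
            unfolding k_def real \<open>c = ereal r\<close> by simp
        qed (use elim(2) g in \<open>auto simp: k_def \<open>c = ereal r\<close>\<close>)
      qed
    qed
    then show ?thesis
      by (subst open_subopen) (fastforce simp: eventually_nhds)
  qed (use c in auto)
  \<comment> \<open>At distance \<open>\<rho>\<close> from \<open>x0\<close> the objective has grown
    by at least \<open>\<rho> * (\<rho> / 2 - norm (x - x0) - \<gamma> * norm u)\<close>, which is
    positive beyond this radius.\<close>
  define B where "B = cball x0 (2 * (norm (x - x0) + \<gamma> * norm u))"
  have out: "k x0 < k p" if "p \<notin> B" for p
  proof -
    define \<rho> where "\<rho> = norm (p - x0)"
    have \<rho>: "\<rho> > 2 * (norm (x - x0) + \<gamma> * norm u)"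
      using that by (simp add: B_def \<rho>_def dist_norm norm_minus_commute)
    have \<rho>0: "\<rho> > 0"
      using \<rho> g by (smt (verit) mult_nonneg_nonneg norm_ge_zero)
    have 1: "(norm (x - p))\<^sup>2 = (norm (x - x0))\<^sup>2 + \<rho>\<^sup>2 - 2 * ((x - x0) \<bullet> (p - x0))"
      by (simp add: \<rho>_def power2_norm_eq_inner inner_diff_left inner_diff_right inner_commute)
    have 2: "(x - x0) \<bullet> (p - x0) \<le> norm (x - x0) * \<rho>"
      unfolding \<rho>_def by (rule norm_cauchy_schwarz)
    have 3: "- (norm u * \<rho>) \<le> u \<bullet> (p - x0)"
      unfolding \<rho>_def using Cauchy_Schwarz_ineq2[of u "p - x0"] by linarith
    have 4: "\<gamma> * (h0 - norm u * \<rho>) \<le> \<gamma> * (h0 + u \<bullet> (p - x0))"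
      using 3 g by (intro mult_left_mono) auto
    have 5: "2 * (norm (x - x0) + \<gamma> * norm u) * \<rho> < \<rho> * \<rho>"
      using \<rho> \<rho>0 by (intro mult_strict_right_mono) auto
    have "(norm (x - x0))\<^sup>2 / 2 + \<gamma> * h0 < (norm (x - p))\<^sup>2 / 2 + \<gamma> * (h0 + u \<bullet> (p - x0))"
      using 1 2 4 5 by (simp add: power2_eq_square algebra_simps)
    also have "ereal \<dots> = ereal ((norm (x - p))\<^sup>2 / 2) + ereal \<gamma> * ereal (h0 + u \<bullet> (p - x0))"
      by simp
    also have "\<dots> \<le> k p"
      unfolding k_def using subdiff_le[OF h u, of p] g
      by (intro add_left_mono ereal_mult_left_mono) (auto simp: h0_def)
    finally show ?thesis by (simp add: k_def h0)
  qed
  \<comment> \<open>Without a minimizer, the open sets where the objective exceeds some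
    \<open>k q\<close> cover the compact ball. Among the finitely many \<open>q\<close> needed and
    \<open>x0\<close>, one with least value would lie in the ball and be beaten by another of
    them.\<close>
  have "\<exists>p. \<forall>q. k p \<le> k q"
  proof (rule ccontr)
    assume "\<not> ?thesis"
    then have q: "\<exists>q. k q < k p" for p by (metis not_le)
    have nm: "k q \<noteq> -\<infinity>" for q
      using g Gamma0_not_MInf[OF h, of q] unfolding k_def by (cases "h q") auto
    have "compact B" by (simp add: B_def)
    then obtain Q where Q: "finite Q" "B \<subseteq> (\<Union>q\<in>Q. {p. k q < k p})"
      using q nm by (elim compactE_image[of B UNIV "\<lambda>q. {p. k q < k p}"]) (auto intro: open_k)
    obtain m where m: "m \<in> insert x0 Q" "\<And>q. q \<in> insert x0 Q \<Longrightarrow> k m \<le> k q"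
    proof -
      have "Min (k ` insert x0 Q) \<in> k ` insert x0 Q" using Q by (intro Min_in) auto
      then obtain m where "m \<in> insert x0 Q" "k m = Min (k ` insert x0 Q)"
        unfolding image_iff by metis
      with Q show ?thesis by (intro that[of m]) (auto simp del: image_insert intro: Min_le)
    qed
    have "m \<in> B" using out[of m] m(2)[of x0] by (meson insertI1 not_le)
    with Q obtain q where "q \<in> Q" "k q < k m" by auto
    with m(2)[of q] show False by auto
  qed
  then have "is_arg_min k (\<lambda>_. True) (prox \<gamma> h x)"
    unfolding prox_def arg_min_def k_def[symmetric]
    by (intro someI_ex[of "is_arg_min k (\<lambda>_. True)"]) (auto simp: is_arg_min_def not_less)
  then show ?thesis
    by (auto simp: is_arg_min_def not_less k_def)
qed

lemma norm_diff_scaleR_sq: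
  fixes a b :: "'a::real_inner"
  shows "(norm (a - t *\<^sub>R b))\<^sup>2 = (norm a)\<^sup>2 - 2 * t * (a \<bullet> b) + t\<^sup>2 * (norm b)\<^sup>2"
  unfolding power2_norm_eq_inner
  by (simp add: inner_diff_left inner_diff_right inner_commute algebra_simps power2_eq_square)

text \<open>First-order optimality: compare the minimizer \<open>p\<close> with points of the
  segment from \<open>p\<close> to \<open>y\<close>. By convexity the comparison is linear in
  \<open>t\<close> up to a quadratic term, which disappears on dividing by \<open>t\<close> and
  letting it tend to 0.\<close>

lemma prox_subgrad:
  fixes x :: "'a::euclidean_space"
  assumes h: "h \<in> Gamma0" and u: "u \<in> subdiff h x0" and g: "\<gamma> > 0"
  shows "(1 / \<gamma>) *\<^sub>R (x - prox \<gamma> h x) \<in> subdiff h (prox \<gamma> h x)"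
proof -
  define p where "p = prox \<gamma> h x"
  note min = prox_minimizes[OF assms, of x, folded p_def]
  obtain h0 where h0: "h x0 = ereal h0"
    using subdiff_finite[OF h u] by auto
  have "h p \<noteq> \<infinity>"
    using min[of x0] g by (auto simp: h0)
  with Gamma0_not_MInf[OF h, of p] obtain a where a: "h p = ereal a" by (cases "h p") auto
  have "h p + ereal ((1 / \<gamma>) *\<^sub>R (x - p) \<bullet> (y - p)) \<le> h y" for y
  proof (cases "h y")
    case (real b)
    have key: "\<gamma> * (a - b) \<le> - ((x - p) \<bullet> (y - p)) + t * ((norm (y - p))\<^sup>2 / 2)"
      if t: "t > 0" "t < 1" for t
    proof -
      have "h ((1 - t) *\<^sub>R p + t *\<^sub>R y) \<le> ereal ((1 - t) * a + t * b)"
        using Gamma0_convexD[OF h, of "1 - t" t p y] t by (simp add: a real)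
      then have "ereal \<gamma> * h ((1 - t) *\<^sub>R p + t *\<^sub>R y) \<le> ereal (\<gamma> * ((1 - t) * a + t * b))"
        using g ereal_mult_left_mono[of _ "ereal ((1 - t) * a + t * b)" "ereal \<gamma>"] by simp
      then have "ereal ((norm (x - p))\<^sup>2 / 2 + \<gamma> * a) \<le>
          ereal ((norm (x - ((1 - t) *\<^sub>R p + t *\<^sub>R y)))\<^sup>2 / 2) + ereal (\<gamma> * ((1 - t) * a + t * b))"
        using order_trans[OF min[of "(1 - t) *\<^sub>R p + t *\<^sub>R y"] add_left_mono, of "ereal (\<gamma> * ((1 - t) * a + t * b))"]
        by (simp add: a)
      moreover have "(norm (x - ((1 - t) *\<^sub>R p + t *\<^sub>R y)))\<^sup>2
          = (norm (x - p))\<^sup>2 - 2 * t * ((x - p) \<bullet> (y - p)) + t\<^sup>2 * (norm (y - p))\<^sup>2"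
      proof -
        have "x - ((1 - t) *\<^sub>R p + t *\<^sub>R y) = (x - p) - t *\<^sub>R (y - p)" by (simp add: algebra_simps)
        then show ?thesis
          by (simp only: norm_diff_scaleR_sq)
      qed
      ultimately have "t * (\<gamma> * (a - b)) \<le> t * (- ((x - p) \<bullet> (y - p)) + t * ((norm (y - p))\<^sup>2 / 2))"
        by (simp add: algebra_simps power2_eq_square)
      with t show ?thesis by simp
    qed
    have "\<gamma> * (a - b) \<le> - ((x - p) \<bullet> (y - p)) + 0 * ((norm (y - p))\<^sup>2 / 2)"
    proof (rule tendsto_lowerbound)
      show "((\<lambda>t. - ((x - p) \<bullet> (y - p)) + t * ((norm (y - p))\<^sup>2 / 2)) \<longlongrightarrow>
          - ((x - p) \<bullet> (y - p)) + 0 * ((norm (y - p))\<^sup>2 / 2)) (at_right 0)"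
        by (intro tendsto_intros)
      show "\<forall>\<^sub>F t in at_right 0. \<gamma> * (a - b) \<le> - ((x - p) \<bullet> (y - p)) + t * ((norm (y - p))\<^sup>2 / 2)"
        unfolding eventually_at_right_field using key by (intro exI[of _ 1]) auto
    qed auto
    with g have "a + (1 / \<gamma>) * ((x - p) \<bullet> (y - p)) \<le> b"
      by (simp add: field_simps)
    then show ?thesis by (simp add: a real)
  qed (use Gamma0_not_MInf[OF h, of y] in auto)
  then show ?thesis unfolding subdiff_def p_def by blast
qed

lemma moreau_le: "moreau \<gamma> h x \<le> h y + ereal ((norm (y - x))\<^sup>2 / (2 * \<gamma>))"
  unfolding moreau_def by (rule INF_lower) auto

text \<open>The objective of \<open>prox\<close> is \<open>\<gamma>\<close> times that of the
  envelope, so the same point minimizes both.\<close>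

lemma moreau_eq_prox:
  fixes x :: "'a::euclidean_space"
  assumes h: "h \<in> Gamma0" and u: "u \<in> subdiff h x0" and g: "\<gamma> > 0"
  shows "moreau \<gamma> h x = h (prox \<gamma> h x) + ereal ((norm (prox \<gamma> h x - x))\<^sup>2 / (2 * \<gamma>))"
proof (rule antisym)
  define p where "p = prox \<gamma> h x"
  have "\<bar>h p\<bar> \<noteq> \<infinity>"
    unfolding p_def using subdiff_finite[OF h prox_subgrad[OF assms]] .
  then obtain a where a: "h p = ereal a" by auto
  show "h (prox \<gamma> h x) + ereal ((norm (prox \<gamma> h x - x))\<^sup>2 / (2 * \<gamma>)) \<le> moreau \<gamma> h x"
    unfolding moreau_def
  proof (rule INF_greatest)
    fix y
    show "h (prox \<gamma> h x) + ereal ((norm (prox \<gamma> h x - x))\<^sup>2 / (2 * \<gamma>))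
        \<le> h y + ereal ((norm (y - x))\<^sup>2 / (2 * \<gamma>))"
    proof (cases "h y")
      case (real b)
      have "(norm (x - p))\<^sup>2 / 2 + \<gamma> * a \<le> (norm (x - y))\<^sup>2 / 2 + \<gamma> * b"
        using prox_minimizes[OF assms, of x y] unfolding p_def[symmetric] a real by simp
      then have "((norm (x - p))\<^sup>2 / 2 + \<gamma> * a) / \<gamma> \<le> ((norm (x - y))\<^sup>2 / 2 + \<gamma> * b) / \<gamma>"
        using g by (intro divide_right_mono) auto
      then show ?thesis
        using g unfolding p_def[symmetric] a real norm_minus_commute[of _ x]
        by (simp add: add_divide_distrib add.commute)
    qed (use Gamma0_not_MInf[OF h, of y] in auto)
  qed
qed (rule moreau_le)

lemma moreau_upper:
  assumes "h \<in> Gamma0" "u \<in> subdiff h x0"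
  shows "moreau \<gamma> h x \<le> ereal (real_of_ereal (h x0) + (norm (x0 - x))\<^sup>2 / (2 * \<gamma>))"
  using moreau_le[of \<gamma> h x x0] subdiff_finite[OF assms] by auto

text \<open>Insert the affine minorant in the infimum and complete the square: the worst
  \<open>y\<close> is \<open>x - \<gamma> *\<^sub>R u\<close>, at a cost of
  \<open>\<gamma> / 2 * (norm u)\<^sup>2\<close>.\<close>

lemma moreau_lower:
  fixes x :: "'a::euclidean_space"
  assumes h: "h \<in> Gamma0" and u: "u \<in> subdiff h x0" and g: "\<gamma> > 0"
  shows "ereal (real_of_ereal (h x0) + u \<bullet> (x - x0) - \<gamma> / 2 * (norm u)\<^sup>2) \<le> moreau \<gamma> h x"
  unfolding moreau_def
proof (rule INF_greatest)
  fix y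
  have "0 \<le> (norm ((y - x) - (- \<gamma>) *\<^sub>R u))\<^sup>2 / (2 * \<gamma>)" using g by simp
  also have "\<dots> = \<gamma> / 2 * (norm u)\<^sup>2 + u \<bullet> (y - x) + (norm (y - x))\<^sup>2 / (2 * \<gamma>)"
    unfolding norm_diff_scaleR_sq inner_commute[of "y - x" u]
    using g by (simp add: add_divide_distrib power2_eq_square)
  finally have "real_of_ereal (h x0) + u \<bullet> (x - x0) - \<gamma> / 2 * (norm u)\<^sup>2
      \<le> real_of_ereal (h x0) + u \<bullet> (y - x0) + (norm (y - x))\<^sup>2 / (2 * \<gamma>)"
    by (simp add: inner_diff_right)
  then show "ereal (real_of_ereal (h x0) + u \<bullet> (x - x0) - \<gamma> / 2 * (norm u)\<^sup>2)
      \<le> h y + ereal ((norm (y - x))\<^sup>2 / (2 * \<gamma>))"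
    using subdiff_le[OF h u, of y] by (cases "h y") auto
qed

lemma moreau_finite:
  fixes x :: "'a::euclidean_space"
  assumes "h \<in> Gamma0" "u \<in> subdiff h x0" "\<gamma> > 0"
  shows "\<bar>moreau \<gamma> h x\<bar> \<noteq> \<infinity>"
  using moreau_lower[OF assms, of x] moreau_upper[OF assms(1,2), of \<gamma> x] by auto

lemma moreau_antimono:
  assumes "0 < \<gamma>" "\<gamma> \<le> \<gamma>'"
  shows "moreau \<gamma>' h x \<le> moreau \<gamma> h x"
  unfolding moreau_def
  using assms by (intro INF_mono' add_left_mono) (auto intro!: divide_left_mono)

text \<open>The infimum is attained at the proximal points, so their convex combination is a
  competitor at the combination of \<open>x\<close> and \<open>y\<close>; convexity of
  \<open>h\<close> and of the square finish.\<close>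

lemma convex_on_moreau:
  fixes h :: "'a::euclidean_space \<Rightarrow> ereal"
  assumes h: "h \<in> Gamma0" and u: "u \<in> subdiff h x0" and g: "\<gamma> > 0"
  shows "convex_on UNIV (\<lambda>x. real_of_ereal (moreau \<gamma> h x))"
proof (rule convex_onI)
  fix t :: real and x y :: 'a
  let ?M = "\<lambda>x. real_of_ereal (moreau \<gamma> h x)"
  assume t: "0 < t" "t < 1"
  define p where "p = prox \<gamma> h x"
  define q where "q = prox \<gamma> h y"
  obtain a where a: "h p = ereal a"
    using subdiff_finite[OF h prox_subgrad[OF assms]] unfolding p_def by (metis ereal_real')
  obtain b where b: "h q = ereal b"
    using subdiff_finite[OF h prox_subgrad[OF assms]] unfolding q_def by (metis ereal_real')
  let ?z = "(1 - t) *\<^sub>R x + t *\<^sub>R y" and ?r = "(1 - t) *\<^sub>R p + t *\<^sub>R q"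
  have "h ?r \<le> ereal ((1 - t) * a + t * b)"
    using Gamma0_convexD[OF h, of "1 - t" t p q] t by (simp add: a b)
  then have "moreau \<gamma> h ?z \<le> ereal ((1 - t) * a + t * b) + ereal ((norm (?r - ?z))\<^sup>2 / (2 * \<gamma>))"
    using moreau_le[of \<gamma> h ?z ?r] by (meson add_right_mono order_trans)
  moreover have "(norm (?r - ?z))\<^sup>2 \<le> (1 - t) * (norm (p - x))\<^sup>2 + t * (norm (q - y))\<^sup>2"
  proof -
    have "norm (?r - ?z) \<le> (1 - t) * norm (p - x) + t * norm (q - y)"
    proof -
      have "?r - ?z = (1 - t) *\<^sub>R (p - x) + t *\<^sub>R (q - y)" by (simp add: algebra_simps)
      then show ?thesis using t norm_triangle_ineq[of "(1 - t) *\<^sub>R (p - x)" "t *\<^sub>R (q - y)"] by simp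
    qed
    then have "(norm (?r - ?z))\<^sup>2 \<le> ((1 - t) * norm (p - x) + t * norm (q - y))\<^sup>2"
      by (intro power_mono) auto
    also have "\<dots> \<le> (1 - t) * (norm (p - x))\<^sup>2 + t * (norm (q - y))\<^sup>2"
      using convex_onD[OF convex_power2, of t "norm (p - x)" "norm (q - y)"] t by simp
    finally show ?thesis .
  qed
  ultimately have le: "moreau \<gamma> h ?z \<le> ereal ((1 - t) * a + t * b
      + ((1 - t) * (norm (p - x))\<^sup>2 + t * (norm (q - y))\<^sup>2) / (2 * \<gamma>))"
  proof -
    assume 1: "moreau \<gamma> h ?z \<le> ereal ((1 - t) * a + t * b) + ereal ((norm (?r - ?z))\<^sup>2 / (2 * \<gamma>))"
      and "(norm (?r - ?z))\<^sup>2 \<le> (1 - t) * (norm (p - x))\<^sup>2 + t * (norm (q - y))\<^sup>2"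
    then have "(norm (?r - ?z))\<^sup>2 / (2 * \<gamma>)
        \<le> ((1 - t) * (norm (p - x))\<^sup>2 + t * (norm (q - y))\<^sup>2) / (2 * \<gamma>)"
      using g by (intro divide_right_mono) auto
    then show ?thesis
      by (intro order_trans[OF 1]) simp
  qed
  have x: "?M x = a + (norm (p - x))\<^sup>2 / (2 * \<gamma>)"
    using moreau_eq_prox[OF assms, of x] by (simp add: p_def[symmetric] a)
  have y: "?M y = b + (norm (q - y))\<^sup>2 / (2 * \<gamma>)"
    using moreau_eq_prox[OF assms, of y] by (simp add: q_def[symmetric] b)
  have "?M ?z \<le> (1 - t) * a + t * b
      + ((1 - t) * (norm (p - x))\<^sup>2 + t * (norm (q - y))\<^sup>2) / (2 * \<gamma>)"
    using le moreau_finite[OF assms, of ?z] by (cases "moreau \<gamma> h ?z") simp_all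
  then show "?M ?z \<le> (1 - t) * ?M x + t * ?M y"
    unfolding x y by (simp add: distrib_left add_divide_distrib)
qed simp

text \<open>A point at distance \<open>\<rho>\<close> costs \<open>\<rho>\<^sup>2 / (2 * \<gamma>)\<close> in the envelope, which beats the affine minorant;
  so only a neighbourhood counts, and there lower semicontinuity applies.\<close>

lemma moreau_ge_of_less:
  fixes x :: "'a::euclidean_space"
  assumes h: "h \<in> Gamma0" and u: "u \<in> subdiff h x0" and c: "ereal c < h x"
  shows "\<forall>\<^sub>F \<gamma> in at_right 0. ereal c \<le> moreau \<gamma> h x"
proof -
  obtain r where r: "r > 0" "\<And>y. dist y x < r \<Longrightarrow> ereal c < h y"
    using Gamma0_lsc[OF h c] unfolding eventually_nhds_metric by blast
  define b where "b = real_of_ereal (h x0) + u \<bullet> (x - x0)"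
  have "filterlim (\<lambda>\<gamma>. b - r * norm u + r\<^sup>2 / 2 * inverse \<gamma>) at_top (at_right 0)"
    using r by (intro filterlim_tendsto_add_at_top[OF tendsto_const]
        filterlim_tendsto_pos_mult_at_top[OF tendsto_const] filterlim_inverse_at_top_right) auto
  \<comment> \<open>This event puts the affine-plus-quadratic bound at radius \<open>r\<close> above
    \<open>c\<close>; \<open>ev2\<close> makes \<open>r / (2 * \<gamma>) - norm u\<close>
    nonnegative, so that the bound only increases with the radius.\<close>
  then have ev1: "\<forall>\<^sub>F \<gamma> in at_right 0. c \<le> b - r * norm u + r\<^sup>2 / 2 * inverse \<gamma>"
    by (simp add: filterlim_at_top)
  have "filterlim (\<lambda>\<gamma>. r * inverse \<gamma> / 2) at_top (at_right 0)"
    using r filterlim_tendsto_pos_mult_at_top[OF tendsto_const[of "r / 2"] _ filterlim_inverse_at_top_right]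
    by simp
  then have ev2: "\<forall>\<^sub>F \<gamma> in at_right 0. norm u \<le> r * inverse \<gamma> / 2"
    by (simp add: filterlim_at_top)
  have "\<forall>\<^sub>F \<gamma> in at_right (0::real). \<gamma> > 0" by (simp add: eventually_at_filter)
  with ev1 ev2 show ?thesis
  proof eventually_elim
    case (elim \<gamma>)
    show ?case unfolding moreau_def
    proof (rule INF_greatest)
      fix y
      show "ereal c \<le> h y + ereal ((norm (y - x))\<^sup>2 / (2 * \<gamma>))"
      proof (cases "dist y x < r")
        case True
        then have "ereal c \<le> h y" using r by (simp add: less_imp_le)
        moreover have "ereal 0 \<le> ereal ((norm (y - x))\<^sup>2 / (2 * \<gamma>))" using elim by simp
        ultimately show ?thesis using add_mono[of "ereal c" "h y" "ereal 0"] by simp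
      next
        case False
        define \<rho> where "\<rho> = norm (y - x)"
        have \<rho>: "\<rho> \<ge> r" using False by (simp add: \<rho>_def dist_norm)
        have "c \<le> b + r * (r / (2 * \<gamma>) - norm u)"
          using elim by (simp add: field_simps power2_eq_square)
        also have "r * (r / (2 * \<gamma>) - norm u) \<le> \<rho> * (\<rho> / (2 * \<gamma>) - norm u)"
        proof (rule mult_mono)
          have "r / (2 * \<gamma>) \<le> \<rho> / (2 * \<gamma>)" using \<rho> elim by (intro divide_right_mono) auto
          then show "r / (2 * \<gamma>) - norm u \<le> \<rho> / (2 * \<gamma>) - norm u" by simp
          show "0 \<le> r / (2 * \<gamma>) - norm u" using elim by (simp add: field_simps)
        qed (use \<rho> r in auto)
        also have "\<dots> \<le> u \<bullet> (y - x) + (norm (y - x))\<^sup>2 / (2 * \<gamma>)"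
          using Cauchy_Schwarz_ineq2[of u "y - x"]
          by (simp add: \<rho>_def[symmetric] algebra_simps power2_eq_square)
        finally have "ereal c \<le> ereal (real_of_ereal (h x0) + u \<bullet> (y - x0))
            + ereal ((norm (y - x))\<^sup>2 / (2 * \<gamma>))"
          by (simp add: b_def inner_diff_right)
        also have "\<dots> \<le> h y + ereal ((norm (y - x))\<^sup>2 / (2 * \<gamma>))"
          by (intro add_right_mono subdiff_le[OF h u])
        finally show ?thesis .
      qed
    qed
  qed
qed

section \<open>Pointwise descent of a Douglas-Rachford step\<close>

lemma gradient_eq:
  assumes "has_gradient h v x"
  shows "gradient h x = v"
proof -
  have "w = v" if "has_gradient h w x" for w
  proof -
    have "(\<lambda>k. k \<bullet> w) = (\<lambda>k. k \<bullet> v)"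
      using assms that unfolding has_gradient_def gderiv_def by (blast intro: has_derivative_unique)
    then have "(w - v) \<bullet> w = (w - v) \<bullet> v" by metis
    then have "(w - v) \<bullet> (w - v) = 0" by (simp add: inner_diff_right)
    then show "w = v" by simp
  qed
  then show ?thesis
    unfolding gradient_def using assms by blast
qed

text \<open>Convexity bounds the difference quotient from \<open>x\<close> towards \<open>y\<close>
  by \<open>r y - r x\<close> for all steps in (0, 1), and its limit at 0 is the directional
  derivative.\<close>

lemma gradient_in_subdiff:
  assumes h: "h \<in> Gamma0" and d: "differentiable_fun h"
  shows "gradient h x \<in> subdiff h x"
proof -
  have fin: "\<bar>h y\<bar> \<noteq> \<infinity>" for y
  proof -
    obtain v where "has_gradient h v y" using d unfolding differentiable_fun_def by blast
    then have "\<forall>\<^sub>F z in nhds y. \<bar>h z\<bar> \<noteq> \<infinity>"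
      unfolding has_gradient_def by (rule conjunct1)
    then show ?thesis by (rule eventually_nhds_x_imp_x)
  qed
  define r where "r = (\<lambda>y. real_of_ereal (h y))"
  have r: "h y = ereal (r y)" for y using fin[of y] by (simp add: r_def ereal_real)
  obtain v where v: "has_gradient h v x" using d unfolding differentiable_fun_def by blast
  have dr: "(r has_derivative (\<lambda>k. k \<bullet> v)) (at x)"
    using v unfolding has_gradient_def gderiv_def r_def by blast
  have "h x + ereal (v \<bullet> (y - x)) \<le> h y" for y
  proof -
    have lin: "((\<lambda>t. x + t *\<^sub>R (y - x)) has_derivative (\<lambda>t. t *\<^sub>R (y - x))) (at (0::real))"
      by (auto intro!: derivative_eq_intros)
    have "((\<lambda>t. r (x + t *\<^sub>R (y - x))) has_derivative (\<lambda>t. (t *\<^sub>R (y - x)) \<bullet> v)) (at (0::real))"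
      by (rule has_derivative_compose[OF lin]) (use dr in simp)
    then have "((\<lambda>t. r (x + t *\<^sub>R (y - x))) has_field_derivative ((y - x) \<bullet> v)) (at (0::real))"
      by (simp add: has_field_derivative_def mult_commute_abs)
    then have "((\<lambda>t. (r (x + t *\<^sub>R (y - x)) - r x) / t) \<longlongrightarrow> (y - x) \<bullet> v) (at 0)"
      by (simp add: has_field_derivative_iff)
    then have lim: "((\<lambda>t. (r (x + t *\<^sub>R (y - x)) - r x) / t) \<longlongrightarrow> (y - x) \<bullet> v) (at_right 0)"
      by (rule tendsto_mono[rotated]) (simp add: at_le)
    have "(r (x + t *\<^sub>R (y - x)) - r x) / t \<le> r y - r x" if t: "0 < t" "t < 1" for t
    proof -
      have "x + t *\<^sub>R (y - x) = (1 - t) *\<^sub>R x + t *\<^sub>R y" by (simp add: algebra_simps)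
      then have "r (x + t *\<^sub>R (y - x)) \<le> (1 - t) * r x + t * r y"
        using Gamma0_convexD[OF h, of "1 - t" t x y] t by (simp add: r)
      then show ?thesis using t by (simp add: field_simps)
    qed
    then have "\<forall>\<^sub>F t in at_right 0. (r (x + t *\<^sub>R (y - x)) - r x) / t \<le> r y - r x"
      unfolding eventually_at_right_field by (intro exI[of _ 1]) auto
    then have "(y - x) \<bullet> v \<le> r y - r x"
      by (intro tendsto_upperbound[OF lim]) auto
    then show ?thesis by (simp add: r inner_commute)
  qed
  with gradient_eq[OF v] show ?thesis by (simp add: subdiff_def)
qed

text \<open>The subgradient inequality at \<open>w\<close>, evaluated at \<open>x\<close>, replaces
  integration of the gradient along the segment. It gives \<open>L\<close> in place of the optimal
  \<open>L / 2\<close>, a loss that only affects constants.\<close>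

lemma lipschitz_gradient_upper:
  assumes h: "h \<in> Gamma0" and d: "differentiable_fun h" and L: "L-lipschitz_on UNIV (gradient h)"
  shows "h w \<le> ereal (real_of_ereal (h x) + gradient h x \<bullet> (w - x) + L * (norm (w - x))\<^sup>2)"
proof -
  note sub = gradient_in_subdiff[OF h d]
  have hw: "h w = ereal (real_of_ereal (h w))"
    using subdiff_finite[OF h sub] by (simp add: ereal_real)
  have "ereal (real_of_ereal (h w) + gradient h w \<bullet> (x - w)) \<le> h x"
    by (rule subdiff_le[OF h sub])
  then have 1: "real_of_ereal (h w) + gradient h w \<bullet> (x - w) \<le> real_of_ereal (h x)"
    using subdiff_finite[OF h sub, of x] by (cases "h x") auto
  have "(gradient h w - gradient h x) \<bullet> (w - x) \<le> norm (gradient h w - gradient h x) * norm (w - x)"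
    by (rule norm_cauchy_schwarz)
  also have "\<dots> \<le> (L * norm (w - x)) * norm (w - x)"
    using lipschitz_onD[OF L, of w x] by (intro mult_right_mono) (auto simp: dist_norm)
  finally have "real_of_ereal (h w) \<le> real_of_ereal (h x) + gradient h x \<bullet> (w - x) + L * (norm (w - x))\<^sup>2"
    using 1 by (simp add: inner_diff_left inner_diff_right power2_eq_square algebra_simps)
  then show ?thesis by (subst hw) simp
qed

text \<open>A quadratic upper bound at \<open>x0\<close> clashes with the affine minorant at \<open>y\<close> at the test point
  \<open>x0 + (u - d) / (2 * L)\<close>.\<close>

lemma subdiff_cocoercive:
  assumes h: "h \<in> Gamma0" and L: "L > 0" and u: "u \<in> subdiff h y"
    and up: "\<And>w. h w \<le> ereal (real_of_ereal (h x0) + d \<bullet> (w - x0) + L * (norm (w - x0))\<^sup>2)"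
  shows "real_of_ereal (h y) + u \<bullet> (x0 - y) + (norm (u - d))\<^sup>2 / (4 * L) \<le> real_of_ereal (h x0)"
proof -
  define w where "w = x0 + (1 / (2 * L)) *\<^sub>R (u - d)"
  have "ereal (real_of_ereal (h y) + u \<bullet> (w - y))
      \<le> ereal (real_of_ereal (h x0) + d \<bullet> (w - x0) + L * (norm (w - x0))\<^sup>2)"
    using subdiff_le[OF h u, of w] up[of w] by (rule order_trans)
  then have "real_of_ereal (h y) + u \<bullet> (x0 - y) + u \<bullet> (w - x0)
      \<le> real_of_ereal (h x0) + d \<bullet> (w - x0) + L * (norm (w - x0))\<^sup>2"
    by (simp add: inner_diff_right)
  moreover have "u \<bullet> (w - x0) - d \<bullet> (w - x0) = (norm (u - d))\<^sup>2 / (2 * L)"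
    by (simp add: w_def inner_diff_left power2_norm_eq_inner diff_divide_distrib)
  moreover have "L * (norm (w - x0))\<^sup>2 = (norm (u - d))\<^sup>2 / (4 * L)"
    using L by (simp add: w_def power_divide power_mult_distrib power2_eq_square)
  ultimately show ?thesis by (simp add: field_simps)
qed

text \<open>Monotonicity of the subdifferential, applied to \<open>u\<close> at \<open>x0\<close>
  and \<open>(x - p) / \<gamma>\<close> at \<open>p\<close>: in effect \<open>x0\<close> is the
  proximal point of \<open>x0 + \<gamma> *\<^sub>R u\<close>, and the map is nonexpansive.\<close>

lemma prox_dist_le:
  fixes x :: "'a::euclidean_space"
  assumes h: "h \<in> Gamma0" and u: "u \<in> subdiff h x0" and g: "\<gamma> > 0"
  shows "norm (prox \<gamma> h x - x0) \<le> norm (x - x0) + \<gamma> * norm u"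
proof -
  define p where "p = prox \<gamma> h x"
  note sub = prox_subgrad[OF assms, of x, folded p_def]
  have "real_of_ereal (h x0) + u \<bullet> (p - x0) \<le> real_of_ereal (h p)"
    using subdiff_le[OF h u, of p] subdiff_finite[OF h sub] by (cases "h p") auto
  moreover have "real_of_ereal (h p) + ((1 / \<gamma>) *\<^sub>R (x - p)) \<bullet> (x0 - p) \<le> real_of_ereal (h x0)"
    using subdiff_le[OF h sub, of x0] subdiff_finite[OF h u] by (cases "h x0") auto
  ultimately have "u \<bullet> (p - x0) + ((1 / \<gamma>) *\<^sub>R (x - p)) \<bullet> (x0 - p) \<le> 0" by simp
  then have "\<gamma> * (u \<bullet> (p - x0) + ((1 / \<gamma>) *\<^sub>R (x - p)) \<bullet> (x0 - p)) \<le> 0"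
    using g by (intro mult_nonneg_nonpos) auto
  then have "(p - x0) \<bullet> (p - x0) \<le> (x - x0 - \<gamma> *\<^sub>R u) \<bullet> (p - x0)"
    using g by (simp add: inner_diff_left inner_diff_right inner_commute algebra_simps)
  also have "\<dots> \<le> norm (x - x0 - \<gamma> *\<^sub>R u) * norm (p - x0)" by (rule norm_cauchy_schwarz)
  finally have "norm (p - x0) * norm (p - x0) \<le> norm (x - x0 - \<gamma> *\<^sub>R u) * norm (p - x0)"
    by (simp add: power2_norm_eq_inner[symmetric] power2_eq_square)
  then have "norm (p - x0) \<le> norm (x - x0 - \<gamma> *\<^sub>R u)"
    by (metis mult_right_le_imp_le norm_ge_zero norm_le_zero_iff order_le_less norm_zero)
  also have "\<dots> \<le> norm (x - x0) + \<gamma> * norm u"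
    using norm_triangle_ineq4[of "x - x0" "\<gamma> *\<^sub>R u"] g by simp
  finally show ?thesis by (simp add: p_def)
qed

text \<open>Coarse but valid for every step size, in contrast to the descent estimate; it serves to
  keep the second moments of the iterates finite.\<close>

lemma dr_step_growth:
  fixes x :: "'a::euclidean_space"
  assumes f: "f \<in> Gamma0" and g: "g \<in> Gamma0" and d: "d \<in> subdiff f xs" and p: "p \<in> subdiff g xs"
    and \<gamma>: "\<gamma> > 0" and y: "y = prox \<gamma> f x" and z: "z = prox \<gamma> g (2 *\<^sub>R y - x)"
  shows "norm (x + z - y - xs) \<le> 5 * norm (x - xs) + 3 * \<gamma> * norm d + \<gamma> * norm p"
proof -
  have 1: "norm (y - xs) \<le> norm (x - xs) + \<gamma> * norm d"
    unfolding y by (rule prox_dist_le[OF f d \<gamma>])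
  have 2: "norm (z - xs) \<le> norm (2 *\<^sub>R y - x - xs) + \<gamma> * norm p"
    unfolding z by (rule prox_dist_le[OF g p \<gamma>])
  have eq: "2 *\<^sub>R y - x - xs = 2 *\<^sub>R (y - xs) - (x - xs)" by (simp add: algebra_simps scaleR_2)
  have 3: "norm (2 *\<^sub>R y - x - xs) \<le> 2 * norm (y - xs) + norm (x - xs)"
    unfolding eq using norm_triangle_ineq4[of "2 *\<^sub>R (y - xs)" "x - xs"] by simp
  have eq: "x + z - y - xs = ((x - xs) + (z - xs)) - (y - xs)" by simp
  have "norm (x + z - y - xs) \<le> norm (x - xs) + norm (z - xs) + norm (y - xs)"
    unfolding eq using norm_triangle_ineq4[of "(x - xs) + (z - xs)" "y - xs"] norm_triangle_ineq[of "x - xs" "z - xs"]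
    by linarith
  with 1 2 3 show ?thesis by simp
qed

text \<open>With \<open>u = (x - y) / \<gamma>\<close> and \<open>v = (2 * y - x - z) / \<gamma>\<close>, subgradients at \<open>y\<close> and \<open>z\<close>, a step moves
  \<open>x\<close> by \<open>- \<gamma> * (u + v)\<close>, and the envelopes with the doubled parameter absorb the distances from \<open>x\<close>
  to \<open>y\<close> and \<open>z\<close>.\<close>

lemma dr_step_descent:
  fixes x :: "'a::euclidean_space"
  assumes f: "f \<in> Gamma0" and g: "g \<in> Gamma0" and d: "d \<in> subdiff f xs" and p: "p \<in> subdiff g xs"
    and L: "L > 0"
    and up: "\<And>w. f w \<le> ereal (real_of_ereal (f xs) + d \<bullet> (w - xs) + L * (norm (w - xs))\<^sup>2)"
    and \<gamma>: "\<gamma> > 0" "\<gamma> \<le> 1 / (8 * L)"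
    and y: "y = prox \<gamma> f x" and z: "z = prox \<gamma> g (2 *\<^sub>R y - x)"
  shows "(norm (x + z - y - xs))\<^sup>2 \<le> (norm (x - xs))\<^sup>2
      - 2 * \<gamma> * (real_of_ereal (moreau (2 * \<gamma>) f x) + real_of_ereal (moreau (2 * \<gamma>) g x)
          - real_of_ereal (f xs) - real_of_ereal (g xs))
      + 4 * \<gamma>\<^sup>2 * (norm d)\<^sup>2"
proof -
  define u where "u = (1 / \<gamma>) *\<^sub>R (x - y)"
  define v where "v = (1 / \<gamma>) *\<^sub>R (2 *\<^sub>R y - x - z)"
  define e where "e = x - xs"
  have u: "u \<in> subdiff f y"
    unfolding u_def y by (rule prox_subgrad[OF f d \<gamma>(1)])
  have v: "v \<in> subdiff g z"
    unfolding v_def z by (rule prox_subgrad[OF g p \<gamma>(1)])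
  have yu: "y = x - \<gamma> *\<^sub>R u" using \<gamma> by (simp add: u_def)
  have "\<gamma> *\<^sub>R v = 2 *\<^sub>R y - x - z" using \<gamma> by (simp add: v_def)
  then have zv: "z = x - \<gamma> *\<^sub>R (2 *\<^sub>R u + v)" by (simp add: yu algebra_simps scaleR_2[of x])
  define a where "a = real_of_ereal (f y)"
  define b where "b = real_of_ereal (g z)"
  have fa: "f y = ereal a" using subdiff_finite[OF f u] by (simp add: a_def ereal_real)
  have gb: "g z = ereal b" using subdiff_finite[OF g v] by (simp add: b_def ereal_real)
  define fs where "fs = real_of_ereal (f xs)"
  define gs where "gs = real_of_ereal (g xs)"
  define mf where "mf = real_of_ereal (moreau (2 * \<gamma>) f x)"
  define mg where "mg = real_of_ereal (moreau (2 * \<gamma>) g x)"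
  \<comment> \<open>Only \<open>f\<close> has the quadratic upper bound: its inequality carries the
    surplus \<open>(norm (u - d))\<^sup>2 / (4 * L)\<close>, which will pay for the square of
    \<open>u\<close>.\<close>
  have 1: "a + u \<bullet> (xs - y) + (norm (u - d))\<^sup>2 / (4 * L) \<le> fs"
    unfolding a_def fs_def by (rule subdiff_cocoercive[OF f L u up])
  have 2: "b + v \<bullet> (xs - z) \<le> gs"
    using subdiff_le[OF g v, of xs] subdiff_finite[OF g p] unfolding b_def gs_def
    by (cases "g xs") auto
  have 3: "mf \<le> a + (norm (y - x))\<^sup>2 / (2 * (2 * \<gamma>))"
    using moreau_le[of "2 * \<gamma>" f x y] moreau_finite[OF f d, of "2 * \<gamma>" x] \<gamma> unfolding mf_def
    by (cases "moreau (2 * \<gamma>) f x") (auto simp: fa)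
  have 4: "mg \<le> b + (norm (z - x))\<^sup>2 / (2 * (2 * \<gamma>))"
    using moreau_le[of "2 * \<gamma>" g x z] moreau_finite[OF g p, of "2 * \<gamma>" x] \<gamma> unfolding mg_def
    by (cases "moreau (2 * \<gamma>) g x") (auto simp: gb)
  define q where "q = (norm (u - d))\<^sup>2"
  have e1: "\<gamma> * a - \<gamma> * (u \<bullet> e) + \<gamma>\<^sup>2 * (u \<bullet> u) + \<gamma> * q / (4 * L) \<le> \<gamma> * fs"
  proof -
    have "\<gamma> * (a + u \<bullet> (xs - y) + q / (4 * L)) \<le> \<gamma> * fs"
      using 1 \<gamma> unfolding q_def by (intro mult_left_mono) auto
    moreover have "xs - y = \<gamma> *\<^sub>R u - e" by (simp add: yu e_def)
    ultimately show ?thesis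
      by (simp add: inner_diff_right power2_eq_square distrib_left right_diff_distrib mult.assoc)
  qed
  have e2: "\<gamma> * b - \<gamma> * (v \<bullet> e) + 2 * \<gamma>\<^sup>2 * (u \<bullet> v) + \<gamma>\<^sup>2 * (v \<bullet> v) \<le> \<gamma> * gs"
  proof -
    have "\<gamma> * (b + v \<bullet> (xs - z)) \<le> \<gamma> * gs"
      using 2 \<gamma> by (intro mult_left_mono) auto
    moreover have "xs - z = \<gamma> *\<^sub>R (2 *\<^sub>R u + v) - e" by (simp add: zv e_def)
    ultimately show ?thesis
      by (simp add: inner_diff_right inner_add_right power2_eq_square distrib_left right_diff_distrib
          mult.assoc inner_commute[of v u] mult.left_commute)
  qed
  have e3: "4 * (\<gamma> * mf) \<le> 4 * (\<gamma> * a) + \<gamma>\<^sup>2 * (u \<bullet> u)"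
  proof -
    have "4 * \<gamma> * mf \<le> 4 * \<gamma> * (a + (norm (y - x))\<^sup>2 / (2 * (2 * \<gamma>)))"
      using 3 \<gamma> by (intro mult_left_mono) auto
    moreover have "(norm (y - x))\<^sup>2 = \<gamma>\<^sup>2 * (u \<bullet> u)"
      by (simp add: yu power_mult_distrib power2_norm_eq_inner)
    ultimately show ?thesis using \<gamma> by (simp add: distrib_left)
  qed
  have e4: "4 * (\<gamma> * mg) \<le> 4 * (\<gamma> * b) + \<gamma>\<^sup>2 * (4 * (u \<bullet> u) + 4 * (u \<bullet> v) + v \<bullet> v)"
  proof -
    have "4 * \<gamma> * mg \<le> 4 * \<gamma> * (b + (norm (z - x))\<^sup>2 / (2 * (2 * \<gamma>)))"
      using 4 \<gamma> by (intro mult_left_mono) auto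
    also have "\<dots> = 4 * (\<gamma> * b) + (norm (z - x))\<^sup>2" using \<gamma> by (simp add: distrib_left)
    also have "(norm (z - x))\<^sup>2 = \<gamma>\<^sup>2 * ((2 *\<^sub>R u + v) \<bullet> (2 *\<^sub>R u + v))"
      by (simp add: zv power_mult_distrib power2_norm_eq_inner)
    also have "(2 *\<^sub>R u + v) \<bullet> (2 *\<^sub>R u + v) = 4 * (u \<bullet> u) + 4 * (u \<bullet> v) + v \<bullet> v"
      by (simp add: inner_add_left inner_add_right inner_commute)
    finally show ?thesis by (simp add: mult.assoc)
  qed
  have 5: "(norm (x + z - y - xs))\<^sup>2 = (norm e)\<^sup>2 - 2 * (\<gamma> * (u \<bullet> e)) - 2 * (\<gamma> * (v \<bullet> e))
      + \<gamma>\<^sup>2 * (u \<bullet> u + 2 * (u \<bullet> v) + v \<bullet> v)"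
  proof -
    have "x + z - y - xs = e - \<gamma> *\<^sub>R (u + v)" by (simp add: yu zv e_def algebra_simps)
      (metis mult_2_right scaleR_left_distrib)
    then have "(norm (x + z - y - xs))\<^sup>2 = (norm e)\<^sup>2 - 2 * \<gamma> * (e \<bullet> (u + v)) + \<gamma>\<^sup>2 * (norm (u + v))\<^sup>2"
      by (simp only: norm_diff_scaleR_sq)
    then show ?thesis
      unfolding power2_norm_eq_inner[of "u + v"]
      by (simp add: inner_add_left inner_add_right inner_commute[of v u] inner_commute[of e]
          distrib_left)
  qed
  have 6: "\<gamma>\<^sup>2 * (u \<bullet> u) \<le> \<gamma>\<^sup>2 * (2 * q + 2 * (norm d)\<^sup>2)"
  proof -
    have "0 \<le> (norm ((u - d) - d))\<^sup>2" by simp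
    also have "\<dots> = 2 * q + 2 * (norm d)\<^sup>2 - u \<bullet> u"
      unfolding q_def power2_norm_eq_inner
      by (simp add: inner_diff_left inner_diff_right inner_commute[of d u])
    finally show ?thesis by (intro mult_left_mono) auto
  qed
  \<comment> \<open>The bound \<open>1 / (8 * L)\<close> on the step lets the cocoercive surplus
    dominate an error of order \<open>\<gamma>\<^sup>2\<close>.\<close>
  have 7: "2 * (\<gamma>\<^sup>2 * q) \<le> \<gamma> * q / (4 * L)"
  proof -
    have "2 * \<gamma> \<le> 1 / (4 * L)" using \<gamma> L by (simp add: field_simps)
    then have "\<gamma> * q * (2 * \<gamma>) \<le> \<gamma> * q * (1 / (4 * L))"
      using \<gamma> by (intro mult_left_mono) (auto simp: q_def)
    then show ?thesis by (simp add: power2_eq_square mult_ac)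
  qed
  have 8: "0 \<le> \<gamma>\<^sup>2 * (v \<bullet> v)" "0 \<le> \<gamma>\<^sup>2 * (norm d)\<^sup>2" "0 \<le> \<gamma>\<^sup>2 * q"
    by (simp_all add: q_def)
  note scaled = e1 e2 e3 e4 5 6 7
  \<comment> \<open>Add to \<open>5\<close> twice \<open>e1\<close> and \<open>e2\<close> and half
    of \<open>e3\<close> and \<open>e4\<close>. In units of \<open>\<gamma>\<^sup>2\<close>, the
    products of \<open>u\<close> and \<open>v\<close> cancel, \<open>v \<bullet> v\<close> keeps the
    coefficient -1/2 and \<open>u \<bullet> u\<close> the coefficient 3/2, which \<open>6\<close>
    turns into \<open>3 * q + 3 * (norm d)\<^sup>2\<close>; twice \<open>7\<close> absorbs the
    \<open>q\<close> part.\<close>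
  have "(norm (x + z - y - xs))\<^sup>2 \<le> (norm e)\<^sup>2
      - 2 * (\<gamma> * mf) - 2 * (\<gamma> * mg) + 2 * (\<gamma> * fs) + 2 * (\<gamma> * gs) + 4 * (\<gamma>\<^sup>2 * (norm d)\<^sup>2)"
    using 8
      scaled[unfolded distrib_left mult.assoc mult.left_commute[of "\<gamma>\<^sup>2" 2]
        mult.left_commute[of "\<gamma>\<^sup>2" 4]]
    by linarith
  then show ?thesis
    by (simp add: e_def mf_def mg_def fs_def gs_def algebra_simps)
qed

section \<open>Distance to a convex set\<close>

lemma infdist_closest_point:
  fixes S :: "'a::euclidean_space set"
  assumes "S \<noteq> {}"
  shows "infdist x S = dist x (closest_point (closure S) x)"
  using setdist_closest_point[of "closure S" x] assms by (simp add: infdist_eq_setdist)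

lemma convex_on_infdist:
  fixes S :: "'a::euclidean_space set"
  assumes "convex S" "S \<noteq> {}"
  shows "convex_on UNIV (\<lambda>x. infdist x S)"
proof (rule convex_onI)
  fix t :: real and x y :: 'a
  assume t: "0 < t" "t < 1"
  let ?z = "(1 - t) *\<^sub>R x + t *\<^sub>R y"
  let ?p = "closest_point (closure S) x" and ?q = "closest_point (closure S) y"
  have "?p \<in> closure S" "?q \<in> closure S"
    using assms by (auto intro: closest_point_in_set)
  then have "(1 - t) *\<^sub>R ?p + t *\<^sub>R ?q \<in> closure S"
    using convex_closure[OF assms(1)] t by (auto simp: convex_def)
  then have "infdist ?z (closure S) \<le> dist ?z ((1 - t) *\<^sub>R ?p + t *\<^sub>R ?q)"
    by (rule infdist_le)
  also have "\<dots> = norm ((1 - t) *\<^sub>R (x - ?p) + t *\<^sub>R (y - ?q))"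
    by (simp add: dist_norm algebra_simps)
  also have "\<dots> \<le> (1 - t) * dist x ?p + t * dist y ?q"
    using norm_triangle_ineq[of "(1 - t) *\<^sub>R (x - ?p)" "t *\<^sub>R (y - ?q)"] t by (simp add: dist_norm)
  finally show "infdist ?z S \<le> (1 - t) * infdist x S + t * infdist y S"
    using assms by (simp add: infdist_closest_point)
qed simp

text \<open>Jensen by a supporting functional: with \<open>p\<close> the projection of the mean
  \<open>m\<close> and \<open>u\<close> the unit vector from \<open>p\<close> to \<open>m\<close>,
  the affine function \<open>u \<bullet> (x - p)\<close> lies below the distance everywhere and
  equals it at \<open>m\<close>.\<close>

lemma infdist_integral_le:
  fixes X :: "'w \<Rightarrow> 'a::euclidean_space"
  assumes M: "prob_space M" and X: "integrable M X" and S: "convex S" "S \<noteq> {}"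
  shows "infdist (\<integral>\<omega>. X \<omega> \<partial>M) S \<le> (\<integral>\<omega>. infdist (X \<omega>) S \<partial>M)"
proof -
  interpret prob_space M by fact
  obtain s where s: "s \<in> S" using S by blast
  have int: "integrable M (\<lambda>\<omega>. infdist (X \<omega>) S)"
  proof (rule Bochner_Integration.integrable_bound)
    show "integrable M (\<lambda>\<omega>. norm (X \<omega> - s))" using X by simp
    show "(\<lambda>\<omega>. infdist (X \<omega>) S) \<in> borel_measurable M"
      using borel_measurable_integrable[OF X]
      by (rule borel_measurable_continuous_on[rotated]) (auto intro!: continuous_intros)
  qed (auto simp: infdist_nonneg dist_norm[symmetric] intro!: infdist_le s)
  define m where "m = (\<integral>\<omega>. X \<omega> \<partial>M)"
  define p where "p = closest_point (closure S) m"
  show ?thesis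
  proof (cases "m = p")
    case True
    then have "infdist m S = 0" unfolding infdist_closest_point[OF S(2)] p_def[symmetric] by simp
    then show ?thesis by (simp add: m_def[symmetric] infdist_nonneg)
  next
    case False
    define u where "u = (1 / norm (m - p)) *\<^sub>R (m - p)"
    have nu: "norm u = 1" using False by (simp add: u_def)
    have le: "u \<bullet> (x - p) \<le> infdist x S" for x
    proof -
      let ?q = "closest_point (closure S) x"
      have "?q \<in> closure S" using S by (auto intro: closest_point_in_set)
      then have "(m - p) \<bullet> (?q - p) \<le> 0"
        unfolding p_def using S by (intro closest_point_dot convex_closure) auto
      then have "u \<bullet> (?q - p) \<le> 0" by (simp add: u_def divide_le_0_iff)
      moreover have "u \<bullet> (x - ?q) \<le> norm (x - ?q)"
        using norm_cauchy_schwarz[of u "x - ?q"] nu by simp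
      ultimately have "u \<bullet> (x - p) \<le> norm (x - ?q)" by (simp add: inner_diff_right)
      then show ?thesis using S by (simp add: infdist_closest_point dist_norm)
    qed
    have "infdist m S = norm (m - p)"
      using S by (simp add: infdist_closest_point p_def dist_norm)
    also have "\<dots> = u \<bullet> (m - p)"
      using False by (simp add: u_def power2_norm_eq_inner[symmetric] power2_eq_square)
    also have "\<dots> = (\<integral>\<omega>. u \<bullet> (X \<omega> - p) \<partial>M)"
      using X by (simp add: m_def inner_diff_right prob_space)
    also have "\<dots> \<le> (\<integral>\<omega>. infdist (X \<omega>) S \<partial>M)"
      using X int le by (intro integral_mono) auto
    finally show ?thesis by (simp add: m_def)
  qed
qed

section \<open>The mean gap\<close>

lemma ereal_integral_eq:
  assumes r: "integrable M r" and h: "AE s in M. h s = ereal (r s)"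
  shows "ereal_integral M h = ereal (\<integral>s. r s \<partial>M)"
proof -
  have 1: "(\<integral>\<^sup>+ s. e2ennreal (h s) \<partial>M) = (\<integral>\<^sup>+ s. ennreal (r s) \<partial>M)"
    using h by (intro nn_integral_cong_AE) (auto elim!: eventually_mono)
  have 2: "(\<integral>\<^sup>+ s. e2ennreal (- h s) \<partial>M) = (\<integral>\<^sup>+ s. ennreal (- r s) \<partial>M)"
    using h by (intro nn_integral_cong_AE) (auto elim!: eventually_mono)
  have "(\<integral>\<^sup>+ s. ennreal (r s) \<partial>M) \<noteq> top" "(\<integral>\<^sup>+ s. ennreal (- r s) \<partial>M) \<noteq> top"
    using r by (auto simp: real_integrable_def)
  then show ?thesis
    unfolding ereal_integral_def 1 2 real_lebesgue_integral_def[OF r]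
    by (cases "\<integral>\<^sup>+ s. ennreal (r s) \<partial>M"; cases "\<integral>\<^sup>+ s. ennreal (- r s) \<partial>M") auto
qed

text \<open>Since \<open>\<infinity> - \<infinity>\<close> is \<open>\<infinity>\<close> in
  \<open>ereal\<close>, the difference is finite only if both parts are.\<close>

lemma ereal_integral_finite:
  assumes h: "h \<in> borel_measurable M" and fin: "AE s in M. \<bar>h s\<bar> \<noteq> \<infinity>"
    and I: "\<bar>ereal_integral M h\<bar> \<noteq> \<infinity>"
  shows "integrable M (\<lambda>s. real_of_ereal (h s))"
proof -
  have 1: "(\<integral>\<^sup>+ s. e2ennreal (h s) \<partial>M) = (\<integral>\<^sup>+ s. ennreal (real_of_ereal (h s)) \<partial>M)"
    using fin by (intro nn_integral_cong_AE) (auto elim!: eventually_mono)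
  have 2: "(\<integral>\<^sup>+ s. e2ennreal (- h s) \<partial>M) = (\<integral>\<^sup>+ s. ennreal (- real_of_ereal (h s)) \<partial>M)"
    using fin by (intro nn_integral_cong_AE) (auto elim!: eventually_mono)
  have "(\<integral>\<^sup>+ s. ennreal (real_of_ereal (h s)) \<partial>M) \<noteq> top"
    "(\<integral>\<^sup>+ s. ennreal (- real_of_ereal (h s)) \<partial>M) \<noteq> top"
    using I unfolding ereal_integral_def 1 2
    by (cases "\<integral>\<^sup>+ s. ennreal (real_of_ereal (h s)) \<partial>M";
        cases "\<integral>\<^sup>+ s. ennreal (- real_of_ereal (h s)) \<partial>M"; auto)+
  then show ?thesis
    using h by (auto simp: real_integrable_def)
qed

lemma filterlim_inverse_Suc_at_right: "filterlim (\<lambda>n. inverse (real (Suc n))) (at_right 0) sequentially"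
  using LIMSEQ_inverse_real_of_nat by (simp add: filterlim_at)

text \<open>The envelope of \<open>k\<close> at \<open>x\<close> is at least its affine minorant up
  to a multiple of the parameter. The bound on the sum then leaves the envelope of \<open>h\<close>
  no room above its own minorant in the limit, whereas it eventually reaches every real
  \<open>c\<close> below \<open>h x\<close>.\<close>

lemma moreau_sum_bound_imp_eq:
  fixes x :: "'a::euclidean_space"
  assumes h: "h \<in> Gamma0" and u: "u \<in> subdiff h x0" and k: "k \<in> Gamma0" and v: "v \<in> subdiff k x0"
    and le: "\<And>n. real_of_ereal (moreau (inverse (real (Suc n))) h x)
        + real_of_ereal (moreau (inverse (real (Suc n))) k x)
      \<le> real_of_ereal (h x0) + real_of_ereal (k x0) + (u + v) \<bullet> (x - x0)"
  shows "h x = ereal (real_of_ereal (h x0) + u \<bullet> (x - x0))"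
proof (rule antisym)
  show "h x \<le> ereal (real_of_ereal (h x0) + u \<bullet> (x - x0))"
  proof (rule ccontr)
    assume "\<not> ?thesis"
    then have "ereal (real_of_ereal (h x0) + u \<bullet> (x - x0)) < h x" by (simp only: not_le)
    then obtain c where c: "real_of_ereal (h x0) + u \<bullet> (x - x0) < c" "ereal c < h x"
      using ereal_dense2[of "ereal (real_of_ereal (h x0) + u \<bullet> (x - x0))" "h x"] by auto
    have "\<forall>\<^sub>F n in sequentially. ereal c \<le> moreau (inverse (real (Suc n))) h x"
      using filterlim_iff[THEN iffD1, OF filterlim_inverse_Suc_at_right, rule_format,
        OF moreau_ge_of_less[OF h u c(2)]] .
    then have "\<forall>\<^sub>F n in sequentially. c - inverse (real (Suc n)) / 2 * (norm v)\<^sup>2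
        \<le> real_of_ereal (h x0) + u \<bullet> (x - x0)"
    proof eventually_elim
      case (elim n)
      let ?g = "inverse (real (Suc n))"
      have "c \<le> real_of_ereal (moreau ?g h x)"
        using elim moreau_finite[OF h u, of ?g x] by (cases "moreau ?g h x") auto
      moreover have "real_of_ereal (k x0) + v \<bullet> (x - x0) - ?g / 2 * (norm v)\<^sup>2
          \<le> real_of_ereal (moreau ?g k x)"
        using moreau_lower[OF k v, of ?g x] moreau_finite[OF k v, of ?g x]
        by (cases "moreau ?g k x") auto
      ultimately show ?case
        using le[of n] by (simp add: inner_add_left)
    qed
    moreover have "(\<lambda>n. c - inverse (real (Suc n)) / 2 * (norm v)\<^sup>2) \<longlonglongrightarrow> c - 0 / 2 * (norm v)\<^sup>2"
      by (intro tendsto_intros LIMSEQ_inverse_real_of_nat) auto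
    ultimately have "c \<le> real_of_ereal (h x0) + u \<bullet> (x - x0)"
      by (intro tendsto_upperbound[of "\<lambda>n. c - inverse (real (Suc n)) / 2 * (norm v)\<^sup>2" c sequentially]) auto
    with c show False by simp
  qed
qed (rule subdiff_le[OF h u])

text \<open>In the application \<open>d s\<close> is the gradient of \<open>f(\<cdot>, s)\<close> at \<open>xs\<close>; its Lipschitz continuity enters only
  through the quadratic upper bound \<open>upper\<close>.\<close>

locale stochastic_dr = prob_space M
  for M :: "'s measure" +
  fixes f g :: "'a::euclidean_space \<Rightarrow> 's \<Rightarrow> ereal"
    and xs :: 'a and d \<phi> :: "'s \<Rightarrow> 'a" and L :: real
  assumes f_G0: "\<And>s. s \<in> space M \<Longrightarrow> (\<lambda>y. f y s) \<in> Gamma0"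
    and g_G0: "\<And>s. s \<in> space M \<Longrightarrow> (\<lambda>y. g y s) \<in> Gamma0"
    and meas_f [measurable]: "\<And>x. (\<lambda>s. f x s) \<in> borel_measurable M"
    and meas_g [measurable]: "\<And>x. (\<lambda>s. g x s) \<in> borel_measurable M"
    and meas_prox_f: "\<And>\<gamma>. \<gamma> > 0 \<Longrightarrow>
          (\<lambda>(x, s). prox \<gamma> (\<lambda>y. f y s) x) \<in> borel_measurable (borel \<Otimes>\<^sub>M M)"
    and meas_prox_g: "\<And>\<gamma>. \<gamma> > 0 \<Longrightarrow>
          (\<lambda>(x, s). prox \<gamma> (\<lambda>y. g y s) x) \<in> borel_measurable (borel \<Otimes>\<^sub>M M)"
    and meas_moreau_f: "\<And>\<gamma> x. \<gamma> > 0 \<Longrightarrow> (\<lambda>s. moreau \<gamma> (\<lambda>y. f y s) x) \<in> borel_measurable M"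
    and meas_moreau_g: "\<And>\<gamma> x. \<gamma> > 0 \<Longrightarrow> (\<lambda>s. moreau \<gamma> (\<lambda>y. g y s) x) \<in> borel_measurable M"
    and d: "AE s in M. d s \<in> subdiff (\<lambda>y. f y s) xs"
    and \<phi>: "AE s in M. \<phi> s \<in> subdiff (\<lambda>y. g y s) xs"
    and L: "L > 0"
    and upper: "AE s in M. \<forall>w. f w s
          \<le> ereal (real_of_ereal (f xs s) + d s \<bullet> (w - xs) + L * (norm (w - xs))\<^sup>2)"
    and meas_d [measurable]: "d \<in> borel_measurable M"
    and meas_\<phi> [measurable]: "\<phi> \<in> borel_measurable M"
    and sq_d: "integrable M (\<lambda>s. (norm (d s))\<^sup>2)"
    and sq_\<phi>: "integrable M (\<lambda>s. (norm (\<phi> s))\<^sup>2)"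
    and mean_zero: "(\<integral>s. d s \<partial>M) + (\<integral>s. \<phi> s \<partial>M) = 0"
begin

lemma good: "AE s in M. s \<in> space M \<and> d s \<in> subdiff (\<lambda>y. f y s) xs \<and> \<phi> s \<in> subdiff (\<lambda>y. g y s) xs"
  using d \<phi> AE_space by eventually_elim auto

lemma integrable_of_square:
  fixes v :: "'s \<Rightarrow> 'a"
  assumes [measurable]: "v \<in> borel_measurable M" and "integrable M (\<lambda>s. (norm (v s))\<^sup>2)"
  shows "integrable M v"
  using square_integrable_imp_integrable[of "\<lambda>s. norm (v s)"] assms(2)
  by (simp add: integrable_norm_iff)

lemma integrable_d: "integrable M d" and integrable_\<phi>: "integrable M \<phi>"
  using sq_d sq_\<phi> by (auto intro: integrable_of_square)

definition dr_step :: "real \<Rightarrow> 'a \<Rightarrow> 's \<Rightarrow> 'a" where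
  "dr_step \<gamma> x s =
     (let y = prox \<gamma> (\<lambda>v. f v s) x; z = prox \<gamma> (\<lambda>v. g v s) (2 *\<^sub>R y - x) in x + z - y)"

lemma measurable_dr_step:
  assumes "\<gamma> > 0"
  shows "(\<lambda>(x, s). dr_step \<gamma> x s) \<in> borel_measurable (borel \<Otimes>\<^sub>M M)"
proof -
  have 1[measurable]: "(\<lambda>p. prox \<gamma> (\<lambda>v. f v (snd p)) (fst p)) \<in> borel_measurable (borel \<Otimes>\<^sub>M M)"
    using meas_prox_f[OF assms] by (simp add: split_beta')
  have "(\<lambda>p. (2 *\<^sub>R prox \<gamma> (\<lambda>v. f v (snd p)) (fst p) - fst p, snd p)) \<in> borel \<Otimes>\<^sub>M M \<rightarrow>\<^sub>M borel \<Otimes>\<^sub>M M"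
    by measurable
  from measurable_compose[OF this meas_prox_g[OF assms]]
  have [measurable]: "(\<lambda>p. prox \<gamma> (\<lambda>v. g v (snd p)) (2 *\<^sub>R prox \<gamma> (\<lambda>v. f v (snd p)) (fst p) - fst p))
      \<in> borel_measurable (borel \<Otimes>\<^sub>M M)"
    by simp
  show ?thesis
    unfolding dr_step_def Let_def split_beta' by measurable
qed

text \<open>Square of the growth estimate with \<open>(a + b + c)\<^sup>2 \<le> 3 * a\<^sup>2 + 3 *
  b\<^sup>2 + 3 * c\<^sup>2\<close>, hence 75 = 3 * 25 and 27 = 3 * 9.\<close>

lemma dr_step_bound:
  assumes "\<gamma> > 0"
  shows "(\<integral>\<^sup>+ s. ennreal ((norm (dr_step \<gamma> x s - xs))\<^sup>2) \<partial>M) \<le>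
    ennreal (75 * (norm (x - xs))\<^sup>2 + 27 * \<gamma>\<^sup>2 * (\<integral>s. (norm (d s))\<^sup>2 \<partial>M) + 3 * \<gamma>\<^sup>2 * (\<integral>s. (norm (\<phi> s))\<^sup>2 \<partial>M))"
proof -
  have "(\<integral>\<^sup>+ s. ennreal ((norm (dr_step \<gamma> x s - xs))\<^sup>2) \<partial>M)
      \<le> (\<integral>\<^sup>+ s. ennreal (75 * (norm (x - xs))\<^sup>2 + 27 * \<gamma>\<^sup>2 * (norm (d s))\<^sup>2 + 3 * \<gamma>\<^sup>2 * (norm (\<phi> s))\<^sup>2) \<partial>M)"
    using good
  proof (intro nn_integral_mono_AE, eventually_elim)
    case (elim s)
    have sq: "(a + b + c)\<^sup>2 \<le> 3 * a\<^sup>2 + 3 * b\<^sup>2 + 3 * c\<^sup>2" for a b c :: real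
    proof -
      have "0 \<le> (a - b)\<^sup>2 + (b - c)\<^sup>2 + (a - c)\<^sup>2" by simp
      then show ?thesis by (simp add: power2_eq_square algebra_simps)
    qed
    have "norm (dr_step \<gamma> x s - xs) \<le> 5 * norm (x - xs) + 3 * \<gamma> * norm (d s) + \<gamma> * norm (\<phi> s)"
      unfolding dr_step_def Let_def
      using dr_step_growth[OF f_G0 g_G0, of s s "d s" xs "\<phi> s" \<gamma>] elim assms by simp
    then have "(norm (dr_step \<gamma> x s - xs))\<^sup>2
        \<le> (5 * norm (x - xs) + 3 * \<gamma> * norm (d s) + \<gamma> * norm (\<phi> s))\<^sup>2"
      by (intro power_mono) auto
    also have "\<dots> \<le> 75 * (norm (x - xs))\<^sup>2 + 27 * \<gamma>\<^sup>2 * (norm (d s))\<^sup>2 + 3 * \<gamma>\<^sup>2 * (norm (\<phi> s))\<^sup>2"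
      using sq[of "5 * norm (x - xs)" "3 * \<gamma> * norm (d s)" "\<gamma> * norm (\<phi> s)"]
      by (simp add: power_mult_distrib)
    finally show ?case by (rule ennreal_leI)
  qed
  also have "\<dots> = ennreal (\<integral>s. 75 * (norm (x - xs))\<^sup>2 + 27 * \<gamma>\<^sup>2 * (norm (d s))\<^sup>2 + 3 * \<gamma>\<^sup>2 * (norm (\<phi> s))\<^sup>2 \<partial>M)"
    using sq_d sq_\<phi> by (intro nn_integral_eq_integral) auto
  also have "(\<integral>s. 75 * (norm (x - xs))\<^sup>2 + 27 * \<gamma>\<^sup>2 * (norm (d s))\<^sup>2 + 3 * \<gamma>\<^sup>2 * (norm (\<phi> s))\<^sup>2 \<partial>M)
     = 75 * (norm (x - xs))\<^sup>2 + 27 * \<gamma>\<^sup>2 * (\<integral>s. (norm (d s))\<^sup>2 \<partial>M) + 3 * \<gamma>\<^sup>2 * (\<integral>s. (norm (\<phi> s))\<^sup>2 \<partial>M)"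
    using sq_d sq_\<phi> by (simp add: prob_space)
  finally show ?thesis .
qed

text \<open>Subtracting the values at \<open>xs\<close> inside the integral leaves, for positive
  parameters, a function of \<open>s\<close> between integrable bounds at every \<open>x\<close>,
  also where \<open>F\<close> or \<open>G\<close> is infinite. The default of
  \<open>real_of_ereal\<close> at infinite values then occurs only on a null set.\<close>

definition gap :: "real \<Rightarrow> 'a \<Rightarrow> 's \<Rightarrow> real" where
  "gap \<gamma> x s = real_of_ereal (moreau \<gamma> (\<lambda>y. f y s) x) + real_of_ereal (moreau \<gamma> (\<lambda>y. g y s) x)
     - real_of_ereal (f xs s) - real_of_ereal (g xs s)"

definition mean_gap :: "real \<Rightarrow> 'a \<Rightarrow> real" where
  "mean_gap \<gamma> x = (\<integral>s. gap \<gamma> x s \<partial>M)"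

lemma measurable_gap [measurable]: "\<gamma> > 0 \<Longrightarrow> gap \<gamma> x \<in> borel_measurable M"
  unfolding gap_def using meas_moreau_f[of \<gamma> x] meas_moreau_g[of \<gamma> x] by measurable

lemma gap_bounds:
  assumes "\<gamma> > 0"
  shows "AE s in M. (d s + \<phi> s) \<bullet> (x - xs) - \<gamma> / 2 * ((norm (d s))\<^sup>2 + (norm (\<phi> s))\<^sup>2) \<le> gap \<gamma> x s
    \<and> gap \<gamma> x s \<le> (norm (x - xs))\<^sup>2 / \<gamma>"
  using good
proof eventually_elim
  case (elim s)
  let ?f = "\<lambda>y. f y s" and ?g = "\<lambda>y. g y s"
  have h: "?f \<in> Gamma0" "d s \<in> subdiff ?f xs" "?g \<in> Gamma0" "\<phi> s \<in> subdiff ?g xs"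
    using elim f_G0 g_G0 by auto
  have "real_of_ereal (f xs s) + d s \<bullet> (x - xs) - \<gamma> / 2 * (norm (d s))\<^sup>2 \<le> real_of_ereal (moreau \<gamma> ?f x)
    \<and> real_of_ereal (moreau \<gamma> ?f x) \<le> real_of_ereal (f xs s) + (norm (x - xs))\<^sup>2 / (2 * \<gamma>)"
    using moreau_lower[OF h(1,2) assms, of x] moreau_upper[OF h(1,2), of \<gamma> x]
      moreau_finite[OF h(1,2) assms, of x]
    by (cases "moreau \<gamma> ?f x") (auto simp: norm_minus_commute)
  moreover have "real_of_ereal (g xs s) + \<phi> s \<bullet> (x - xs) - \<gamma> / 2 * (norm (\<phi> s))\<^sup>2 \<le> real_of_ereal (moreau \<gamma> ?g x)
    \<and> real_of_ereal (moreau \<gamma> ?g x) \<le> real_of_ereal (g xs s) + (norm (x - xs))\<^sup>2 / (2 * \<gamma>)"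
    using moreau_lower[OF h(3,4) assms, of x] moreau_upper[OF h(3,4), of \<gamma> x]
      moreau_finite[OF h(3,4) assms, of x]
    by (cases "moreau \<gamma> ?g x") (auto simp: norm_minus_commute)
  moreover have "(norm (x - xs))\<^sup>2 / (2 * \<gamma>) + (norm (x - xs))\<^sup>2 / (2 * \<gamma>) = (norm (x - xs))\<^sup>2 / \<gamma>"
    using assms by (simp add: field_simps)
  ultimately show ?case
    unfolding gap_def by (auto simp: inner_add_left distrib_left)
qed

lemma gap_antimono:
  assumes "0 < \<gamma>" "\<gamma> \<le> \<gamma>'"
  shows "AE s in M. gap \<gamma>' x s \<le> gap \<gamma> x s"
  using good
proof eventually_elim
  case (elim s)
  let ?f = "\<lambda>y. f y s" and ?g = "\<lambda>y. g y s"
  have h: "?f \<in> Gamma0" "d s \<in> subdiff ?f xs" "?g \<in> Gamma0" "\<phi> s \<in> subdiff ?g xs"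
    using elim f_G0 g_G0 by auto
  have "real_of_ereal (moreau \<gamma>' ?f x) \<le> real_of_ereal (moreau \<gamma> ?f x)"
    using moreau_antimono[OF assms, of ?f x] moreau_finite[OF h(1,2), of \<gamma> x] moreau_finite[OF h(1,2), of \<gamma>' x]
      assms
    by (cases "moreau \<gamma> ?f x"; cases "moreau \<gamma>' ?f x") auto

  moreover have "real_of_ereal (moreau \<gamma>' ?g x) \<le> real_of_ereal (moreau \<gamma> ?g x)"
    using moreau_antimono[OF assms, of ?g x] moreau_finite[OF h(3,4), of \<gamma> x] moreau_finite[OF h(3,4), of \<gamma>' x]
      assms
    by (cases "moreau \<gamma> ?g x"; cases "moreau \<gamma>' ?g x") auto

  ultimately show ?case unfolding gap_def by simp
qed

end

text \<open>A point of \<open>Argmin\<close> may have value \<open>\<infinity>\<close>; this is the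
  nondegenerate case, where the values at \<open>xs\<close> can be integrated.\<close>

locale stochastic_dr_finite = stochastic_dr M f g xs d \<phi> L
  for M :: "'s measure" and f g :: "'a::euclidean_space \<Rightarrow> 's \<Rightarrow> ereal" and xs d \<phi> L +
  assumes finite_f: "\<bar>ereal_integral M (\<lambda>s. f xs s)\<bar> \<noteq> \<infinity>"
    and finite_g: "\<bar>ereal_integral M (\<lambda>s. g xs s)\<bar> \<noteq> \<infinity>"
begin

lemma finite_at_xs: "AE s in M. \<bar>f xs s\<bar> \<noteq> \<infinity>" "AE s in M. \<bar>g xs s\<bar> \<noteq> \<infinity>"
proof -
  show "AE s in M. \<bar>f xs s\<bar> \<noteq> \<infinity>"
    using good
  proof eventually_elim
    case (elim s)
    then show ?case by (intro subdiff_finite[OF f_G0, of s "d s" xs]) simp_all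
  qed
  show "AE s in M. \<bar>g xs s\<bar> \<noteq> \<infinity>"
    using good
  proof eventually_elim
    case (elim s)
    then show ?case by (intro subdiff_finite[OF g_G0, of s "\<phi> s" xs]) simp_all
  qed
qed

lemma integrable_f: "integrable M (\<lambda>s. real_of_ereal (f xs s))"
  and integrable_g: "integrable M (\<lambda>s. real_of_ereal (g xs s))"
  by (rule ereal_integral_finite[OF meas_f finite_at_xs(1) finite_f],
      rule ereal_integral_finite[OF meas_g finite_at_xs(2) finite_g])

lemma integrable_gap:
  assumes "\<gamma> > 0"
  shows "integrable M (gap \<gamma> x)"
proof (rule Bochner_Integration.integrable_bound)
  let ?b = "\<lambda>s. \<bar>(d s + \<phi> s) \<bullet> (x - xs)\<bar> + \<gamma> / 2 * ((norm (d s))\<^sup>2 + (norm (\<phi> s))\<^sup>2)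
      + (norm (x - xs))\<^sup>2 / \<gamma>"
  show "integrable M ?b"
    using integrable_d integrable_\<phi> sq_d sq_\<phi> by auto
  show "AE s in M. norm (gap \<gamma> x s) \<le> norm (?b s)"
    using gap_bounds[OF assms, of x]
  proof eventually_elim
    case (elim s)
    have "0 \<le> \<gamma> / 2 * ((norm (d s))\<^sup>2 + (norm (\<phi> s))\<^sup>2)" "0 \<le> (norm (x - xs))\<^sup>2 / \<gamma>"
      using assms by auto
    with elim have "\<bar>gap \<gamma> x s\<bar> \<le> ?b s" by linarith
    then show ?case by simp
  qed
qed (use assms in auto)

lemma mean_linear_zero: "(\<integral>s. (d s + \<phi> s) \<bullet> v \<partial>M) = 0"
  using integrable_d integrable_\<phi> mean_zero by (simp add: Bochner_Integration.integral_add)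

text \<open>The linear part of the pointwise lower bound integrates to 0 because the means of
  \<open>d\<close> and \<open>\<phi>\<close> cancel; only the squared norms survive.\<close>

lemma mean_gap_ge:
  assumes "\<gamma> > 0"
  shows "- (\<gamma> / 2 * ((\<integral>s. (norm (d s))\<^sup>2 \<partial>M) + (\<integral>s. (norm (\<phi> s))\<^sup>2 \<partial>M))) \<le> mean_gap \<gamma> x"
proof -
  have "(\<integral>s. (d s + \<phi> s) \<bullet> (x - xs) - \<gamma> / 2 * ((norm (d s))\<^sup>2 + (norm (\<phi> s))\<^sup>2) \<partial>M) \<le> mean_gap \<gamma> x"
    unfolding mean_gap_def using gap_bounds[OF assms, of x] integrable_d integrable_\<phi> sq_d sq_\<phi> integrable_gap[OF assms]
    by (intro integral_mono_AE) auto
  also have "(\<integral>s. (d s + \<phi> s) \<bullet> (x - xs) - \<gamma> / 2 * ((norm (d s))\<^sup>2 + (norm (\<phi> s))\<^sup>2) \<partial>M)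
     = (\<integral>s. (d s + \<phi> s) \<bullet> (x - xs) \<partial>M) - \<gamma> / 2 * ((\<integral>s. (norm (d s))\<^sup>2 \<partial>M) + (\<integral>s. (norm (\<phi> s))\<^sup>2 \<partial>M))"
    using integrable_d integrable_\<phi> sq_d sq_\<phi>
    by (subst Bochner_Integration.integral_diff) auto
  finally show ?thesis by (simp add: mean_linear_zero)
qed

lemma mean_gap_xs: "\<gamma> > 0 \<Longrightarrow> mean_gap \<gamma> xs \<le> 0"
  unfolding mean_gap_def using gap_bounds[of \<gamma> xs] integral_mono_AE[OF integrable_gap integrable_zero, of \<gamma> xs]
  by (auto elim!: eventually_mono)

lemma mean_gap_antimono:
  assumes "0 < \<gamma>" "\<gamma> \<le> \<gamma>'"
  shows "mean_gap \<gamma>' x \<le> mean_gap \<gamma> x"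
  unfolding mean_gap_def using assms by (intro integral_mono_AE integrable_gap gap_antimono) auto

lemma convex_on_mean_gap:
  assumes "\<gamma> > 0"
  shows "convex_on UNIV (mean_gap \<gamma>)"
proof (rule convex_onI)
  fix t :: real and x y :: 'a
  assume t: "0 < t" "t < 1"
  have "mean_gap \<gamma> ((1 - t) *\<^sub>R x + t *\<^sub>R y) \<le> (\<integral>s. (1 - t) * gap \<gamma> x s + t * gap \<gamma> y s \<partial>M)"
    unfolding mean_gap_def
  proof (rule integral_mono_AE)
    show "AE s in M. gap \<gamma> ((1 - t) *\<^sub>R x + t *\<^sub>R y) s \<le> (1 - t) * gap \<gamma> x s + t * gap \<gamma> y s"
      using good
    proof eventually_elim
      case (elim s)
      then show ?case
        using convex_onD[OF convex_on_moreau[OF f_G0], of s "d s" xs \<gamma> t x y]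
          convex_onD[OF convex_on_moreau[OF g_G0], of s "\<phi> s" xs \<gamma> t x y] assms t
        by (simp add: gap_def right_diff_distrib distrib_left left_diff_distrib)
    qed
  qed (use assms integrable_gap in auto)
  also have "\<dots> = (1 - t) * mean_gap \<gamma> x + t * mean_gap \<gamma> y"
    unfolding mean_gap_def using integrable_gap[OF assms] by simp
  finally show "mean_gap \<gamma> ((1 - t) *\<^sub>R x + t *\<^sub>R y) \<le> (1 - t) * mean_gap \<gamma> x + t * mean_gap \<gamma> y" .
qed simp

text \<open>The source of positivity off the minimizers. The excess \<open>a\<close> of the gap over
  its mean-zero linear part is shown to be nonpositive almost surely for all parameters of the
  sequence; this forces \<open>f\<close> and \<open>g\<close> to meet their affine minorants at
  \<open>x\<close>, and the linear terms cancel on integration.\<close>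

lemma gap_sum_eq_of_mean_gap:
  assumes le: "\<And>n. mean_gap (inverse (real (Suc n))) x \<le> 0"
  shows "ereal_integral M (\<lambda>s. f x s) + ereal_integral M (\<lambda>s. g x s)
    = ereal_integral M (\<lambda>s. f xs s) + ereal_integral M (\<lambda>s. g xs s)"
proof -
  define \<gamma> where "\<gamma> n = inverse (real (Suc n))" for n
  have \<gamma>: "\<gamma> n > 0" for n by (simp add: \<gamma>_def)
  define a where "a n s = gap (\<gamma> n) x s - (d s + \<phi> s) \<bullet> (x - xs)" for n s
  define e where "e s = ((norm (d s))\<^sup>2 + (norm (\<phi> s))\<^sup>2) / 2" for s
  have int_a: "integrable M (a n)" for n
    unfolding a_def using integrable_gap[OF \<gamma>] integrable_d integrable_\<phi> by auto
  have int_e: "integrable M e"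
    unfolding e_def using sq_d sq_\<phi> by auto
  have "AE s in M. a n s \<le> 0" for n
  proof -
    \<comment> \<open>For \<open>k \<ge> n\<close> the smaller parameter gives
      \<open>a n s \<le> a k s\<close>, and \<open>a k s + \<gamma> k * e s\<close> is nonnegative
      by \<open>gap_bounds\<close>. So the positive part of the fixed \<open>a n\<close> is
      dominated by functions whose integrals are at most a quantity tending to 0 with
      \<open>k\<close>.\<close>
    have bound: "(\<integral>s. max 0 (a n s) \<partial>M) \<le> \<gamma> k * (\<integral>s. e s \<partial>M)" if k: "n \<le> k" for k
    proof -
      have "\<gamma> k \<le> \<gamma> n" using k by (simp add: \<gamma>_def)
      have "(\<integral>s. max 0 (a n s) \<partial>M) \<le> (\<integral>s. a k s + \<gamma> k * e s \<partial>M)"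
      proof (rule integral_mono_AE)
        show "AE s in M. max 0 (a n s) \<le> a k s + \<gamma> k * e s"
          using gap_bounds[OF \<gamma>[of k], of x] gap_antimono[OF \<gamma> \<open>\<gamma> k \<le> \<gamma> n\<close>, of x]
        proof eventually_elim
          case (elim s)
          have "0 \<le> \<gamma> k * e s" using \<gamma>[of k] by (simp add: e_def)
          with elim show ?case by (simp add: a_def e_def)
        qed
      qed (use int_a int_e in auto)
      also have "\<dots> = mean_gap (\<gamma> k) x - (\<integral>s. (d s + \<phi> s) \<bullet> (x - xs) \<partial>M) + \<gamma> k * (\<integral>s. e s \<partial>M)"
        unfolding a_def mean_gap_def using integrable_gap[OF \<gamma>] integrable_d integrable_\<phi> int_e
        by simp
      also have "\<dots> \<le> \<gamma> k * (\<integral>s. e s \<partial>M)"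
        using le[of k] mean_linear_zero by (simp add: \<gamma>_def)
      finally show ?thesis .
    qed
    have "(\<lambda>k. \<gamma> k * (\<integral>s. e s \<partial>M)) \<longlonglongrightarrow> 0 * (\<integral>s. e s \<partial>M)"
      unfolding \<gamma>_def by (intro tendsto_intros LIMSEQ_inverse_real_of_nat)
    then have "(\<integral>s. max 0 (a n s) \<partial>M) \<le> 0 * (\<integral>s. e s \<partial>M)"
      by (rule tendsto_lowerbound) (use bound in \<open>auto intro: eventually_sequentiallyI[of n]\<close>)
    moreover have "0 \<le> (\<integral>s. max 0 (a n s) \<partial>M)" by (intro integral_nonneg_AE) auto
    ultimately have "(\<integral>s. max 0 (a n s) \<partial>M) = 0" by simp
    then have "AE s in M. max 0 (a n s) = 0"
      using int_a[of n] by (subst (asm) integral_nonneg_eq_0_iff_AE) auto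
    then show ?thesis by eventually_elim auto
  qed
  then have "AE s in M. \<forall>n. a n s \<le> 0" by (simp add: AE_all_countable)
  with good have eq: "AE s in M. f x s = ereal (real_of_ereal (f xs s) + d s \<bullet> (x - xs))
      \<and> g x s = ereal (real_of_ereal (g xs s) + \<phi> s \<bullet> (x - xs))"
  proof eventually_elim
    case (elim s)
    let ?f = "\<lambda>y. f y s" and ?g = "\<lambda>y. g y s"
    have h: "?f \<in> Gamma0" "d s \<in> subdiff ?f xs" "?g \<in> Gamma0" "\<phi> s \<in> subdiff ?g xs"
      using elim f_G0 g_G0 by auto
    have le: "real_of_ereal (moreau (inverse (real (Suc n))) ?f x) + real_of_ereal (moreau (inverse (real (Suc n))) ?g x)
        \<le> real_of_ereal (f xs s) + real_of_ereal (g xs s) + (d s + \<phi> s) \<bullet> (x - xs)" for n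
    proof -
      have "a n s \<le> 0" using elim by blast
      then show ?thesis unfolding a_def gap_def \<gamma>_def by linarith
    qed
    show ?case
    proof
      show "f x s = ereal (real_of_ereal (f xs s) + d s \<bullet> (x - xs))"
        by (rule moreau_sum_bound_imp_eq[OF h le])
      show "g x s = ereal (real_of_ereal (g xs s) + \<phi> s \<bullet> (x - xs))"
      proof (rule moreau_sum_bound_imp_eq[OF h(3,4,1,2)])
        show "real_of_ereal (moreau (inverse (real (Suc n))) ?g x) + real_of_ereal (moreau (inverse (real (Suc n))) ?f x)
          \<le> real_of_ereal (g xs s) + real_of_ereal (f xs s) + (\<phi> s + d s) \<bullet> (x - xs)" for n
          using le[of n] by (simp only: add.commute)
      qed
    qed
  qed
  have "ereal_integral M (\<lambda>s. f x s) = ereal (\<integral>s. real_of_ereal (f xs s) + d s \<bullet> (x - xs) \<partial>M)"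
    using eq integrable_f integrable_d by (intro ereal_integral_eq) (auto elim!: eventually_mono)
  moreover have "ereal_integral M (\<lambda>s. g x s) = ereal (\<integral>s. real_of_ereal (g xs s) + \<phi> s \<bullet> (x - xs) \<partial>M)"
    using eq integrable_g integrable_\<phi> by (intro ereal_integral_eq) (auto elim!: eventually_mono)
  moreover have "ereal_integral M (\<lambda>s. f xs s) = ereal (\<integral>s. real_of_ereal (f xs s) \<partial>M)"
    using integrable_f finite_at_xs(1) by (intro ereal_integral_eq) (auto elim!: eventually_mono simp: ereal_real)
  moreover have "ereal_integral M (\<lambda>s. g xs s) = ereal (\<integral>s. real_of_ereal (g xs s) \<partial>M)"
    using integrable_g finite_at_xs(2) by (intro ereal_integral_eq) (auto elim!: eventually_mono simp: ereal_real)
  moreover have "(\<integral>s. d s \<partial>M) \<bullet> (x - xs) + (\<integral>s. \<phi> s \<partial>M) \<bullet> (x - xs) = 0"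
    unfolding inner_add_left[symmetric] mean_zero by simp
  ultimately show ?thesis
    using integrable_f integrable_g integrable_d integrable_\<phi> by simp
qed

text \<open>The first claim allows the bound to be added to another term inside
  \<open>ennreal\<close>, which truncates negative numbers at 0.\<close>

lemma dr_step_mean_descent:
  assumes \<gamma>: "\<gamma> > 0" "\<gamma> \<le> 1 / (8 * L)"
  shows "0 \<le> (norm (x - xs))\<^sup>2 - 2 * \<gamma> * mean_gap (2 * \<gamma>) x + 4 * \<gamma>\<^sup>2 * (\<integral>s. (norm (d s))\<^sup>2 \<partial>M)"
    and "(\<integral>\<^sup>+ s. ennreal ((norm (dr_step \<gamma> x s - xs))\<^sup>2) \<partial>M)
      \<le> ennreal ((norm (x - xs))\<^sup>2 - 2 * \<gamma> * mean_gap (2 * \<gamma>) x + 4 * \<gamma>\<^sup>2 * (\<integral>s. (norm (d s))\<^sup>2 \<partial>M))"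
proof -
  define r where "r s = (norm (x - xs))\<^sup>2 - 2 * \<gamma> * gap (2 * \<gamma>) x s + 4 * \<gamma>\<^sup>2 * (norm (d s))\<^sup>2" for s
  have le: "AE s in M. (norm (dr_step \<gamma> x s - xs))\<^sup>2 \<le> r s"
    using good upper
  proof eventually_elim
    case (elim s)
    show ?case
      unfolding r_def gap_def dr_step_def Let_def
      using dr_step_descent[OF f_G0 g_G0, of s s "d s" xs "\<phi> s" L \<gamma> _ x] elim \<gamma> L by simp
  qed
  then have nonneg: "AE s in M. 0 \<le> r s"
    by eventually_elim (metis order_trans zero_le_power2)
  have int: "integrable M r"
    unfolding r_def using \<gamma> integrable_gap[of "2 * \<gamma>" x] sq_d by auto
  have eq: "(\<integral>s. r s \<partial>M)
      = (norm (x - xs))\<^sup>2 - 2 * \<gamma> * mean_gap (2 * \<gamma>) x + 4 * \<gamma>\<^sup>2 * (\<integral>s. (norm (d s))\<^sup>2 \<partial>M)"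
    unfolding r_def mean_gap_def using \<gamma> integrable_gap[of "2 * \<gamma>" x] sq_d by (simp add: prob_space)
  show "0 \<le> (norm (x - xs))\<^sup>2 - 2 * \<gamma> * mean_gap (2 * \<gamma>) x + 4 * \<gamma>\<^sup>2 * (\<integral>s. (norm (d s))\<^sup>2 \<partial>M)"
    unfolding eq[symmetric] using nonneg by (rule integral_nonneg_AE)
  have "(\<integral>\<^sup>+ s. ennreal ((norm (dr_step \<gamma> x s - xs))\<^sup>2) \<partial>M) \<le> (\<integral>\<^sup>+ s. ennreal (r s) \<partial>M)"
    using le by (intro nn_integral_mono_AE) (auto elim!: eventually_mono intro: ennreal_leI)
  also have "\<dots> = ennreal (\<integral>s. r s \<partial>M)"
    using int nonneg by (rule nn_integral_eq_integral)
  finally show "(\<integral>\<^sup>+ s. ennreal ((norm (dr_step \<gamma> x s - xs))\<^sup>2) \<partial>M)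
      \<le> ennreal ((norm (x - xs))\<^sup>2 - 2 * \<gamma> * mean_gap (2 * \<gamma>) x + 4 * \<gamma>\<^sup>2 * (\<integral>s. (norm (d s))\<^sup>2 \<partial>M))"
    by (simp only: eq)
qed

end

text \<open>A Dini argument on the compact set of points at distance \<open>\<epsilon>\<close> from \<open>S\<close>; convexity carries the
  bound outwards along the rays from \<open>x0\<close>.\<close>

lemma convex_family_growth:
  fixes \<psi> :: "nat \<Rightarrow> 'a::euclidean_space \<Rightarrow> real"
  assumes conv: "\<And>n. convex_on UNIV (\<psi> n)" and mono: "\<And>n x. \<psi> n x \<le> \<psi> (Suc n) x"
    and x0: "x0 \<in> S" "\<And>n. \<psi> n x0 \<le> 0" and S: "bounded S"
    and pos: "\<And>x. x \<notin> S \<Longrightarrow> \<exists>n. 0 < \<psi> n x" and \<epsilon>: "\<epsilon> > 0"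
  obtains N c where "c > 0" "\<And>x. \<epsilon> < infdist x S \<Longrightarrow> c * infdist x S \<le> \<psi> N x"
proof -
  have S0: "S \<noteq> {}" using x0 by auto
  obtain r where r: "r > 0" "closure S \<subseteq> cball x0 r"
  proof -
    obtain r where "\<forall>y\<in>closure S. dist x0 y \<le> r"
      using bounded_closure[OF S] unfolding bounded_any_center[of _ x0] by blast
    then show ?thesis by (intro that[of "max r 1"]) auto
  qed
  define K where "K = {x. infdist x S = \<epsilon>}"
  have K_le: "norm (w - x0) \<le> r + \<epsilon>" if "w \<in> K" for w
  proof -
    have "closest_point (closure S) w \<in> closure S"
      using S0 by (auto intro: closest_point_in_set)
    then have "dist x0 (closest_point (closure S) w) \<le> r" using r by auto
    moreover have "dist w (closest_point (closure S) w) = \<epsilon>"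
      using that infdist_closest_point[OF S0, of w] by (simp add: K_def)
    ultimately show ?thesis
      using dist_triangle2[of w x0 "closest_point (closure S) w"] by (simp add: dist_norm)
  qed
  have "closed K" unfolding K_def by (intro closed_Collect_eq continuous_intros)
  moreover have "bounded K"
    by (rule boundedI[of _ "r + \<epsilon> + norm x0"]) (use K_le norm_triangle_sub in \<open>smt (verit)\<close>)
  ultimately have "compact K" by (simp add: compact_eq_bounded_closed)
  have cont: "continuous_on UNIV (\<psi> n)" for n
    by (intro convex_on_continuous conv) auto
  have mono': "\<psi> m x \<le> \<psi> n x" if "m \<le> n" for m n x
    using lift_Suc_mono_le[of "\<lambda>n. \<psi> n x", OF mono that] .
  \<comment> \<open>The open sets where \<open>\<psi> n\<close> is positive increase with
    \<open>n\<close> and cover \<open>K\<close>, so compactness yields a single index.\<close>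
  obtain N where N: "\<And>w. w \<in> K \<Longrightarrow> 0 < \<psi> N w"
  proof -
    have "K \<subseteq> (\<Union>n\<in>UNIV. {x. 0 < \<psi> n x})"
      using pos \<epsilon> by (force simp: K_def)
    moreover have "open {x. 0 < \<psi> n x}" for n
      by (intro open_Collect_less cont continuous_intros)
    ultimately obtain C where C: "finite C" "K \<subseteq> (\<Union>n\<in>C. {x. 0 < \<psi> n x})"
      using \<open>compact K\<close> by (elim compactE_image[of K UNIV "\<lambda>n. {x. 0 < \<psi> n x}"]) auto
    show ?thesis
    proof (rule that[of "Max (insert 0 C)"])
      fix w assume "w \<in> K"
      with C obtain n where "n \<in> C" "0 < \<psi> n w" by auto
      with C mono'[of n "Max (insert 0 C)" w] show "0 < \<psi> (Max (insert 0 C)) w" by auto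
    qed
  qed
  obtain \<delta> where \<delta>: "\<delta> > 0" "\<And>w. w \<in> K \<Longrightarrow> \<delta> \<le> \<psi> N w"
  proof (cases "K = {}")
    case False
    then obtain w where "w \<in> K" "\<forall>v\<in>K. \<psi> N w \<le> \<psi> N v"
      using continuous_attains_inf[OF \<open>compact K\<close> False continuous_on_subset[OF cont]] by blast
    with N show ?thesis by (intro that[of "\<psi> N w"]) auto
  qed (use that[of 1] in auto)
  \<comment> \<open>The segment from \<open>x0\<close> to \<open>x\<close> meets \<open>K\<close> at
    some parameter \<open>t\<close>. As \<open>\<psi> N\<close> is at most 0 at \<open>x0\<close>,
    convexity gives \<open>\<delta> \<le> t * \<psi> N x\<close>; as \<open>K\<close> lies within
    \<open>r + \<epsilon>\<close> of \<open>x0\<close>, also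
    \<open>t * infdist x S \<le> r + \<epsilon>\<close>. Eliminating \<open>t\<close> gives this
    slope.\<close>
  have "\<delta> / (r + \<epsilon>) * infdist x S \<le> \<psi> N x" if x: "\<epsilon> < infdist x S" for x
  proof -
    let ?p = "\<lambda>t. (1 - t) *\<^sub>R x0 + t *\<^sub>R x"
    have "\<exists>t\<ge>0. t \<le> 1 \<and> infdist (?p t) S = \<epsilon>"
      using x x0 \<epsilon> by (intro IVT') (auto intro!: continuous_intros)
    then obtain t where t: "0 \<le> t" "t \<le> 1" "?p t \<in> K" by (auto simp: K_def)
    have "t \<noteq> 0" using t(3) x0 \<epsilon> by (auto simp: K_def)
    with t have t0: "t > 0" by simp
    have "\<delta> \<le> \<psi> N (?p t)" using t \<delta> by simp
    also have "\<dots> \<le> (1 - t) * \<psi> N x0 + t * \<psi> N x"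
      using convex_onD[OF conv, of t x0 x N] t by simp
    also have "\<dots> \<le> t * \<psi> N x"
      using t x0(2)[of N] by (simp add: mult_nonneg_nonpos)
    finally have 1: "\<delta> \<le> t * \<psi> N x" .
    have "?p t - x0 = t *\<^sub>R (x - x0)" by (simp add: algebra_simps)
    then have 2: "t * norm (x - x0) \<le> r + \<epsilon>"
      using K_le[OF t(3)] t0 by simp
    have "infdist x S \<le> norm (x - x0)" using infdist_le[OF x0(1), of x] by (simp add: dist_norm)
    then have "t * infdist x S \<le> r + \<epsilon>" using 2 t0 by (smt (verit) mult_left_mono)
    then have "\<delta> * (t * infdist x S) \<le> \<delta> * (r + \<epsilon>)" using \<delta> by (intro mult_left_mono) auto
    also have "\<dots> \<le> t * \<psi> N x * (r + \<epsilon>)" using 1 r \<epsilon> by (intro mult_right_mono) auto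
    finally have "t * (\<delta> * infdist x S) \<le> t * (\<psi> N x * (r + \<epsilon>))" by (simp add: mult_ac)
    then have "\<delta> * infdist x S \<le> \<psi> N x * (r + \<epsilon>)" using t0 by simp
    then show ?thesis using r \<epsilon> by (simp add: field_simps)
  qed
  then show ?thesis using \<delta> r \<epsilon> by (intro that[of "\<delta> / (r + \<epsilon>)" N]) auto
qed

section \<open>Law of the iterates\<close>

context stochastic_dr_finite
begin

text \<open>Growth is obtained at one parameter 1 / (N + 1) and passes to every smaller one by
  monotonicity. Within distance \<open>\<epsilon>\<close> of \<open>S\<close> the left side is 0,
  and the added multiple of \<open>\<gamma>\<close> makes the right side nonnegative.\<close>

lemma mean_gap_growth:
  assumes S: "xs \<in> S" "bounded S"
    and crit: "\<And>x. ereal_integral M (\<lambda>s. f x s) + ereal_integral M (\<lambda>s. g x s)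
        = ereal_integral M (\<lambda>s. f xs s) + ereal_integral M (\<lambda>s. g xs s) \<Longrightarrow> x \<in> S"
    and \<epsilon>: "\<epsilon> > 0"
  obtains c \<gamma>0 where "c > 0" "\<gamma>0 > 0"
    "\<And>\<gamma> x. 0 < \<gamma> \<Longrightarrow> \<gamma> \<le> \<gamma>0 \<Longrightarrow> c * max 0 (infdist x S - \<epsilon>)
      \<le> mean_gap \<gamma> x + \<gamma> / 2 * ((\<integral>s. (norm (d s))\<^sup>2 \<partial>M) + (\<integral>s. (norm (\<phi> s))\<^sup>2 \<partial>M))"
proof -
  let ?V = "(\<integral>s. (norm (d s))\<^sup>2 \<partial>M) + (\<integral>s. (norm (\<phi> s))\<^sup>2 \<partial>M)"
  define \<psi> where "\<psi> n = mean_gap (inverse (real (Suc n)))" for n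
  obtain N c where c: "c > 0" "\<And>x. \<epsilon> < infdist x S \<Longrightarrow> c * infdist x S \<le> \<psi> N x"
  proof (rule convex_family_growth[of \<psi> xs S \<epsilon>])
    show "\<psi> n x \<le> \<psi> (Suc n) x" for n x
      unfolding \<psi>_def by (intro mean_gap_antimono) auto
    show "\<exists>n. 0 < \<psi> n x" if "x \<notin> S" for x
      using gap_sum_eq_of_mean_gap[of x] crit[of x] that unfolding \<psi>_def by (meson not_le)
  qed (use S \<epsilon> in \<open>auto simp: \<psi>_def intro!: convex_on_mean_gap mean_gap_xs\<close>)
  show ?thesis
  proof (rule that[OF c(1), of "inverse (real (Suc N))"])
    fix \<gamma> x assume \<gamma>: "0 < \<gamma>" "\<gamma> \<le> inverse (real (Suc N))"
    have V: "0 \<le> \<gamma> / 2 * ?V" using \<gamma> by (intro mult_nonneg_nonneg add_nonneg_nonneg integral_nonneg_AE) auto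
    show "c * max 0 (infdist x S - \<epsilon>) \<le> mean_gap \<gamma> x + \<gamma> / 2 * ?V"
    proof (cases "\<epsilon> < infdist x S")
      case True
      have "c * max 0 (infdist x S - \<epsilon>) \<le> c * infdist x S"
        using c \<epsilon> True by (intro mult_left_mono) auto
      also have "\<dots> \<le> mean_gap \<gamma> x"
        using c(2)[OF True] mean_gap_antimono[OF \<gamma>, of x] by (simp add: \<psi>_def)
      finally show ?thesis using V by simp
    next
      case False
      then show ?thesis using mean_gap_ge[OF \<gamma>(1), of x] by simp
    qed
  qed auto
qed

lemma dr_step_drift:
  assumes S: "xs \<in> S" "bounded S"
    and crit: "\<And>x. ereal_integral M (\<lambda>s. f x s) + ereal_integral M (\<lambda>s. g x s)
        = ereal_integral M (\<lambda>s. f xs s) + ereal_integral M (\<lambda>s. g xs s) \<Longrightarrow> x \<in> S"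
    and \<epsilon>: "\<epsilon> > 0"
  obtains c C \<gamma>0 where "c > 0" "C \<ge> 0" "\<gamma>0 > 0"
    "\<And>\<gamma> x. 0 < \<gamma> \<Longrightarrow> \<gamma> \<le> \<gamma>0 \<Longrightarrow>
      (\<integral>\<^sup>+ s. ennreal ((norm (dr_step \<gamma> x s - xs))\<^sup>2) \<partial>M) + ennreal (\<gamma> * c * max 0 (infdist x S - \<epsilon>))
        \<le> ennreal ((norm (x - xs))\<^sup>2 + C * \<gamma>\<^sup>2)"
proof -
  let ?D = "\<integral>s. (norm (d s))\<^sup>2 \<partial>M"
  let ?V = "?D + (\<integral>s. (norm (\<phi> s))\<^sup>2 \<partial>M)"
  have nn: "0 \<le> ?D" "0 \<le> ?V" by (auto intro!: add_nonneg_nonneg integral_nonneg_AE)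
  obtain c \<gamma>0 where c: "c > 0" "\<gamma>0 > 0"
    and gr: "\<And>\<gamma> x. 0 < \<gamma> \<Longrightarrow> \<gamma> \<le> \<gamma>0 \<Longrightarrow> c * max 0 (infdist x S - \<epsilon>) \<le> mean_gap \<gamma> x + \<gamma> / 2 * ?V"
    using mean_gap_growth[OF S crit \<epsilon>] by blast
  show ?thesis
  \<comment> \<open>The descent involves the mean gap at \<open>2 * \<gamma>\<close>, so growth is
    applied there. This asks for \<open>\<gamma> \<le> \<gamma>0 / 2\<close>, and the correction
    \<open>\<gamma> * ?V\<close>, multiplied by \<open>2 * \<gamma>\<close>, adds
    \<open>2 * ?V\<close> to the \<open>4 * ?D\<close> of the descent.\<close>
  proof (rule that[of "2 * c" "4 * ?D + 2 * ?V" "min (\<gamma>0 / 2) (1 / (8 * L))"])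
    fix \<gamma> x assume \<gamma>: "0 < \<gamma>" "\<gamma> \<le> min (\<gamma>0 / 2) (1 / (8 * L))"
    let ?q = "max 0 (infdist x S - \<epsilon>)"
    let ?b = "(norm (x - xs))\<^sup>2 - 2 * \<gamma> * mean_gap (2 * \<gamma>) x + 4 * \<gamma>\<^sup>2 * ?D"
    have b: "0 \<le> ?b" "(\<integral>\<^sup>+ s. ennreal ((norm (dr_step \<gamma> x s - xs))\<^sup>2) \<partial>M) \<le> ennreal ?b"
      using dr_step_mean_descent[of \<gamma> x] \<gamma> by auto
    have "(\<integral>\<^sup>+ s. ennreal ((norm (dr_step \<gamma> x s - xs))\<^sup>2) \<partial>M) + ennreal (\<gamma> * (2 * c) * ?q)
        \<le> ennreal ?b + ennreal (\<gamma> * (2 * c) * ?q)"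
      by (intro add_right_mono b)
    also have "\<dots> = ennreal (?b + \<gamma> * (2 * c) * ?q)"
      using b(1) c \<gamma> by (intro ennreal_plus[symmetric] mult_nonneg_nonneg) auto
    also have "\<dots> \<le> ennreal ((norm (x - xs))\<^sup>2 + (4 * ?D + 2 * ?V) * \<gamma>\<^sup>2)"
    proof (rule ennreal_leI)
      have "2 * \<gamma> * (c * ?q) \<le> 2 * \<gamma> * (mean_gap (2 * \<gamma>) x + 2 * \<gamma> / 2 * ?V)"
        using gr[of "2 * \<gamma>" x] \<gamma> by (intro mult_left_mono) auto
      then show "?b + \<gamma> * (2 * c) * ?q \<le> (norm (x - xs))\<^sup>2 + (4 * ?D + 2 * ?V) * \<gamma>\<^sup>2"
        by (simp add: power2_eq_square algebra_simps)
    qed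
    finally show "(\<integral>\<^sup>+ s. ennreal ((norm (dr_step \<gamma> x s - xs))\<^sup>2) \<partial>M) + ennreal (\<gamma> * (2 * c) * ?q)
        \<le> ennreal ((norm (x - xs))\<^sup>2 + (4 * ?D + 2 * ?V) * \<gamma>\<^sup>2)" .
  qed (use c L nn in auto)
qed

end

section \<open>Joint law of start and noise, and the one-step Markov property\<close>

lemma dr_iter_cong:
  "(\<And>i. i \<in> {1..n} \<Longrightarrow> u i = u' i) \<Longrightarrow> dr_iter \<gamma> f g x u n = dr_iter \<gamma> f g x u' n"
  by (induction n) (auto simp: Let_def)

text \<open>Agreement on measurable rectangles suffices. Independence of \<open>X0\<close> from the
  noise splits their probability, and the i.i.d. assumption gives the law of the first
  \<open>n\<close> noises; \<open>n \<ge> 1\<close> keeps the index set nonempty, as the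
  characterization of independence by product laws requires.\<close>

lemma joint_law:
  assumes M: "prob_space M" and P: "prob_space P" and iid: "iid_copies P M \<xi>"
    and init: "initial_rv P M \<xi> \<nu> X0" and n: "n \<ge> 1"
  shows "distr P (\<nu> \<Otimes>\<^sub>M PiM {1..n} (\<lambda>_. M)) (\<lambda>\<omega>. (X0 \<omega>, \<lambda>i\<in>{1..n}. \<xi> i \<omega>)) = \<nu> \<Otimes>\<^sub>M PiM {1..n} (\<lambda>_. M)"
proof -
  interpret M: prob_space M by fact
  interpret P: prob_space P by fact
  have X0 [measurable]: "X0 \<in> borel_measurable P" and \<nu>: "\<nu> = distr P borel X0"
    and ind: "P.indep_set (sets (vimage_algebra (space P) X0 borel))
       (sets (vimage_algebra (space P) (\<lambda>\<omega>. \<lambda>n\<in>{1..}. \<xi> n \<omega>) (PiM {1..} (\<lambda>_. M))))"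
    using init unfolding initial_rv_def by auto
  interpret \<nu>: prob_space \<nu> unfolding \<nu> by (rule P.prob_space_distr) simp
  have sets_\<nu> [measurable_cong]: "sets \<nu> = sets borel" by (simp add: \<nu>)
  have iv: "P.indep_vars (\<lambda>_. M) \<xi> {1..}" and law: "\<And>n. n \<ge> 1 \<Longrightarrow> distr P M (\<xi> n) = M"
    using iid unfolding iid_copies_def by auto
  have \<xi> [measurable]: "\<xi> i \<in> P \<rightarrow>\<^sub>M M" if "i \<ge> 1" for i
    using iv that unfolding P.indep_vars_def by auto
  have \<Xi>: "(\<lambda>\<omega>. \<lambda>i\<in>{1..}. \<xi> i \<omega>) \<in> P \<rightarrow>\<^sub>M PiM {1..} (\<lambda>_. M)"
    by (intro measurable_restrict) auto
  have \<Xi>n [measurable]: "(\<lambda>\<omega>. \<lambda>i\<in>{1..n}. \<xi> i \<omega>) \<in> P \<rightarrow>\<^sub>M PiM {1..n} (\<lambda>_. M)"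
    by (intro measurable_restrict) auto
  have "P.indep_vars (\<lambda>_. M) \<xi> {1..n}"
    using iv by (rule P.indep_vars_subset) auto
  then have "distr P (PiM {1..n} (\<lambda>_. M)) (\<lambda>\<omega>. \<lambda>i\<in>{1..n}. \<xi> i \<omega>) = PiM {1..n} (\<lambda>i. distr P M (\<xi> i))"
    using n by (subst (asm) P.indep_vars_iff_distr_eq_PiM') auto
  also have "\<dots> = PiM {1..n} (\<lambda>_. M)"
    by (intro PiM_cong) (auto simp: law)
  finally have law_n: "distr P (PiM {1..n} (\<lambda>_. M)) (\<lambda>\<omega>. \<lambda>i\<in>{1..n}. \<xi> i \<omega>) = PiM {1..n} (\<lambda>_. M)" .
  interpret Pn: prob_space "PiM {1..n} (\<lambda>_. M)" by (intro prob_space_PiM M)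
  show ?thesis
  proof (rule pair_measure_eqI[symmetric])
    fix A B assume A: "A \<in> sets \<nu>" and B: "B \<in> sets (PiM {1..n} (\<lambda>_. M))"
    define A' where "A' = X0 -` A \<inter> space P"
    define B' where "B' = (\<lambda>\<omega>. \<lambda>i\<in>{1..n}. \<xi> i \<omega>) -` B \<inter> space P"
    have A': "A' \<in> sets (vimage_algebra (space P) X0 borel)"
      unfolding A'_def using A by (intro in_vimage_algebra) (simp add: sets_\<nu>)
    \<comment> \<open>An event about the first \<open>n\<close> noises is, through the restriction
      map, an event about the whole sequence, which is what the independence assumption speaks
      of.\<close>
    have "(\<lambda>u. restrict u {1..n}) -` B \<inter> space (PiM {1..} (\<lambda>_. M)) \<in> sets (PiM {1..} (\<lambda>_. M))"
      using B by (intro measurable_sets[OF measurable_restrict_subset]) auto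
    then have "(\<lambda>\<omega>. \<lambda>n\<in>{1..}. \<xi> n \<omega>) -` ((\<lambda>u. restrict u {1..n}) -` B \<inter> space (PiM {1..} (\<lambda>_. M))) \<inter> space P
        \<in> sets (vimage_algebra (space P) (\<lambda>\<omega>. \<lambda>n\<in>{1..}. \<xi> n \<omega>) (PiM {1..} (\<lambda>_. M)))"
      by (rule in_vimage_algebra)
    also have "(\<lambda>\<omega>. \<lambda>n\<in>{1..}. \<xi> n \<omega>) -` ((\<lambda>u. restrict u {1..n}) -` B \<inter> space (PiM {1..} (\<lambda>_. M))) \<inter> space P = B'"
    proof -
      have "restrict (\<lambda>n\<in>{1..}. \<xi> n \<omega>) {1..n} = (\<lambda>i\<in>{1..n}. \<xi> i \<omega>)" for \<omega> by auto
      then show ?thesis using measurable_space[OF \<Xi>] unfolding B'_def by auto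
    qed
    finally have B': "B' \<in> sets (vimage_algebra (space P) (\<lambda>\<omega>. \<lambda>n\<in>{1..}. \<xi> n \<omega>) (PiM {1..} (\<lambda>_. M)))" .
    have "P.prob (A' \<inter> B') = P.prob A' * P.prob B'"
      by (rule P.indep_setD[OF ind A' B'])
    then have "emeasure P (A' \<inter> B') = emeasure P A' * emeasure P B'"
      by (simp add: P.emeasure_eq_measure ennreal_mult)
    also have "emeasure P A' = emeasure \<nu> A"
      unfolding A'_def \<nu> using A by (subst emeasure_distr) (auto simp: sets_\<nu>)
    also have "emeasure P B' = emeasure (PiM {1..n} (\<lambda>_. M)) B"
      unfolding B'_def using B by (subst law_n[symmetric], subst emeasure_distr) auto
    also have "A' \<inter> B' = (\<lambda>\<omega>. (X0 \<omega>, \<lambda>i\<in>{1..n}. \<xi> i \<omega>)) -` (A \<times> B) \<inter> space P"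
      unfolding A'_def B'_def by auto
    finally show "emeasure \<nu> A * emeasure (PiM {1..n} (\<lambda>_. M)) B
       = emeasure (distr P (\<nu> \<Otimes>\<^sub>M PiM {1..n} (\<lambda>_. M)) (\<lambda>\<omega>. (X0 \<omega>, \<lambda>i\<in>{1..n}. \<xi> i \<omega>))) (A \<times> B)"
      using A B by (subst emeasure_distr) auto
  qed (rule \<nu>.sigma_finite_measure_axioms Pn.sigma_finite_measure_axioms | simp)+
qed

locale dr_process = stochastic_dr M f g xs d \<phi> L
  for M :: "'s measure" and f g :: "'a::euclidean_space \<Rightarrow> 's \<Rightarrow> ereal" and xs d \<phi> L +
  fixes P :: "'w measure" and \<xi> :: "nat \<Rightarrow> 'w \<Rightarrow> 's" and \<nu> :: "'a measure" and X0 :: "'w \<Rightarrow> 'a"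
  assumes P: "prob_space P" and iid: "iid_copies P M \<xi>" and init: "initial_rv P M \<xi> \<nu> X0"
    and second_moment: "integrable \<nu> (\<lambda>x. (norm x)\<^sup>2)"
begin

sublocale P: prob_space P by (rule P)

definition X :: "real \<Rightarrow> nat \<Rightarrow> 'w \<Rightarrow> 'a" where
  "X \<gamma> n \<omega> = dr_iter \<gamma> f g (X0 \<omega>) (\<lambda>k. \<xi> k \<omega>) n"

lemma X_0: "X \<gamma> 0 \<omega> = X0 \<omega>"
  by (simp add: X_def)

lemma X_Suc: "X \<gamma> (Suc n) \<omega> = dr_step \<gamma> (X \<gamma> n \<omega>) (\<xi> (Suc n) \<omega>)"
  by (simp add: X_def dr_step_def Let_def)

lemma measurable_X0 [measurable]: "X0 \<in> borel_measurable P"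
  using init unfolding initial_rv_def by auto

lemma measurable_\<xi> [measurable]: "\<xi> (Suc n) \<in> P \<rightarrow>\<^sub>M M"
  using iid unfolding iid_copies_def P.indep_vars_def by auto

text \<open>The number \<open>N\<close> of noises is kept apart from the time \<open>n\<close>, so
  that the induction stays in one product space.\<close>

lemma measurable_dr_iter:
  assumes "\<gamma> > 0" "n \<le> N"
  shows "(\<lambda>p. dr_iter \<gamma> f g (fst p) (snd p) n) \<in> borel_measurable (borel \<Otimes>\<^sub>M PiM {1..N} (\<lambda>_. M))"
  using \<open>n \<le> N\<close>
proof (induction n)
  case (Suc n)
  then have [measurable]: "(\<lambda>p. dr_iter \<gamma> f g (fst p) (snd p) n)
      \<in> borel_measurable (borel \<Otimes>\<^sub>M PiM {1..N} (\<lambda>_. M))" by simp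
  have [measurable]: "(\<lambda>p. snd p (Suc n)) \<in> borel \<Otimes>\<^sub>M PiM {1..N} (\<lambda>_. M) \<rightarrow>\<^sub>M M"
    using Suc.prems by (intro measurable_compose[OF measurable_snd measurable_component_singleton]) auto
  have "(\<lambda>p. (dr_iter \<gamma> f g (fst p) (snd p) n, snd p (Suc n)))
      \<in> borel \<Otimes>\<^sub>M PiM {1..N} (\<lambda>_. M) \<rightarrow>\<^sub>M borel \<Otimes>\<^sub>M M"
    by measurable
  from measurable_compose[OF this measurable_dr_step[OF \<open>\<gamma> > 0\<close>]] show ?case
    by (simp add: dr_step_def Let_def)
qed simp

lemma measurable_X [measurable]: "\<gamma> > 0 \<Longrightarrow> X \<gamma> n \<in> borel_measurable P"
proof (induction n)
  case 0
  then show ?case by (simp add: X_0[abs_def])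
next
  case (Suc n)
  then have "(\<lambda>\<omega>. (X \<gamma> n \<omega>, \<xi> (Suc n) \<omega>)) \<in> P \<rightarrow>\<^sub>M borel \<Otimes>\<^sub>M M" by measurable
  from measurable_compose[OF this measurable_dr_step[OF Suc.prems]] show ?case
    by (simp add: X_Suc[abs_def])
qed

text \<open>Markov property without conditional expectations: the iterate at time \<open>n\<close>
  reads only the start and the noises 1 to \<open>n\<close>, so under the joint law the next noise
  is a separate coordinate, which Fubini integrates out.\<close>

lemma nn_integral_X_step:
  assumes \<gamma>: "\<gamma> > 0" and h [measurable]: "h \<in> borel_measurable (borel \<Otimes>\<^sub>M M)"
  shows "(\<integral>\<^sup>+ \<omega>. h (X \<gamma> n \<omega>, \<xi> (Suc n) \<omega>) \<partial>P) = (\<integral>\<^sup>+ \<omega>. (\<integral>\<^sup>+ s. h (X \<gamma> n \<omega>, s) \<partial>M) \<partial>P)"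
proof -
  let ?I = "{1..Suc n}"
  have sets_\<nu> [measurable_cong]: "sets \<nu> = sets borel"
    using init unfolding initial_rv_def by auto
  interpret Pi: product_prob_space "\<lambda>_::nat. M" "{1..n}" by standard
  interpret PiS: prob_space "PiM ?I (\<lambda>_. M)" by (intro prob_space_PiM prob_space_axioms)
  have \<Xi> [measurable]: "(\<lambda>\<omega>. \<lambda>i\<in>?I. \<xi> i \<omega>) \<in> P \<rightarrow>\<^sub>M PiM ?I (\<lambda>_. M)"
    using iid unfolding iid_copies_def P.indep_vars_def by (intro measurable_restrict) auto
  have key: "(\<integral>\<^sup>+ \<omega>. H (X0 \<omega>, \<lambda>i\<in>?I. \<xi> i \<omega>) \<partial>P)
      = (\<integral>\<^sup>+ x. (\<integral>\<^sup>+ u. (\<integral>\<^sup>+ s. H (x, u(Suc n := s)) \<partial>M) \<partial>PiM {1..n} (\<lambda>_. M)) \<partial>\<nu>)"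
    if H [measurable]: "H \<in> borel_measurable (\<nu> \<Otimes>\<^sub>M PiM ?I (\<lambda>_. M))" for H :: "_ \<Rightarrow> ennreal"
  proof -
    have "(\<integral>\<^sup>+ \<omega>. H (X0 \<omega>, \<lambda>i\<in>?I. \<xi> i \<omega>) \<partial>P)
        = (\<integral>\<^sup>+ p. H p \<partial>distr P (\<nu> \<Otimes>\<^sub>M PiM ?I (\<lambda>_. M)) (\<lambda>\<omega>. (X0 \<omega>, \<lambda>i\<in>?I. \<xi> i \<omega>)))"
      by (rule nn_integral_distr[symmetric]) measurable
    also have "\<dots> = (\<integral>\<^sup>+ p. H p \<partial>(\<nu> \<Otimes>\<^sub>M PiM ?I (\<lambda>_. M)))"
      by (subst joint_law[OF prob_space_axioms P iid init]) auto
    also have "\<dots> = (\<integral>\<^sup>+ x. (\<integral>\<^sup>+ u. H (x, u) \<partial>PiM ?I (\<lambda>_. M)) \<partial>\<nu>)"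
      by (rule PiS.nn_integral_fst[OF H, symmetric])
    also have "\<dots> = (\<integral>\<^sup>+ x. (\<integral>\<^sup>+ u. (\<integral>\<^sup>+ s. H (x, u(Suc n := s)) \<partial>M) \<partial>PiM {1..n} (\<lambda>_. M)) \<partial>\<nu>)"
    proof (rule nn_integral_cong)
      fix x assume x: "x \<in> space \<nu>"
      have I: "?I = insert (Suc n) {1..n}" by auto
      have "(\<lambda>u. H (x, u)) \<in> borel_measurable (PiM ?I (\<lambda>_. M))"
        using x by measurable
      then show "(\<integral>\<^sup>+ u. H (x, u) \<partial>PiM ?I (\<lambda>_. M))
          = (\<integral>\<^sup>+ u. (\<integral>\<^sup>+ s. H (x, u(Suc n := s)) \<partial>M) \<partial>PiM {1..n} (\<lambda>_. M))"
        unfolding I by (intro Pi.product_nn_integral_insert) auto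
    qed
    finally show ?thesis .
  qed
  have it [measurable]: "(\<lambda>p. dr_iter \<gamma> f g (fst p) (snd p) n) \<in> borel_measurable (borel \<Otimes>\<^sub>M PiM ?I (\<lambda>_. M))"
    by (rule measurable_dr_iter[OF \<gamma>]) simp
  have [measurable]: "(\<lambda>p. snd p (Suc n)) \<in> borel \<Otimes>\<^sub>M PiM ?I (\<lambda>_. M) \<rightarrow>\<^sub>M M"
    by (intro measurable_compose[OF measurable_snd measurable_component_singleton]) auto
  define H1 where "H1 p = h (dr_iter \<gamma> f g (fst p) (snd p) n, snd p (Suc n))" for p
  define H2 where "H2 p = (\<integral>\<^sup>+ s. h (dr_iter \<gamma> f g (fst p) (snd p) n, s) \<partial>M)" for p
  have X_eq: "X \<gamma> n \<omega> = dr_iter \<gamma> f g (X0 \<omega>) (\<lambda>i\<in>?I. \<xi> i \<omega>) n" for \<omega>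
    unfolding X_def by (rule dr_iter_cong) auto
  have upd: "dr_iter \<gamma> f g x (u(Suc n := s)) n = dr_iter \<gamma> f g x u n" for x u s
    by (rule dr_iter_cong) auto
  have H: "H1 \<in> borel_measurable (\<nu> \<Otimes>\<^sub>M PiM ?I (\<lambda>_. M))" "H2 \<in> borel_measurable (\<nu> \<Otimes>\<^sub>M PiM ?I (\<lambda>_. M))"
    unfolding H1_def H2_def by measurable
  have "(\<integral>\<^sup>+ \<omega>. h (X \<gamma> n \<omega>, \<xi> (Suc n) \<omega>) \<partial>P) = (\<integral>\<^sup>+ \<omega>. H1 (X0 \<omega>, \<lambda>i\<in>?I. \<xi> i \<omega>) \<partial>P)"
    by (simp add: H1_def X_eq)
  \<comment> \<open>Both sides reduce to the same iterated integral: overwriting coordinate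
    \<open>Suc n\<close> leaves the iterate unchanged, and \<open>H2\<close> does not depend on that
    coordinate, whose law has mass 1.\<close>
  also have "\<dots> = (\<integral>\<^sup>+ \<omega>. H2 (X0 \<omega>, \<lambda>i\<in>?I. \<xi> i \<omega>) \<partial>P)"
    unfolding key[OF H(1)] key[OF H(2)]
    by (simp add: H1_def H2_def upd emeasure_space_1)
  also have "\<dots> = (\<integral>\<^sup>+ \<omega>. (\<integral>\<^sup>+ s. h (X \<gamma> n \<omega>, s) \<partial>M) \<partial>P)"
    by (simp add: H2_def X_eq)
  finally show ?thesis .
qed

end

section \<open>Ergodic limits\<close>

context dr_process
begin

definition V :: "real \<Rightarrow> nat \<Rightarrow> real" where
  "V \<gamma> n = (\<integral>\<omega>. (norm (X \<gamma> n \<omega> - xs))\<^sup>2 \<partial>P)"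

lemma nn_integral_X_Suc:
  assumes "\<gamma> > 0"
  shows "(\<integral>\<^sup>+ \<omega>. ennreal ((norm (X \<gamma> (Suc n) \<omega> - xs))\<^sup>2) \<partial>P)
    = (\<integral>\<^sup>+ \<omega>. (\<integral>\<^sup>+ s. ennreal ((norm (dr_step \<gamma> (X \<gamma> n \<omega>) s - xs))\<^sup>2) \<partial>M) \<partial>P)"
proof -
  have [measurable]: "(\<lambda>p. dr_step \<gamma> (fst p) (snd p)) \<in> borel_measurable (borel \<Otimes>\<^sub>M M)"
    using measurable_dr_step[OF assms] by (simp add: split_beta')
  have "(\<lambda>p. ennreal ((norm (dr_step \<gamma> (fst p) (snd p) - xs))\<^sup>2)) \<in> borel_measurable (borel \<Otimes>\<^sub>M M)"
    by measurable
  from nn_integral_X_step[OF assms this, of n] show ?thesis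
    by (simp add: X_Suc)
qed

text \<open>Induction from the second moment of \<open>\<nu>\<close>: one step multiplies the second
  moment about \<open>xs\<close> by at most 75 and adds a constant.\<close>

lemma integrable_sq_X:
  assumes "\<gamma> > 0"
  shows "integrable P (\<lambda>\<omega>. (norm (X \<gamma> n \<omega> - xs))\<^sup>2)"
proof (induction n)
  case 0
  have \<nu>: "\<nu> = distr P borel X0"
    using init unfolding initial_rv_def by simp
  have "integrable P (\<lambda>\<omega>. (norm (X0 \<omega>))\<^sup>2)"
    using second_moment unfolding \<nu> by (subst (asm) integrable_distr_eq) auto
  then have "integrable P (\<lambda>\<omega>. 2 * (norm (X0 \<omega>))\<^sup>2 + 2 * (norm xs)\<^sup>2)" by simp
  then show ?case
  proof (rule Bochner_Integration.integrable_bound)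
    have "(norm (x - xs))\<^sup>2 \<le> 2 * (norm x)\<^sup>2 + 2 * (norm xs)\<^sup>2" for x
    proof -
      have "0 \<le> (norm (x + xs))\<^sup>2" by simp
      then show ?thesis
        unfolding power2_norm_eq_inner
        by (simp add: inner_add_left inner_add_right inner_diff_left inner_diff_right inner_commute)
    qed
    then show "AE \<omega> in P. norm ((norm (X \<gamma> 0 \<omega> - xs))\<^sup>2) \<le> norm (2 * (norm (X0 \<omega>))\<^sup>2 + 2 * (norm xs)\<^sup>2)"
      by (simp add: X_0)
  qed (use assms in measurable)
next
  case (Suc n)
  define b where "b = 27 * \<gamma>\<^sup>2 * (\<integral>s. (norm (d s))\<^sup>2 \<partial>M) + 3 * \<gamma>\<^sup>2 * (\<integral>s. (norm (\<phi> s))\<^sup>2 \<partial>M)"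
  have "(\<integral>\<^sup>+ \<omega>. ennreal ((norm (X \<gamma> (Suc n) \<omega> - xs))\<^sup>2) \<partial>P)
      \<le> (\<integral>\<^sup>+ \<omega>. ennreal (75 * (norm (X \<gamma> n \<omega> - xs))\<^sup>2 + b) \<partial>P)"
    unfolding nn_integral_X_Suc[OF assms] b_def using dr_step_bound[OF assms]
    by (intro nn_integral_mono) (simp add: add.assoc)
  also have "\<dots> < \<infinity>"
    using Suc by (subst nn_integral_eq_integral) (auto simp: b_def intro!: add_nonneg_nonneg)
  finally show ?case
    using assms by (intro integrableI_bounded) auto
qed

lemma integrable_X:
  assumes "\<gamma> > 0"
  shows "integrable P (X \<gamma> n)"
proof -
  have "integrable P (\<lambda>\<omega>. norm (X \<gamma> n \<omega> - xs))"
    by (rule P.square_integrable_imp_integrable) (use assms integrable_sq_X in auto)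
  then have "integrable P (\<lambda>\<omega>. X \<gamma> n \<omega> - xs)"
    using assms by (simp add: integrable_norm_iff)
  from Bochner_Integration.integrable_add[OF this, of "\<lambda>_. xs"] show ?thesis by simp
qed

text \<open>Take expectations along the iterates and telescope; the last \<open>V\<close> term is
  nonnegative and dropped. Integrability of \<open>q\<close> along the iterates comes from the
  finite right-hand side of each step.\<close>

lemma drift_sum:
  assumes \<gamma>: "\<gamma> > 0" and c: "c > 0" and q [measurable]: "q \<in> borel_measurable borel" "\<And>x. 0 \<le> q x" and b: "b \<ge> 0"
    and drift: "\<And>x. (\<integral>\<^sup>+ s. ennreal ((norm (dr_step \<gamma> x s - xs))\<^sup>2) \<partial>M) + ennreal (c * q x)
        \<le> ennreal ((norm (x - xs))\<^sup>2 + b)"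
  shows "c * (\<Sum>k=0..n. \<integral>\<omega>. q (X \<gamma> k \<omega>) \<partial>P) \<le> V \<gamma> 0 + real (n + 1) * b"
proof -
  have V: "(\<integral>\<^sup>+ \<omega>. ennreal ((norm (X \<gamma> n \<omega> - xs))\<^sup>2) \<partial>P) = ennreal (V \<gamma> n)" for n
    unfolding V_def using integrable_sq_X[OF \<gamma>] by (intro nn_integral_eq_integral) auto
  have V_nonneg: "0 \<le> V \<gamma> n" for n
    unfolding V_def by (intro integral_nonneg_AE) auto
  have step: "V \<gamma> (Suc n) + c * (\<integral>\<omega>. q (X \<gamma> n \<omega>) \<partial>P) \<le> V \<gamma> n + b" for n
  proof -
    have [measurable]: "(\<lambda>p. dr_step \<gamma> (fst p) (snd p)) \<in> borel_measurable (borel \<Otimes>\<^sub>M M)"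
      using measurable_dr_step[OF \<gamma>] by (simp add: split_beta')
    have "(\<lambda>x. \<integral>\<^sup>+ s. ennreal ((norm (dr_step \<gamma> (fst (x, s)) (snd (x, s)) - xs))\<^sup>2) \<partial>M) \<in> borel_measurable borel"
      by (rule borel_measurable_nn_integral_fst) measurable
    then have [measurable]: "(\<lambda>x. \<integral>\<^sup>+ s. ennreal ((norm (dr_step \<gamma> x s - xs))\<^sup>2) \<partial>M) \<in> borel_measurable borel"
      by simp
    have "ennreal (V \<gamma> (Suc n)) + (\<integral>\<^sup>+ \<omega>. ennreal (c * q (X \<gamma> n \<omega>)) \<partial>P)
      = (\<integral>\<^sup>+ \<omega>. (\<integral>\<^sup>+ s. ennreal ((norm (dr_step \<gamma> (X \<gamma> n \<omega>) s - xs))\<^sup>2) \<partial>M) + ennreal (c * q (X \<gamma> n \<omega>)) \<partial>P)"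
      unfolding V[symmetric] nn_integral_X_Suc[OF \<gamma>]
      using \<gamma> by (subst nn_integral_add) auto
    also have "\<dots> \<le> (\<integral>\<^sup>+ \<omega>. ennreal ((norm (X \<gamma> n \<omega> - xs))\<^sup>2 + b) \<partial>P)"
      by (intro nn_integral_mono drift)
    also have "\<dots> = ennreal (V \<gamma> n + b)"
      unfolding V_def using integrable_sq_X[OF \<gamma>] b by (subst nn_integral_eq_integral) (auto simp: P.prob_space)
    finally have le: "ennreal (V \<gamma> (Suc n)) + (\<integral>\<^sup>+ \<omega>. ennreal (c * q (X \<gamma> n \<omega>)) \<partial>P) \<le> ennreal (V \<gamma> n + b)" .
    have "(\<integral>\<^sup>+ \<omega>. ennreal (c * q (X \<gamma> n \<omega>)) \<partial>P)
        \<le> ennreal (V \<gamma> (Suc n)) + (\<integral>\<^sup>+ \<omega>. ennreal (c * q (X \<gamma> n \<omega>)) \<partial>P)" by simp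
    also note le
    also have "ennreal (V \<gamma> n + b) < \<infinity>" by simp
    finally have "(\<integral>\<^sup>+ \<omega>. ennreal (c * q (X \<gamma> n \<omega>)) \<partial>P) < \<infinity>" .
    then have int: "integrable P (\<lambda>\<omega>. c * q (X \<gamma> n \<omega>))"
      using \<gamma> c q(2) by (intro integrableI_bounded) auto
    have "(\<integral>\<^sup>+ \<omega>. ennreal (c * q (X \<gamma> n \<omega>)) \<partial>P) = ennreal (\<integral>\<omega>. c * q (X \<gamma> n \<omega>) \<partial>P)"
      using int c q(2) by (intro nn_integral_eq_integral) auto
    also have "(\<integral>\<omega>. c * q (X \<gamma> n \<omega>) \<partial>P) = c * (\<integral>\<omega>. q (X \<gamma> n \<omega>) \<partial>P)" by simp
    finally have eq: "(\<integral>\<^sup>+ \<omega>. ennreal (c * q (X \<gamma> n \<omega>)) \<partial>P) = ennreal (c * (\<integral>\<omega>. q (X \<gamma> n \<omega>) \<partial>P))" .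
    have nn: "0 \<le> c * (\<integral>\<omega>. q (X \<gamma> n \<omega>) \<partial>P)" using c q(2) by (intro mult_nonneg_nonneg integral_nonneg_AE) auto
    show ?thesis
      using le V_nonneg[of n] V_nonneg[of "Suc n"] nn b unfolding eq
      by (simp add: ennreal_plus[symmetric] del: ennreal_plus)
  qed
  have "c * (\<Sum>k=0..n. \<integral>\<omega>. q (X \<gamma> k \<omega>) \<partial>P) + V \<gamma> (Suc n) \<le> V \<gamma> 0 + real (n + 1) * b"
  proof (induction n)
    case 0
    then show ?case using step[of 0] by simp
  next
    case (Suc n)
    then show ?case using step[of "Suc n"] by (simp add: distrib_left distrib_right)
  qed
  with V_nonneg[of "Suc n"] show ?thesis by linarith
qed

end

text \<open>The form of the bound reflects the order of limits: the \<open>A\<close> term vanishes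
  as \<open>n\<close> grows with \<open>\<gamma>\<close> fixed, the \<open>B\<close> term as
  \<open>\<gamma>\<close> tends to 0, and \<open>\<eta>\<close> is arbitrary. Starting at
  \<open>n = 1\<close> avoids a division by 0 and does not affect the limit superior.\<close>

lemma limsup_tendsto_zeroI:
  fixes a :: "real \<Rightarrow> nat \<Rightarrow> real"
  assumes nonneg: "\<And>\<gamma> n. 0 \<le> a \<gamma> n"
    and bound: "\<And>\<eta>. \<eta> > 0 \<Longrightarrow> \<exists>A B \<gamma>0. \<gamma>0 > 0 \<and>
      (\<forall>\<gamma>\<in>{0<..\<gamma>0}. \<forall>n\<ge>1. a \<gamma> n \<le> \<eta> + A / (\<gamma> * real n) + B * \<gamma>)"
  shows "((\<lambda>\<gamma>. limsup (\<lambda>n. ereal (a \<gamma> n))) \<longlongrightarrow> 0) (at_right 0)"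
proof (rule order_tendstoI)
  fix e :: ereal assume "e < 0"
  moreover have "0 \<le> limsup (\<lambda>n. ereal (a \<gamma> n))" for \<gamma>
    using nonneg[of \<gamma>] by (intro le_Limsup) auto
  ultimately show "\<forall>\<^sub>F \<gamma> in at_right 0. e < limsup (\<lambda>n. ereal (a \<gamma> n))"
    by (intro always_eventually allI) (rule less_le_trans)
next
  fix e :: ereal assume "0 < e"
  then obtain r where r: "0 < r" "ereal r < e"
    using ereal_dense2[of 0 e] by auto
  obtain A B \<gamma>0 where \<gamma>0: "\<gamma>0 > 0"
    and le: "\<And>\<gamma> n. \<gamma> \<in> {0<..\<gamma>0} \<Longrightarrow> n \<ge> 1 \<Longrightarrow> a \<gamma> n \<le> r / 2 + A / (\<gamma> * real n) + B * \<gamma>"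
    using bound[OF half_gt_zero[OF r(1)]] by blast
  have lim: "limsup (\<lambda>n. ereal (a \<gamma> n)) \<le> ereal (r / 2 + B * \<gamma>)" if \<gamma>: "\<gamma> \<in> {0<..\<gamma>0}" for \<gamma>
  proof -
    have "limsup (\<lambda>n. ereal (a \<gamma> n)) \<le> limsup (\<lambda>n. ereal (r / 2 + A / (\<gamma> * real n) + B * \<gamma>))"
      using le[OF \<gamma>] by (intro Limsup_mono) (auto intro!: eventually_sequentiallyI[of 1])
    also have "\<dots> = ereal (r / 2 + A / \<gamma> * 0 + B * \<gamma>)"
    proof (rule lim_imp_Limsup)
      have "(\<lambda>n. r / 2 + A / \<gamma> * (1 / real n) + B * \<gamma>) \<longlonglongrightarrow> r / 2 + A / \<gamma> * 0 + B * \<gamma>"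
        by (intro tendsto_intros lim_1_over_n)
      then show "(\<lambda>n. ereal (r / 2 + A / (\<gamma> * real n) + B * \<gamma>)) \<longlonglongrightarrow> ereal (r / 2 + A / \<gamma> * 0 + B * \<gamma>)"
        by simp
    qed simp
    finally show ?thesis by simp
  qed
  have "((\<lambda>\<gamma>. r / 2 + B * \<gamma>) \<longlongrightarrow> r / 2 + B * 0) (at_right 0)"
    by (intro tendsto_intros)
  then have "\<forall>\<^sub>F \<gamma> in at_right 0. r / 2 + B * \<gamma> < r"
    by (rule order_tendstoD(2)) (use r in simp)
  moreover have "\<forall>\<^sub>F \<gamma> in at_right 0. \<gamma> \<in> {0<..\<gamma>0}"
    unfolding eventually_at_right_field using \<gamma>0 by (intro exI[of _ \<gamma>0]) auto
  ultimately show "\<forall>\<^sub>F \<gamma> in at_right 0. limsup (\<lambda>n. ereal (a \<gamma> n)) < e"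
  proof eventually_elim
    case (elim \<gamma>)
    have "limsup (\<lambda>n. ereal (a \<gamma> n)) \<le> ereal (r / 2 + B * \<gamma>)" using elim lim by simp
    also have "\<dots> < ereal r" using elim by simp
    also note r(2)
    finally show ?case .
  qed
qed

text \<open>In \<open>avg\<close>, \<open>\<epsilon>\<close> is a dead zone around \<open>S\<close>.
  Probabilities use it with \<open>\<epsilon> / 2\<close>: a distance of at least
  \<open>\<epsilon>\<close> leaves an excess of at least \<open>\<epsilon> / 2\<close> for Markov's
  inequality. The mean uses it with the tolerance \<open>\<eta>\<close> itself.\<close>

lemma ergodic_limits:
  fixes X :: "real \<Rightarrow> nat \<Rightarrow> 'w \<Rightarrow> 'a::euclidean_space"
  assumes P: "prob_space P" and X: "\<And>\<gamma> n. \<gamma> > 0 \<Longrightarrow> integrable P (X \<gamma> n)"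
    and S: "convex S" "S \<noteq> {}"
    and avg: "\<And>\<epsilon>. \<epsilon> > 0 \<Longrightarrow> \<exists>A B \<gamma>0. \<gamma>0 > 0 \<and> 0 \<le> A \<and> 0 \<le> B \<and> (\<forall>\<gamma>\<in>{0<..\<gamma>0}. \<forall>n.
        (\<Sum>k=0..n. \<integral>\<omega>. max 0 (infdist (X \<gamma> k \<omega>) S - \<epsilon>) \<partial>P) \<le> A / \<gamma> + real (n + 1) * (B * \<gamma>))"
  defines "Y \<equiv> \<lambda>\<gamma> n \<omega>. (1 / real n) *\<^sub>R (\<Sum>k=1..n. X \<gamma> k \<omega>)"
  shows "\<epsilon> > 0 \<Longrightarrow> ((\<lambda>\<gamma>. limsup (\<lambda>n. ereal (1 / real (n + 1) *
            (\<Sum>k=0..n. measure P {\<omega> \<in> space P. infdist (X \<gamma> k \<omega>) S > \<epsilon>})))) \<longlongrightarrow> 0) (at_right 0)"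
    and "\<epsilon> > 0 \<Longrightarrow> ((\<lambda>\<gamma>. limsup (\<lambda>n. ereal (measure P {\<omega> \<in> space P. infdist (Y \<gamma> n \<omega>) S \<ge> \<epsilon>}))) \<longlongrightarrow> 0)
            (at_right 0)"
    and "\<gamma> > 0 \<Longrightarrow> integrable P (Y \<gamma> n)"
    and "((\<lambda>\<gamma>. limsup (\<lambda>n. ereal (infdist (\<integral>\<omega>. Y \<gamma> n \<omega> \<partial>P) S))) \<longlongrightarrow> 0) (at_right 0)"
proof -
  interpret prob_space P by fact
  obtain s where s: "s \<in> S" using S by blast
  define q where "q \<gamma> \<epsilon> k \<omega> = max 0 (infdist (X \<gamma> k \<omega>) S - \<epsilon>)" for \<gamma> \<epsilon> k \<omega>
  have int_inf: "integrable P (\<lambda>\<omega>. infdist (Z \<omega>) S)" if Z: "integrable P Z" for Z :: "'w \<Rightarrow> 'a"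
  proof (rule Bochner_Integration.integrable_bound)
    show "integrable P (\<lambda>\<omega>. norm (Z \<omega> - s))" using Z by simp
    show "(\<lambda>\<omega>. infdist (Z \<omega>) S) \<in> borel_measurable P"
      using borel_measurable_integrable[OF Z]
      by (rule borel_measurable_continuous_on[rotated]) (auto intro!: continuous_intros)
  qed (auto simp: infdist_nonneg dist_norm[symmetric] intro!: infdist_le s)
  have int_q: "integrable P (q \<gamma> \<epsilon> k)" if "\<gamma> > 0" for \<gamma> \<epsilon> k
    unfolding q_def using int_inf[OF X[OF that]] by auto
  have q_nonneg: "0 \<le> q \<gamma> \<epsilon> k \<omega>" for \<gamma> \<epsilon> k \<omega> by (simp add: q_def)
  \<comment> \<open>The iterates are averaged over times 0 to \<open>n\<close>, \<open>Y\<close>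
    over times 1 to \<open>n\<close>. Dividing by \<open>n\<close> instead of \<open>n + 1\<close>
    costs \<open>n + 1 \<le> 2 * n\<close>, whence the witness \<open>2 * B\<close>.\<close>
  have avg0: "\<exists>A B \<gamma>0. \<gamma>0 > 0 \<and> (\<forall>\<gamma>\<in>{0<..\<gamma>0}. \<forall>n\<ge>1.
      1 / real (n + 1) * (\<Sum>k=0..n. \<integral>\<omega>. q \<gamma> \<epsilon> k \<omega> \<partial>P) \<le> A / (\<gamma> * real n) + B * \<gamma> \<and>
      1 / real n * (\<Sum>k=1..n. \<integral>\<omega>. q \<gamma> \<epsilon> k \<omega> \<partial>P) \<le> A / (\<gamma> * real n) + B * \<gamma>)" if \<epsilon>: "\<epsilon> > 0" for \<epsilon>
  proof -
    obtain A B \<gamma>0 where \<gamma>0: "\<gamma>0 > 0" "0 \<le> A" "0 \<le> B"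
      and le: "\<And>\<gamma> n. \<gamma> \<in> {0<..\<gamma>0} \<Longrightarrow> (\<Sum>k=0..n. \<integral>\<omega>. q \<gamma> \<epsilon> k \<omega> \<partial>P) \<le> A / \<gamma> + real (n + 1) * (B * \<gamma>)"
      using avg[OF \<epsilon>] unfolding q_def by blast
    show ?thesis
    proof (rule exI[of _ A], rule exI[of _ "2 * B"], rule exI[of _ \<gamma>0], intro conjI ballI allI impI)
      fix \<gamma> and n :: nat assume \<gamma>: "\<gamma> \<in> {0<..\<gamma>0}" and n: "n \<ge> 1"
      have nn: "0 \<le> A / \<gamma>" "0 \<le> B * \<gamma>" using \<gamma>0 \<gamma> by auto
      have "1 / real (n + 1) * (\<Sum>k=0..n. \<integral>\<omega>. q \<gamma> \<epsilon> k \<omega> \<partial>P)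
          \<le> 1 / real (n + 1) * (A / \<gamma> + real (n + 1) * (B * \<gamma>))"
        by (intro mult_left_mono le[OF \<gamma>]) auto
      also have "\<dots> = A / \<gamma> / real (n + 1) + B * \<gamma>"
        by (simp add: distrib_left add_divide_distrib del: of_nat_Suc of_nat_add)
      also have "A / \<gamma> / real (n + 1) \<le> A / \<gamma> / real n"
        using n nn by (intro divide_left_mono) auto
      finally show "1 / real (n + 1) * (\<Sum>k=0..n. \<integral>\<omega>. q \<gamma> \<epsilon> k \<omega> \<partial>P) \<le> A / (\<gamma> * real n) + 2 * B * \<gamma>"
        using nn by simp
      have "(\<Sum>k=1..n. \<integral>\<omega>. q \<gamma> \<epsilon> k \<omega> \<partial>P) \<le> (\<Sum>k=0..n. \<integral>\<omega>. q \<gamma> \<epsilon> k \<omega> \<partial>P)"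
        by (intro sum_mono2) (auto intro!: integral_nonneg_AE q_nonneg)
      also have "\<dots> \<le> A / \<gamma> + real (n + 1) * (B * \<gamma>)" by (rule le[OF \<gamma>])
      also have "real (n + 1) * (B * \<gamma>) \<le> (2 * real n) * (B * \<gamma>)"
        using n nn by (intro mult_right_mono) auto
      finally have "1 / real n * (\<Sum>k=1..n. \<integral>\<omega>. q \<gamma> \<epsilon> k \<omega> \<partial>P) \<le> 1 / real n * (A / \<gamma> + (2 * real n) * (B * \<gamma>))"
        by (intro mult_left_mono) auto
      also have "\<dots> = A / (\<gamma> * real n) + 2 * B * \<gamma>"
        using n by (simp add: distrib_left)
      finally show "1 / real n * (\<Sum>k=1..n. \<integral>\<omega>. q \<gamma> \<epsilon> k \<omega> \<partial>P) \<le> A / (\<gamma> * real n) + 2 * B * \<gamma>" .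
    qed (use \<gamma>0 in auto)
  qed
  have markov: "measure P {\<omega> \<in> space P. Q \<omega>} \<le> (\<integral>\<omega>. u \<omega> \<partial>P) / c"
    if u: "integrable P u" "\<And>\<omega>. 0 \<le> u \<omega>" "c > 0" "\<And>\<omega>. Q \<omega> \<Longrightarrow> c \<le> u \<omega>" for Q and u :: "'w \<Rightarrow> real" and c
  proof -
    have "measure P {\<omega> \<in> space P. Q \<omega>} \<le> measure P {\<omega> \<in> space P. c \<le> u \<omega>}"
      using u borel_measurable_integrable[OF u(1)] by (intro finite_measure_mono) auto
    also have "\<dots> \<le> (\<integral>\<omega>. u \<omega> \<partial>P) / c"
      using u by (intro integral_Markov_inequality_measure[where A = "{}"]) auto
    finally show ?thesis .
  qed
  show int_Y: "integrable P (Y \<gamma> n)" if "\<gamma> > 0" for \<gamma> n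
    unfolding Y_def using X[OF that] by auto
  have Y_le: "infdist (Y \<gamma> n \<omega>) S \<le> \<epsilon> + 1 / real n * (\<Sum>k=1..n. q \<gamma> \<epsilon> k \<omega>)" if n: "n \<ge> 1" for \<gamma> n \<omega> \<epsilon>
  proof -
    have "infdist (Y \<gamma> n \<omega>) S = infdist (\<Sum>k=1..n. (1 / real n) *\<^sub>R X \<gamma> k \<omega>) S"
      unfolding Y_def by (simp add: scaleR_sum_right)
    also have "\<dots> \<le> (\<Sum>k=1..n. 1 / real n * infdist (X \<gamma> k \<omega>) S)"
      using n by (intro convex_on_sum[OF _ _ convex_on_infdist[OF S]]) auto
    also have "\<dots> \<le> (\<Sum>k=1..n. 1 / real n * (\<epsilon> + q \<gamma> \<epsilon> k \<omega>))"
      by (intro sum_mono mult_left_mono) (auto simp: q_def)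
    also have "\<dots> = \<epsilon> + 1 / real n * (\<Sum>k=1..n. q \<gamma> \<epsilon> k \<omega>)"
      using n by (simp add: distrib_left sum.distrib sum_distrib_left)
    finally show ?thesis .
  qed
  have int_avg: "integrable P (\<lambda>\<omega>. 1 / real n * (\<Sum>k=1..n. q \<gamma> \<epsilon> k \<omega>))"
    and avg_eq: "(\<integral>\<omega>. 1 / real n * (\<Sum>k=1..n. q \<gamma> \<epsilon> k \<omega>) \<partial>P) = 1 / real n * (\<Sum>k=1..n. \<integral>\<omega>. q \<gamma> \<epsilon> k \<omega> \<partial>P)"
    if "\<gamma> > 0" for \<gamma> \<epsilon> n
    using int_q[OF that] by simp_all
  show "((\<lambda>\<gamma>. limsup (\<lambda>n. ereal (1 / real (n + 1) *
      (\<Sum>k=0..n. measure P {\<omega> \<in> space P. infdist (X \<gamma> k \<omega>) S > \<epsilon>})))) \<longlongrightarrow> 0) (at_right 0)" if \<epsilon>: "\<epsilon> > 0"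
  proof (rule limsup_tendsto_zeroI)
    fix \<eta> :: real assume \<eta>: "\<eta> > 0"
    obtain A B \<gamma>0 where \<gamma>0: "\<gamma>0 > 0" and le: "\<And>\<gamma> n. \<gamma> \<in> {0<..\<gamma>0} \<Longrightarrow> n \<ge> 1 \<Longrightarrow>
      1 / real (n + 1) * (\<Sum>k=0..n. \<integral>\<omega>. q \<gamma> (\<epsilon> / 2) k \<omega> \<partial>P) \<le> A / (\<gamma> * real n) + B * \<gamma>"
      using avg0[OF half_gt_zero[OF \<epsilon>]] by blast
    show "\<exists>A B \<gamma>0. \<gamma>0 > 0 \<and> (\<forall>\<gamma>\<in>{0<..\<gamma>0}. \<forall>n\<ge>1. 1 / real (n + 1) *
      (\<Sum>k=0..n. measure P {\<omega> \<in> space P. infdist (X \<gamma> k \<omega>) S > \<epsilon>}) \<le> \<eta> + A / (\<gamma> * real n) + B * \<gamma>)"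
    proof (rule exI[of _ "A / (\<epsilon> / 2)"], rule exI[of _ "B / (\<epsilon> / 2)"], rule exI[of _ \<gamma>0], intro conjI ballI allI impI \<gamma>0)
      fix \<gamma> and n :: nat assume \<gamma>: "\<gamma> \<in> {0<..\<gamma>0}" and n: "n \<ge> 1"
      have "1 / real (n + 1) * (\<Sum>k=0..n. measure P {\<omega> \<in> space P. infdist (X \<gamma> k \<omega>) S > \<epsilon>})
          \<le> 1 / real (n + 1) * (\<Sum>k=0..n. (\<integral>\<omega>. q \<gamma> (\<epsilon> / 2) k \<omega> \<partial>P) / (\<epsilon> / 2))"
      proof (intro mult_left_mono sum_mono)
        fix k
        show "measure P {\<omega> \<in> space P. infdist (X \<gamma> k \<omega>) S > \<epsilon>} \<le> (\<integral>\<omega>. q \<gamma> (\<epsilon> / 2) k \<omega> \<partial>P) / (\<epsilon> / 2)"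
          by (rule markov[OF int_q q_nonneg]) (use \<gamma> \<epsilon> in \<open>auto simp: q_def\<close>)
      qed auto
      also have "\<dots> = 1 / real (n + 1) * (\<Sum>k=0..n. \<integral>\<omega>. q \<gamma> (\<epsilon> / 2) k \<omega> \<partial>P) / (\<epsilon> / 2)"
        by (simp only: sum_divide_distrib[symmetric] times_divide_eq_right)
      also have "\<dots> \<le> (A / (\<gamma> * real n) + B * \<gamma>) / (\<epsilon> / 2)"
        using \<epsilon> by (intro divide_right_mono le \<gamma> n) auto
      also have "\<dots> = A / (\<epsilon> / 2) / (\<gamma> * real n) + B / (\<epsilon> / 2) * \<gamma>"
        by (simp add: add_divide_distrib mult_ac)
      finally show "1 / real (n + 1) * (\<Sum>k=0..n. measure P {\<omega> \<in> space P. infdist (X \<gamma> k \<omega>) S > \<epsilon>})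
          \<le> \<eta> + A / (\<epsilon> / 2) / (\<gamma> * real n) + B / (\<epsilon> / 2) * \<gamma>"
        using \<eta> by linarith
    qed
  qed (auto intro!: sum_nonneg divide_nonneg_nonneg)
  show "((\<lambda>\<gamma>. limsup (\<lambda>n. ereal (measure P {\<omega> \<in> space P. infdist (Y \<gamma> n \<omega>) S \<ge> \<epsilon>}))) \<longlongrightarrow> 0)
            (at_right 0)" if \<epsilon>: "\<epsilon> > 0"
  proof (rule limsup_tendsto_zeroI)
    fix \<eta> :: real assume \<eta>: "\<eta> > 0"
    obtain A B \<gamma>0 where \<gamma>0: "\<gamma>0 > 0" and le: "\<And>\<gamma> n. \<gamma> \<in> {0<..\<gamma>0} \<Longrightarrow> n \<ge> 1 \<Longrightarrow>
      1 / real n * (\<Sum>k=1..n. \<integral>\<omega>. q \<gamma> (\<epsilon> / 2) k \<omega> \<partial>P) \<le> A / (\<gamma> * real n) + B * \<gamma>"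
      using avg0[OF half_gt_zero[OF \<epsilon>]] by blast
    show "\<exists>A B \<gamma>0. \<gamma>0 > 0 \<and> (\<forall>\<gamma>\<in>{0<..\<gamma>0}. \<forall>n\<ge>1.
      measure P {\<omega> \<in> space P. infdist (Y \<gamma> n \<omega>) S \<ge> \<epsilon>} \<le> \<eta> + A / (\<gamma> * real n) + B * \<gamma>)"
    proof (rule exI[of _ "A / (\<epsilon> / 2)"], rule exI[of _ "B / (\<epsilon> / 2)"], rule exI[of _ \<gamma>0], intro conjI ballI allI impI \<gamma>0)
      fix \<gamma> and n :: nat assume \<gamma>: "\<gamma> \<in> {0<..\<gamma>0}" and n: "n \<ge> 1"
      have "\<gamma> > 0" using \<gamma> by simp
      have "measure P {\<omega> \<in> space P. infdist (Y \<gamma> n \<omega>) S \<ge> \<epsilon>}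
          \<le> (\<integral>\<omega>. 1 / real n * (\<Sum>k=1..n. q \<gamma> (\<epsilon> / 2) k \<omega>) \<partial>P) / (\<epsilon> / 2)"
      proof (rule markov)
        show "\<epsilon> / 2 \<le> 1 / real n * (\<Sum>k=1..n. q \<gamma> (\<epsilon> / 2) k \<omega>)" if "\<epsilon> \<le> infdist (Y \<gamma> n \<omega>) S" for \<omega>
          using Y_le[OF n, of \<gamma> \<omega> "\<epsilon> / 2"] that by linarith
      qed (use \<gamma> \<epsilon> int_avg q_nonneg in \<open>auto intro!: divide_nonneg_nonneg sum_nonneg\<close>)
      also have "\<dots> \<le> (A / (\<gamma> * real n) + B * \<gamma>) / (\<epsilon> / 2)"
        unfolding avg_eq[OF \<open>\<gamma> > 0\<close>] using \<epsilon> by (intro divide_right_mono le \<gamma> n) auto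
      also have "\<dots> = A / (\<epsilon> / 2) / (\<gamma> * real n) + B / (\<epsilon> / 2) * \<gamma>"
        by (simp add: add_divide_distrib mult_ac)
      finally show "measure P {\<omega> \<in> space P. infdist (Y \<gamma> n \<omega>) S \<ge> \<epsilon>}
          \<le> \<eta> + A / (\<epsilon> / 2) / (\<gamma> * real n) + B / (\<epsilon> / 2) * \<gamma>"
        using \<eta> by linarith
    qed
  qed simp
  show "((\<lambda>\<gamma>. limsup (\<lambda>n. ereal (infdist (\<integral>\<omega>. Y \<gamma> n \<omega> \<partial>P) S))) \<longlongrightarrow> 0) (at_right 0)"
  proof (rule limsup_tendsto_zeroI)
    fix \<eta> :: real assume \<eta>: "\<eta> > 0"
    obtain A B \<gamma>0 where \<gamma>0: "\<gamma>0 > 0" and le: "\<And>\<gamma> n. \<gamma> \<in> {0<..\<gamma>0} \<Longrightarrow> n \<ge> 1 \<Longrightarrow>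
      1 / real n * (\<Sum>k=1..n. \<integral>\<omega>. q \<gamma> \<eta> k \<omega> \<partial>P) \<le> A / (\<gamma> * real n) + B * \<gamma>"
      using avg0[OF \<eta>] by blast
    show "\<exists>A B \<gamma>0. \<gamma>0 > 0 \<and> (\<forall>\<gamma>\<in>{0<..\<gamma>0}. \<forall>n\<ge>1.
      infdist (\<integral>\<omega>. Y \<gamma> n \<omega> \<partial>P) S \<le> \<eta> + A / (\<gamma> * real n) + B * \<gamma>)"
    proof (rule exI[of _ A], rule exI[of _ B], rule exI[of _ \<gamma>0], intro conjI ballI allI impI \<gamma>0)
      fix \<gamma> and n :: nat assume \<gamma>: "\<gamma> \<in> {0<..\<gamma>0}" and n: "n \<ge> 1"
      have \<gamma>': "\<gamma> > 0" using \<gamma> by simp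
      have "infdist (\<integral>\<omega>. Y \<gamma> n \<omega> \<partial>P) S \<le> (\<integral>\<omega>. infdist (Y \<gamma> n \<omega>) S \<partial>P)"
        by (rule infdist_integral_le[OF P int_Y[OF \<gamma>'] S])
      also have "\<dots> \<le> (\<integral>\<omega>. \<eta> + 1 / real n * (\<Sum>k=1..n. q \<gamma> \<eta> k \<omega>) \<partial>P)"
        using int_inf[OF int_Y[OF \<gamma>']] int_avg[OF \<gamma>'] by (intro integral_mono Y_le n) auto
      also have "\<dots> = \<eta> + 1 / real n * (\<Sum>k=1..n. \<integral>\<omega>. q \<gamma> \<eta> k \<omega> \<partial>P)"
        using int_avg[OF \<gamma>'] avg_eq[OF \<gamma>'] by (subst Bochner_Integration.integral_add) (auto simp: prob_space)
      also have "\<dots> \<le> \<eta> + A / (\<gamma> * real n) + B * \<gamma>"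
        using le[OF \<gamma> n] by linarith
      finally show "infdist (\<integral>\<omega>. Y \<gamma> n \<omega> \<partial>P) S \<le> \<eta> + A / (\<gamma> * real n) + B * \<gamma>" .
    qed
  qed (simp add: infdist_nonneg)
qed

section \<open>Geometry of the set of minimizers, and assembly of the limits\<close>

theorem theorem1:
  fixes M :: "'s measure"
    and P :: "'w measure"
    and f g :: "'a::euclidean_space \<Rightarrow> 's \<Rightarrow> ereal"
    and F G :: "'a \<Rightarrow> ereal"
    and FM GM :: "real \<Rightarrow> 'a \<Rightarrow> ereal"
    and D :: "'s \<Rightarrow> 'a set"
    and \<xi> :: "nat \<Rightarrow> 'w \<Rightarrow> 's"
    and X :: "real \<Rightarrow> ('w \<Rightarrow> 'a) \<Rightarrow> nat \<Rightarrow> 'w \<Rightarrow> 'a"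
    and Xbar :: "real \<Rightarrow> ('w \<Rightarrow> 'a) \<Rightarrow> nat \<Rightarrow> 'w \<Rightarrow> 'a"
  assumes M: "prob_space M" and P: "prob_space P"
    \<comment> \<open>notation\<close>
    and F_eq: "\<And>x. F x = ereal_integral M (\<lambda>s. f x s)"
    and G_eq: "\<And>x. G x = ereal_integral M (\<lambda>s. g x s)"
    and FM_eq: "\<And>\<gamma> x. FM \<gamma> x = ereal_integral M (\<lambda>s. moreau \<gamma> (\<lambda>y. f y s) x)"
    and GM_eq: "\<And>\<gamma> x. GM \<gamma> x = ereal_integral M (\<lambda>s. moreau \<gamma> (\<lambda>y. g y s) x)"
    and D_eq: "\<And>s. D s = edom (\<lambda>y. g y s)"
    and X_eq: "\<And>\<gamma> X0 n \<omega>. X \<gamma> X0 n \<omega> = dr_iter \<gamma> f g (X0 \<omega>) (\<lambda>k. \<xi> k \<omega>) n"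
    and Xbar_eq: "\<And>\<gamma> X0 n \<omega>. Xbar \<gamma> X0 n \<omega> = (1 / real n) *\<^sub>R (\<Sum>k=1..n. X \<gamma> X0 k \<omega>)"
    \<comment> \<open>standing assumptions\<close>
    and f_G0: "\<And>s. s \<in> space M \<Longrightarrow> (\<lambda>y. f y s) \<in> Gamma0"
    and g_G0: "\<And>s. s \<in> space M \<Longrightarrow> (\<lambda>y. g y s) \<in> Gamma0"
    and F_G0: "F \<in> Gamma0"
    and G_G0: "G \<in> Gamma0"
    and iid: "iid_copies P M \<xi>"
    \<comment> \<open>measurability of the proximity maps and of the integrands\<close>
    and meas_prox_f: "\<And>\<gamma>. \<gamma> > 0 \<Longrightarrow>
          (\<lambda>(x, s). prox \<gamma> (\<lambda>y. f y s) x) \<in> borel_measurable (borel \<Otimes>\<^sub>M M)"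
    and meas_prox_g: "\<And>\<gamma>. \<gamma> > 0 \<Longrightarrow>
          (\<lambda>(x, s). prox \<gamma> (\<lambda>y. g y s) x) \<in> borel_measurable (borel \<Otimes>\<^sub>M M)"
    and meas_f: "\<And>x. (\<lambda>s. f x s) \<in> borel_measurable M"
    and meas_g: "\<And>x. (\<lambda>s. g x s) \<in> borel_measurable M"
    and meas_moreau_f: "\<And>\<gamma> x. \<gamma> > 0 \<Longrightarrow>
          (\<lambda>s. moreau \<gamma> (\<lambda>y. f y s) x) \<in> borel_measurable M"
    and meas_moreau_g: "\<And>\<gamma> x. \<gamma> > 0 \<Longrightarrow>
          (\<lambda>s. moreau \<gamma> (\<lambda>y. g y s) x) \<in> borel_measurable M"
    and meas_subgrad: "\<And>x. x \<in> edom G \<Longrightarrow>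
          (\<lambda>s. norm (least_subgrad (\<lambda>y. g y s) x)) \<in> borel_measurable M"
    and meas_grad: "\<And>x. (\<lambda>s. norm (gradient (\<lambda>y. f y s) x)) \<in> borel_measurable M"
    and meas_grad_moreau: "\<And>\<gamma> x. \<gamma> > 0 \<Longrightarrow>
          (\<lambda>s. norm (gradient (moreau \<gamma> (\<lambda>y. f y s)) x)) \<in> borel_measurable M"
    and meas_dist: "\<And>x. (\<lambda>s. infdist x (D s)) \<in> borel_measurable M"
    and meas_proj: "\<And>\<gamma> x. \<gamma> > 0 \<Longrightarrow>
          (\<lambda>s. norm (prox \<gamma> (\<lambda>y. g y s) x - closest_point (closure (D s)) x))
            \<in> borel_measurable M"
    \<comment> \<open>the hypotheses (A1) to (A8)\<close>
    and A1: "\<And>K. compact K \<Longrightarrow> \<exists>\<epsilon>>0.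
          (\<forall>x\<in>K \<inter> edom G. AE s in M. subdiff (\<lambda>y. g y s) x \<noteq> {}) \<and>
          (SUP x\<in>K \<inter> edom G.
             \<integral>\<^sup>+ s. ennreal (norm (least_subgrad (\<lambda>y. g y s) x) powr (1 + \<epsilon>)) \<partial>M) < \<infinity>"
    and A2_diff: "AE s in M. differentiable_fun (\<lambda>y. f y s)"
    and A2_ball: "\<exists>c r m. r > 0 \<and> integrable M m \<and>
          (AE s in M. \<forall>x\<in>cball c r. norm (gradient (\<lambda>y. f y s) x) \<le> m s)"
    and A2_sup: "\<And>K. compact K \<Longrightarrow> \<exists>\<epsilon>>0.
          (SUP x\<in>K. \<integral>\<^sup>+ s. ennreal (norm (gradient (\<lambda>y. f y s) x) powr (1 + \<epsilon>)) \<partial>M) < \<infinity>"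
    and A3: "\<exists>C>0. \<forall>x.
          (\<integral>\<^sup>+ s. ennreal ((infdist x (D s))\<^sup>2) \<partial>M) \<ge> ennreal (C * (infdist x (edom G))\<^sup>2)"
    and A4: "\<And>K. compact K \<Longrightarrow> \<exists>\<epsilon>>0. \<exists>C>0. \<exists>\<gamma>0>0. \<forall>\<gamma>\<in>{0<..\<gamma>0}. \<forall>x\<in>K.
          ennreal (1 / \<gamma> powr (1 + \<epsilon>)) *
            (\<integral>\<^sup>+ s. ennreal (norm (prox \<gamma> (\<lambda>y. g y s) x - closest_point (closure (D s)) x)
                      powr (1 + \<epsilon>)) \<partial>M) < ennreal C"
    and A5: "\<exists>L>0. AE s in M. L-lipschitz_on UNIV (gradient (\<lambda>y. f y s))"
    and A6: "\<exists>xs \<in> Argmin (\<lambda>x. F x + G x). \<exists>\<phi> \<in> Lp 2 M.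
          (AE s in M. \<phi> s \<in> subdiff (\<lambda>y. g y s) xs) \<and>
          (\<lambda>s. gradient (\<lambda>y. f y s) xs) \<in> Lp 2 M \<and>
          (\<integral>s. gradient (\<lambda>y. f y s) xs \<partial>M) + (\<integral>s. \<phi> s \<partial>M) = 0"
    and A7: "coercive (\<lambda>x. F x + G x) \<or> supercoercive (\<lambda>x. F x + G x)"
    and A8: "\<exists>\<gamma>0>0. \<exists>C>0. \<forall>\<gamma>\<in>{0<..\<gamma>0}. \<forall>x.
          enn2ereal (\<integral>\<^sup>+ s. ennreal (norm (gradient (moreau \<gamma> (\<lambda>y. f y s)) x) +
              1 / \<gamma> * norm (prox \<gamma> (\<lambda>y. g y s) x - closest_point (closure (D s)) x)) \<partial>M)
          \<le> ereal C * (1 + \<bar>FM \<gamma> x + GM \<gamma> x\<bar>)"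
  shows "\<forall>\<nu> X0. prob_space \<nu> \<and> sets \<nu> = sets borel \<and> integrable \<nu> (\<lambda>x. (norm x)\<^sup>2) \<and>
                initial_rv P M \<xi> \<nu> X0 \<longrightarrow>
      (\<forall>\<epsilon>>0.
        ((\<lambda>\<gamma>. limsup (\<lambda>n. ereal (1 / real (n + 1) *
            (\<Sum>k=0..n. measure P {\<omega> \<in> space P.
               infdist (X \<gamma> X0 k \<omega>) (Argmin (\<lambda>x. F x + G x)) > \<epsilon>})))) \<longlongrightarrow> 0) (at_right 0)) \<and>
      (supercoercive (\<lambda>x. F x + G x) \<longrightarrow>
        (\<forall>\<epsilon>>0.
          ((\<lambda>\<gamma>. limsup (\<lambda>n. ereal (measure P {\<omega> \<in> space P.
               infdist (Xbar \<gamma> X0 n \<omega>) (Argmin (\<lambda>x. F x + G x)) \<ge> \<epsilon>}))) \<longlongrightarrow> 0) (at_right 0)) \<and>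
        (\<forall>\<gamma>>0. \<forall>n\<ge>1. integrable P (Xbar \<gamma> X0 n)) \<and>
        ((\<lambda>\<gamma>. limsup (\<lambda>n. ereal (infdist (\<integral>\<omega>. Xbar \<gamma> X0 n \<omega> \<partial>P)
               (Argmin (\<lambda>x. F x + G x))))) \<longlongrightarrow> 0) (at_right 0))"
proof -
  let ?H = "\<lambda>x. F x + G x"
  define S where "S = Argmin ?H"
  obtain xs \<phi> where xs: "xs \<in> S" and \<phi>: "\<phi> \<in> Lp 2 M" "AE s in M. \<phi> s \<in> subdiff (\<lambda>y. g y s) xs"
    and d2: "(\<lambda>s. gradient (\<lambda>y. f y s) xs) \<in> Lp 2 M"
    and mean: "(\<integral>s. gradient (\<lambda>y. f y s) xs \<partial>M) + (\<integral>s. \<phi> s \<partial>M) = 0"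
    using A6 unfolding S_def by blast
  obtain L where L: "L > 0" "AE s in M. L-lipschitz_on UNIV (gradient (\<lambda>y. f y s))"
    using A5 by blast
  define d where "d s = gradient (\<lambda>y. f y s) xs" for s
  have xs_le: "?H xs \<le> ?H y" for y
    using xs by (auto simp: S_def Argmin_def is_arg_min_def not_less)
  have S_iff: "x \<in> S \<longleftrightarrow> ?H x \<le> ?H xs" for x
    using xs_le by (auto simp: S_def Argmin_def is_arg_min_def not_less intro: order_trans)
  have d_sub: "AE s in M. d s \<in> subdiff (\<lambda>y. f y s) xs"
    using A2_diff AE_space
  proof eventually_elim
    case (elim s)
    then show ?case unfolding d_def by (intro gradient_in_subdiff f_G0)
  qed
  have upper: "AE s in M. \<forall>w. f w s
      \<le> ereal (real_of_ereal (f xs s) + d s \<bullet> (w - xs) + L * (norm (w - xs))\<^sup>2)"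
    using A2_diff L(2) AE_space
  proof eventually_elim
    case (elim s)
    then show ?case
      unfolding d_def using lipschitz_gradient_upper[OF f_G0, of s L _ xs] by blast
  qed
  have sdr: "stochastic_dr M f g xs d \<phi> L"
  proof (intro stochastic_dr.intro M stochastic_dr_axioms.intro)
    show "d \<in> borel_measurable M" "integrable M (\<lambda>s. (norm (d s))\<^sup>2)"
      using d2 by (simp_all add: Lp_def d_def[abs_def])
    show "\<phi> \<in> borel_measurable M" "integrable M (\<lambda>s. (norm (\<phi> s))\<^sup>2)"
      using \<phi> by (simp_all add: Lp_def)
    show "(\<integral>s. d s \<partial>M) + (\<integral>s. \<phi> s \<partial>M) = 0"
      using mean by (simp add: d_def)
  qed (fact f_G0 g_G0 meas_f meas_g meas_prox_f meas_prox_g meas_moreau_f meas_moreau_g d_sub \<phi>(2) L(1) upper)+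
  interpret sdr: stochastic_dr M f g xs d \<phi> L by (rule sdr)
  have not_MInf: "F x \<noteq> -\<infinity>" "G x \<noteq> -\<infinity>" for x
    using Gamma0_not_MInf[OF F_G0] Gamma0_not_MInf[OF G_G0] by auto
  \<comment> \<open>Membership in \<open>S\<close> is comparison with the value at
    \<open>xs\<close>, so real arithmetic suffices once that value is finite; if it is infinite, the
    comparison is trivial.\<close>
  have "convex S"
    unfolding convex_def
  proof (intro ballI allI impI)
    fix x y u v assume S: "x \<in> S" "y \<in> S" and uv: "0 \<le> u" "0 \<le> v" "u + v = (1::real)"
    let ?z = "u *\<^sub>R x + v *\<^sub>R y"
    have "?H ?z \<le> (ereal u * F x + ereal v * F y) + (ereal u * G x + ereal v * G y)"
      by (intro add_mono Gamma0_convexD F_G0 G_G0 uv)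
    also have "\<dots> \<le> ?H xs"
    proof (cases "?H xs = \<infinity>")
      case False
      have "?H x \<le> ?H xs" "?H y \<le> ?H xs" using S S_iff by auto
      then have "F x \<noteq> \<infinity>" "G x \<noteq> \<infinity>" "F y \<noteq> \<infinity>" "G y \<noteq> \<infinity>"
        using False by auto
      then obtain a b a' b' where eq: "F x = ereal a" "G x = ereal b" "F y = ereal a'" "G y = ereal b'"
        using not_MInf by (metis ereal_cases)
      obtain h where h: "?H xs = ereal h"
        using False not_MInf[of xs] by (cases "F xs"; cases "G xs") auto
      have "a + b \<le> h" "a' + b' \<le> h"
        using \<open>?H x \<le> ?H xs\<close> \<open>?H y \<le> ?H xs\<close> unfolding h eq by auto
      then have "u * (a + b) + v * (a' + b') \<le> u * h + v * h"
        using uv by (intro add_mono mult_left_mono) auto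
      also have "\<dots> = h" using uv(3) by (simp add: distrib_right[symmetric])
      finally show ?thesis unfolding h eq by (simp add: algebra_simps)
    next
      case True
      show ?thesis unfolding True by simp
    qed
    finally show "?z \<in> S" by (simp add: S_iff)
  qed
  have "S \<noteq> {}" using xs by auto
  \<comment> \<open>Either growth property excludes values up to \<open>h\<close> far out. The
    supercoercive quotient is compared with the absolute value of \<open>h\<close>, so that
    multiplying by a norm of at least 1 cannot lead below \<open>h\<close>.\<close>
  have bounded_S: "bounded S" if fin: "?H xs \<noteq> \<infinity>"
  proof -
    obtain h where h: "?H xs = ereal h"
      using fin not_MInf[of xs] by (cases "F xs"; cases "G xs") auto
    have "\<forall>\<^sub>F x in at_infinity. ereal h < ?H x"
    proof (rule disjE[OF A7])
      assume "coercive ?H"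
      then show ?thesis unfolding coercive_def by (rule order_tendstoD) simp
    next
      assume "supercoercive ?H"
      then have "\<forall>\<^sub>F x in at_infinity. ereal \<bar>h\<bar> < ?H x / ereal (norm x)"
        unfolding supercoercive_def by (rule order_tendstoD) simp
      moreover have "\<forall>\<^sub>F x::'a in at_infinity. 1 \<le> norm x"
        by (rule eventually_at_infinityI)
      ultimately show ?thesis
      proof eventually_elim
        case (elim x)
        show ?case
        proof (cases "?H x")
          case (real r)
          have "\<bar>h\<bar> < r / norm x" using elim unfolding real by (cases "x = 0") auto
          then have "\<bar>h\<bar> * norm x < r" using elim by (subst (asm) pos_less_divide_eq) auto
          moreover have "\<bar>h\<bar> * 1 \<le> \<bar>h\<bar> * norm x" using elim by (intro mult_left_mono) auto
          ultimately show ?thesis unfolding real by simp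
        qed (use not_MInf[of x] in auto)
      qed
    qed
    then obtain b where b: "\<And>x. b \<le> norm x \<Longrightarrow> ereal h < ?H x"
      unfolding eventually_at_infinity by blast
    have "norm x \<le> b" if "x \<in> S" for x
      using b[of x] that unfolding S_iff h by (meson leD le_cases)
    then show ?thesis by (rule boundedI)
  qed
  show ?thesis
  proof (intro allI impI, elim conjE)
    fix \<nu> :: "'a measure" and X0 :: "'w \<Rightarrow> 'a"
    assume \<nu>: "prob_space \<nu>" "sets \<nu> = sets borel" "integrable \<nu> (\<lambda>x. (norm x)\<^sup>2)"
      and init: "initial_rv P M \<xi> \<nu> X0"
    interpret pr: dr_process M f g xs d \<phi> L P \<xi> \<nu> X0
      by (intro dr_process.intro sdr dr_process_axioms.intro P iid init \<nu>(3))
    have X_proc: "X \<gamma> X0 = pr.X \<gamma>" for \<gamma>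
      by (intro ext) (simp add: X_eq pr.X_def)
    have X_int: "integrable P (X \<gamma> X0 n)" if "\<gamma> > 0" for \<gamma> n
      unfolding X_proc by (rule pr.integrable_X[OF that])
    have avg: "\<exists>A B \<gamma>0. \<gamma>0 > 0 \<and> 0 \<le> A \<and> 0 \<le> B \<and> (\<forall>\<gamma>\<in>{0<..\<gamma>0}. \<forall>n.
        (\<Sum>k=0..n. \<integral>\<omega>. max 0 (infdist (X \<gamma> X0 k \<omega>) S - \<epsilon>) \<partial>P) \<le> A / \<gamma> + real (n + 1) * (B * \<gamma>))"
      if \<epsilon>: "\<epsilon> > 0" for \<epsilon>
    proof (cases "?H xs = \<infinity>")
      case True
      \<comment> \<open>\<open>F + G\<close> is infinite everywhere and every point is a minimizer.\<close>
      have "x \<in> S" for x unfolding S_iff True by simp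
      then have "S = UNIV" by blast
      then have "infdist x S = 0" for x by simp
      then show ?thesis
        using \<epsilon> by - (rule exI[of _ 0], rule exI[of _ 0], rule exI[of _ 1], simp)
    next
      case False
      then have fin: "\<bar>F xs\<bar> \<noteq> \<infinity>" "\<bar>G xs\<bar> \<noteq> \<infinity>"
        using not_MInf[of xs] by auto
      interpret fin: stochastic_dr_finite M f g xs d \<phi> L
        by (intro stochastic_dr_finite.intro sdr stochastic_dr_finite_axioms.intro)
          (use fin in \<open>simp_all add: F_eq G_eq\<close>)
      have crit: "x \<in> S" if "ereal_integral M (\<lambda>s. f x s) + ereal_integral M (\<lambda>s. g x s)
          = ereal_integral M (\<lambda>s. f xs s) + ereal_integral M (\<lambda>s. g xs s)" for x
        using that unfolding S_iff F_eq G_eq by simp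
      obtain c C \<gamma>0 where c: "c > 0" "C \<ge> 0" "\<gamma>0 > 0"
        and drift: "\<And>\<gamma> x. 0 < \<gamma> \<Longrightarrow> \<gamma> \<le> \<gamma>0 \<Longrightarrow>
          (\<integral>\<^sup>+ s. ennreal ((norm (sdr.dr_step \<gamma> x s - xs))\<^sup>2) \<partial>M) + ennreal (\<gamma> * c * max 0 (infdist x S - \<epsilon>))
            \<le> ennreal ((norm (x - xs))\<^sup>2 + C * \<gamma>\<^sup>2)"
        using fin.dr_step_drift[OF xs bounded_S[OF False] crit \<epsilon>] by blast
      define V0 where "V0 = (\<integral>\<omega>. (norm (X0 \<omega> - xs))\<^sup>2 \<partial>P)"
      have V0: "pr.V \<gamma> 0 = V0" for \<gamma> by (simp add: pr.V_def V0_def pr.X_0)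
      \<comment> \<open>Division of the summed drift by \<open>\<gamma> * c\<close>: the initial
        moment, which does not depend on \<open>\<gamma>\<close>, gains a factor
        \<open>1 / \<gamma>\<close>, and \<open>\<gamma>\<^sup>2\<close> loses one power.\<close>
      have "(\<Sum>k=0..n. \<integral>\<omega>. max 0 (infdist (X \<gamma> X0 k \<omega>) S - \<epsilon>) \<partial>P)
          \<le> V0 / c / \<gamma> + real (n + 1) * (C / c * \<gamma>)" if \<gamma>: "\<gamma> \<in> {0<..\<gamma>0}" for \<gamma> n
      proof -
        let ?s = "\<Sum>k=0..n. \<integral>\<omega>. max 0 (infdist (X \<gamma> X0 k \<omega>) S - \<epsilon>) \<partial>P"
        have "\<gamma> * c * ?s \<le> pr.V \<gamma> 0 + real (n + 1) * (C * \<gamma>\<^sup>2)"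
          unfolding X_proc
        proof (rule pr.drift_sum)
          show "(\<lambda>x. max 0 (infdist x S - \<epsilon>)) \<in> borel_measurable borel"
            by (intro borel_measurable_continuous_onI continuous_intros)
        qed (use \<gamma> c drift in auto)
        moreover have "\<gamma> * c * (V0 / c / \<gamma>) = V0" "\<gamma> * c * (N * (C / c * \<gamma>)) = N * (C * \<gamma>\<^sup>2)" for N
          using \<gamma> c by (simp_all add: power2_eq_square)
        ultimately have "\<gamma> * c * ?s \<le> \<gamma> * c * (V0 / c / \<gamma> + real (n + 1) * (C / c * \<gamma>))"
          unfolding V0 by (simp only: distrib_left)
        then show ?thesis using \<gamma> c by simp
      qed
      moreover have "0 \<le> V0" unfolding V0_def by (intro integral_nonneg_AE) auto
      ultimately show ?thesis
        using c by - (rule exI[of _ "V0 / c"], rule exI[of _ "C / c"], rule exI[of _ \<gamma>0], auto)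
    qed
    have Y: "Xbar \<gamma> X0 n = (\<lambda>\<omega>. (1 / real n) *\<^sub>R (\<Sum>k=1..n. X \<gamma> X0 k \<omega>))" for \<gamma> n
      by (intro ext) (rule Xbar_eq)
    note limits = ergodic_limits[where X = "\<lambda>\<gamma>. X \<gamma> X0", OF P X_int \<open>convex S\<close> \<open>S \<noteq> {}\<close> avg]
    show "(\<forall>\<epsilon>>0. ((\<lambda>\<gamma>. limsup (\<lambda>n. ereal (1 / real (n + 1) *
            (\<Sum>k=0..n. measure P {\<omega> \<in> space P.
               infdist (X \<gamma> X0 k \<omega>) (Argmin ?H) > \<epsilon>})))) \<longlongrightarrow> 0) (at_right 0)) \<and>
      (supercoercive ?H \<longrightarrow>
        (\<forall>\<epsilon>>0.
          ((\<lambda>\<gamma>. limsup (\<lambda>n. ereal (measure P {\<omega> \<in> space P.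
               infdist (Xbar \<gamma> X0 n \<omega>) (Argmin ?H) \<ge> \<epsilon>}))) \<longlongrightarrow> 0) (at_right 0)) \<and>
        (\<forall>\<gamma>>0. \<forall>n\<ge>1. integrable P (Xbar \<gamma> X0 n)) \<and>
        ((\<lambda>\<gamma>. limsup (\<lambda>n. ereal (infdist (\<integral>\<omega>. Xbar \<gamma> X0 n \<omega> \<partial>P)
               (Argmin ?H)))) \<longlongrightarrow> 0) (at_right 0))"
      unfolding S_def[symmetric] Y
      by (intro conjI impI allI limits)
  qed
qed

end
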